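(* $\mathrm{regRD}<\mathrm{regWRTI}$; that is, regWRTI p-simulates regRD, but regRD does not simulate regWRTI.
   Context: Clauses are finite sets of literals; $\Box$ is the empty clause. Resolution: from $C_0\ni x$, $C_1\ni\overline x$ infer $(C_0\setminus\{x\})\cup(C_1\setminus\{\overline x\})$; w-resolution: the same inference from arbitrary $C_0,C_1$ and a variable $x$. regRD: refutations of a set $F$ of clauses given as a finite dag of clause-labeled nodes with a unique out-degree-$0$ node labeled $\Box$, in-degree-$0$ nodes labeled by clauses of $F$, every other node of in-degree $2$ labeled by a variable $x$ and the resolvent on $x$ of its predecessors' clauses, such that for each variable $x$ every path contains at most one node labeled $x$. regWRTI: an ordered binary tree $T$ with post-order $<_T$ (left subtree, then right subtree, then the node) where each leaf $v$ is labeled by a clause of $F$ or by a clause labeling some input-derived node $u<_T v$, each internal node is labeled by a variable $x$ and the w-resolvent on $x$ of its children's clauses, the root is labeled $\Box$, and no leaf-to-root path contains two inferences on the same variable. A node is input-derived if the subtree rooted at it is an input resolution tree: a tree using only genuine resolution in which every internal node has a leaf child. Size = number of nodes. $R$ simulates $Q$ if there is a polynomial $p$ such that whenever $F$ has a $Q$-refutation of size $n$ it has an $R$-refutation of size $\le p(n)$; p-simulates if additionally the $R$-refutation is computable in polynomial time from the $Q$-refutation. $Q<R$ means $R$ p-simulates $Q$ but $Q$ does not simulate $R$. *)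

theory Defs
  imports Main "HOL-Library.FSet" "HOL-Computational_Algebra.Polynomial"
begin

section \<open>Clauses and resolution\<close>

datatype literal = Pos nat | Neg nat

type_synonym clause = "literal fset"

definition resolvent :: "nat \<Rightarrow> clause \<Rightarrow> clause \<Rightarrow> clause" where
  "resolvent x C0 C1 = (C0 |-| {|Pos x|}) |\<union>| (C1 |-| {|Neg x|})"

text \<open>The left-to-right order of the children of a node of an ordered tree determines the
  post-order but says nothing about polarity: either child may be the premise from which
  \<open>Pos x\<close> is removed. Hence both predicates are symmetric in \<open>C\<close> and \<open>D\<close>.\<close>

definition is_resolvent :: "nat \<Rightarrow> clause \<Rightarrow> clause \<Rightarrow> clause \<Rightarrow> bool" where
  "is_resolvent x C D E \<longleftrightarrow>
     (Pos x |\<in>| C \<and> Neg x |\<in>| D \<and> E = resolvent x C D) \<or>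
     (Pos x |\<in>| D \<and> Neg x |\<in>| C \<and> E = resolvent x D C)"

definition is_w_resolvent :: "nat \<Rightarrow> clause \<Rightarrow> clause \<Rightarrow> clause \<Rightarrow> bool" where
  "is_w_resolvent x C D E \<longleftrightarrow> E = resolvent x C D \<or> E = resolvent x D C"


section \<open>Regular dag-like resolution\<close>

text \<open>The nodes of a dag are the positions of a list. A derived node stores its variable, its
  clause and the positions of its two predecessors; the order of the list need not be
  topological.\<close>

datatype dag_node = Source clause | Derived nat clause nat nat

type_synonym dag = "dag_node list"

fun node_clause :: "dag_node \<Rightarrow> clause" where
  "node_clause (Source C) = C"
| "node_clause (Derived x C i j) = C"

fun node_var :: "dag_node \<Rightarrow> nat option" where
  "node_var (Source C) = None"
| "node_var (Derived x C i j) = Some x"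

fun preds :: "dag_node \<Rightarrow> nat set" where
  "preds (Source C) = {}"
| "preds (Derived x C i j) = {i, j}"

definition edges :: "dag \<Rightarrow> (nat \<times> nat) set" where
  "edges D = {(u, v). v < length D \<and> u \<in> preds (D ! v)}"

fun correct_node :: "clause set \<Rightarrow> dag \<Rightarrow> dag_node \<Rightarrow> bool" where
  "correct_node F D (Source C) \<longleftrightarrow> C \<in> F"
| "correct_node F D (Derived x C i j) \<longleftrightarrow>
     i < length D \<and> j < length D \<and> i \<noteq> j \<and>
     is_resolvent x (node_clause (D ! i)) (node_clause (D ! j)) C"

definition dag_path :: "dag \<Rightarrow> nat list \<Rightarrow> bool" where
  "dag_path D p \<longleftrightarrow> set p \<subseteq> {..<length D} \<and> successively (\<lambda>u v. (u, v) \<in> edges D) p"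

definition regular_dag :: "dag \<Rightarrow> bool" where
  "regular_dag D \<longleftrightarrow>
     (\<forall>p x. dag_path D p \<longrightarrow> length (filter (\<lambda>v. node_var (D ! v) = Some x) p) \<le> 1)"

definition regRD_refutation :: "clause set \<Rightarrow> dag \<Rightarrow> bool" where
  "regRD_refutation F D \<longleftrightarrow>
     acyclic (edges D) \<and>
     (\<exists>s<length D. node_clause (D ! s) = {||} \<and>
        (\<forall>v<length D. (\<forall>w. (v, w) \<notin> edges D) \<longleftrightarrow> v = s)) \<and>
     (\<forall>v<length D. correct_node F D (D ! v)) \<and>
     regular_dag D"


section \<open>Regular w-resolution trees with input lemmas\<close>

datatype rtree = Leaf clause | Node nat clause rtree rtree

fun root_clause :: "rtree \<Rightarrow> clause" where
  "root_clause (Leaf C) = C"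
| "root_clause (Node x C l r) = C"

text \<open>The nodes of a tree are identified with the positions of this list, in which every node
  is represented by the subtree rooted at it.\<close>

fun post_order :: "rtree \<Rightarrow> rtree list" where
  "post_order (Leaf C) = [Leaf C]"
| "post_order (Node x C l r) = post_order l @ post_order r @ [Node x C l r]"

fun is_leaf :: "rtree \<Rightarrow> bool" where
  "is_leaf (Leaf C) \<longleftrightarrow> True"
| "is_leaf (Node x C l r) \<longleftrightarrow> False"

fun input_resolution_tree :: "rtree \<Rightarrow> bool" where
  "input_resolution_tree (Leaf C) \<longleftrightarrow> True"
| "input_resolution_tree (Node x C l r) \<longleftrightarrow>
     is_resolvent x (root_clause l) (root_clause r) C \<and> (is_leaf l \<or> is_leaf r) \<and>
     input_resolution_tree l \<and> input_resolution_tree r"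

definition leaves_correct :: "clause set \<Rightarrow> rtree \<Rightarrow> bool" where
  "leaves_correct F T \<longleftrightarrow>
     (let N = post_order T in
      \<forall>v<length N. \<forall>C. N ! v = Leaf C \<longrightarrow>
        C \<in> F \<or> (\<exists>u<v. input_resolution_tree (N ! u) \<and> root_clause (N ! u) = C))"

fun inferences_correct :: "rtree \<Rightarrow> bool" where
  "inferences_correct (Leaf C) \<longleftrightarrow> True"
| "inferences_correct (Node x C l r) \<longleftrightarrow>
     is_w_resolvent x (root_clause l) (root_clause r) C \<and>
     inferences_correct l \<and> inferences_correct r"

text \<open>The sequences of inference variables on the paths between the root and a leaf.\<close>

fun branch_vars :: "rtree \<Rightarrow> nat list set" where
  "branch_vars (Leaf C) = {[]}"
| "branch_vars (Node x C l r) = (#) x ` (branch_vars l \<union> branch_vars r)"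

definition regWRTI_refutation :: "clause set \<Rightarrow> rtree \<Rightarrow> bool" where
  "regWRTI_refutation F T \<longleftrightarrow>
     root_clause T = {||} \<and> inferences_correct T \<and> leaves_correct F T \<and>
     (\<forall>p\<in>branch_vars T. distinct p)"


section \<open>Refutations as words\<close>

datatype symbol = Zero | One | Open | Close

type_synonym word = "symbol list"

text \<open>Binary notation, least significant bit first.\<close>

fun bits :: "nat \<Rightarrow> word" where
  "bits n = (if n = 0 then [] else (if odd n then One else Zero) # bits (n div 2))"

declare bits.simps [simp del]

definition bracket :: "word list \<Rightarrow> word" where
  "bracket ws = Open # concat ws @ [Close]"

definition nat_word :: "nat \<Rightarrow> word" where
  "nat_word n = bracket [bits n]"

fun literal_index :: "literal \<Rightarrow> nat" where
  "literal_index (Pos x) = 2 * x"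
| "literal_index (Neg x) = 2 * x + 1"

definition clause_word :: "clause \<Rightarrow> word" where
  "clause_word C = bracket (map nat_word (sorted_list_of_fset (literal_index |`| C)))"

fun node_word :: "dag_node \<Rightarrow> word" where
  "node_word (Source C) = bracket [clause_word C]"
| "node_word (Derived x C i j) = bracket [nat_word x, clause_word C, nat_word i, nat_word j]"

definition dag_word :: "dag \<Rightarrow> word" where
  "dag_word D = bracket (map node_word D)"

fun tree_word :: "rtree \<Rightarrow> word" where
  "tree_word (Leaf C) = bracket [clause_word C]"
| "tree_word (Node x C l r) = bracket [nat_word x, clause_word C, tree_word l, tree_word r]"


section \<open>Polynomial-time computability\<close>

text \<open>While-programs over finitely many stacks of symbols from a fixed finite alphabet, every
  elementary command and every test costing one unit of time. This is the multitape Turing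
  machine in structured form: a stack is a one-way infinite tape, a tape is a pair of stacks, and
  the finite control can be kept on a stack of bounded height, so the two models simulate each
  other with constant-factor overhead.\<close>

datatype program =
    Skip
  | Push nat symbol
  | Pop nat
  | Seq program program
  | Cond nat symbol program program  \<comment> \<open>tests the top of a stack; an empty stack fails the test\<close>
  | Loop nat program                 \<comment> \<open>repeats while the stack is nonempty\<close>

type_synonym store = "nat \<Rightarrow> word"

text \<open>\<open>exec c s t s'\<close>: started in \<open>s\<close>, program \<open>c\<close> halts in \<open>s'\<close> after exactly \<open>t\<close> steps.\<close>

inductive exec :: "program \<Rightarrow> store \<Rightarrow> nat \<Rightarrow> store \<Rightarrow> bool" where
  skip: "exec Skip s 1 s"
| push: "exec (Push r a) s 1 (s(r := a # s r))"
| pop: "exec (Pop r) s 1 (s(r := tl (s r)))"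
| seq: "exec c s t1 s1 \<Longrightarrow> exec d s1 t2 s2 \<Longrightarrow> exec (Seq c d) s (t1 + t2) s2"
| cond_true: "s r \<noteq> [] \<Longrightarrow> hd (s r) = a \<Longrightarrow> exec c s t s1 \<Longrightarrow> exec (Cond r a c d) s (Suc t) s1"
| cond_false: "s r = [] \<or> hd (s r) \<noteq> a \<Longrightarrow> exec d s t s1 \<Longrightarrow> exec (Cond r a c d) s (Suc t) s1"
| loop_end: "s r = [] \<Longrightarrow> exec (Loop r c) s 1 s"
| loop_step: "s r \<noteq> [] \<Longrightarrow> exec c s t1 s1 \<Longrightarrow> exec (Loop r c) s1 t2 s2 \<Longrightarrow>
    exec (Loop r c) s (Suc (t1 + t2)) s2"

definition input_store :: "word \<Rightarrow> store" where
  "input_store w = (\<lambda>_. [])(0 := w)"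

text \<open>Input and output are the contents of stack 0, and the running time is measured in the
  length of the input word.\<close>

definition polytime_computable_on ::
    "'a set \<Rightarrow> ('a \<Rightarrow> word) \<Rightarrow> ('b \<Rightarrow> word) \<Rightarrow> ('a \<Rightarrow> 'b) \<Rightarrow> bool" where
  "polytime_computable_on A code_in code_out f \<longleftrightarrow>
     (\<exists>c (p :: nat poly). \<forall>a\<in>A. \<exists>t s.
        exec c (input_store (code_in a)) t s \<and> s 0 = code_out (f a) \<and>
        t \<le> poly p (length (code_in a)))"


section \<open>Simulations between refutation systems\<close>

record 'r refutation_system =
  refutes :: "clause set \<Rightarrow> 'r \<Rightarrow> bool"
  nodes :: "'r \<Rightarrow> nat"
  code :: "'r \<Rightarrow> word"

definition regRD :: "dag refutation_system" where
  "regRD = \<lparr>refutes = regRD_refutation, nodes = length, code = dag_word\<rparr>"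

definition regWRTI :: "rtree refutation_system" where
  "regWRTI = \<lparr>refutes = regWRTI_refutation, nodes = (\<lambda>T. length (post_order T)), code = tree_word\<rparr>"

definition simulates :: "'r refutation_system \<Rightarrow> 'q refutation_system \<Rightarrow> bool" where
  "simulates R Q \<longleftrightarrow>
     (\<exists>p :: nat poly. \<forall>F n.
        (\<exists>\<pi>. refutes Q F \<pi> \<and> nodes Q \<pi> = n) \<longrightarrow>
        (\<exists>\<rho>. refutes R F \<rho> \<and> nodes R \<rho> \<le> poly p n))"

definition p_simulates :: "'r refutation_system \<Rightarrow> 'q refutation_system \<Rightarrow> bool" where
  "p_simulates R Q \<longleftrightarrow>
     (\<exists>f (p :: nat poly).
        (\<forall>F \<pi>. refutes Q F \<pi> \<longrightarrow> refutes R F (f \<pi>) \<and> nodes R (f \<pi>) \<le> poly p (nodes Q \<pi>)) \<and>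
        polytime_computable_on {\<pi>. \<exists>F. refutes Q F \<pi>} (code Q) (code R) f)"

definition strictly_weaker :: "'q refutation_system \<Rightarrow> 'r refutation_system \<Rightarrow> bool" where
  "strictly_weaker Q R \<longleftrightarrow> p_simulates R Q \<and> \<not> simulates Q R"

end

theory Submission imports Defs
begin

text \<open>Simulation. Unfold the dag depth-first, turning every later visit of a node into a leaf. A
  lemma must be input-derived, but the first derivation of \<open>C\<close> from \<open>A\<close> and \<open>B\<close> need
  not be; so it is combined with a second copy whose premises are now the lemmas \<open>A\<close> and
  \<open>B\<close>, by a w-resolution of \<open>C\<close> with itself on a fresh variable. A program does this with
  an agenda stack, marking a visited node by turning it into a source.

  Separation. Take the ordering principle, guard each clause ``\<open>a\<close> is not minimal'' by fresh
  selectors that pick a comparison \<open>y\<close> on which one must branch before using the clause, and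
  add a unit clause \<open>{q}\<close>. By w-resolution with \<open>{q}\<close>, a side tree can learn a clause
  and then weaken it away, so short general resolution refutations become short regWRTI
  refutations. In a regular dag an adversary answers comparisons of two so far unbeaten elements by
  tossing a coin, the loser being put on top of all remaining elements, and selectors at random.
  After \<open>t\<close> coins, the current clause either contains all comparisons decided by coins or has
  forgotten such a comparison \<open>y\<close>, which by regularity can never be queried again; then nearly
  all elements must occur in it with a selector, since otherwise an untouched element could be made
  minimal with its guard set to \<open>y\<close>. Each clause is thus reached with probability at most
  \<open>2\<^sup>-\<^sup>t\<close>.\<close>

section \<open>Tree lemmas and regular dags\<close>

text \<open>Without guards the ordering principle would not separate the systems: repeatedly
  eliminating the largest element refutes it regularly in polynomial size. The guards break this.
  The two clauses selected by a comparison y must be resolved on y near the sources, although y is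
  resolved on once more when its larger element is eliminated. In a tree with lemmas, regularity
  only concerns branches, and a branch ends at the leaf that cites a lemma, so the earlier use of y
  is not seen by the later one. For this reason a derivation is cut into single inferences, each in
  a side tree of its own, and no information passes through the roots of these trees. The lower
  bound is a count rather than a probability. With s selectors there are 2^t * 2^s pairs of a coin
  sequence and a set of selectors; each pair leads to a node, and no node is reached by more than
  2^s pairs. A node that has forgotten a coin must know t selectors, and those t bits pay for the t
  coins.\<close>

definition lemmas_of :: "rtree list \<Rightarrow> clause set" where
  "lemmas_of N = {root_clause t |t. t \<in> set N \<and> input_resolution_tree t}"

abbreviation tree_lemmas :: "rtree \<Rightarrow> clause set" where
  "tree_lemmas T \<equiv> lemmas_of (post_order T)"

lemma lemmas_of_append [simp]: "lemmas_of (xs @ ys) = lemmas_of xs \<union> lemmas_of ys"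
  by (auto simp: lemmas_of_def)

lemma tree_lemmas_Node:
  "tree_lemmas (Node x C l r) = tree_lemmas l \<union> tree_lemmas r \<union>
     (if input_resolution_tree (Node x C l r) then {C} else {})"
  unfolding lemmas_of_def by (auto; force)

lemma tree_lemmas_Leaf [simp]: "tree_lemmas (Leaf C) = {C}"
  by (auto simp: lemmas_of_def)

text \<open>Recursive form of \<open>leaves_correct\<close>: the clauses that may be cited are
  threaded through the tree in post-order, so inductions on trees need no positions.\<close>

fun supported :: "clause set \<Rightarrow> rtree \<Rightarrow> bool" where
  "supported K (Leaf C) \<longleftrightarrow> C \<in> K"
| "supported K (Node x C l r) \<longleftrightarrow> supported K l \<and> supported (K \<union>
    tree_lemmas l) r"

lemma supported_imp_leaves_correct:
  assumes "supported F T"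
  shows "leaves_correct F T"
proof -
  define ok where "ok K N \<longleftrightarrow> (\<forall>v<length N. \<forall>C. N ! v = Leaf C
      \<longrightarrow>
      C \<in> K \<or> (\<exists>u<v. input_resolution_tree (N ! u) \<and> root_clause (N ! u) =
          C))" for K N
  have append: "ok K (xs @ ys)" if "ok K xs" "ok (K \<union> lemmas_of xs) ys" for K xs ys
    unfolding ok_def
  proof (intro allI impI)
    fix v C assume v: "v < length (xs @ ys)" "(xs @ ys) ! v = Leaf C"
    show "C \<in> K \<or> (\<exists>u<v. input_resolution_tree ((xs @ ys) ! u) \<and> root_clause
        ((xs @ ys) ! u) = C)"
    proof (cases "v < length xs")
      case True
      with v that(1) have "C \<in> K \<or> (\<exists>u<v. input_resolution_tree (xs ! u) \<and>
          root_clause (xs ! u) = C)"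
        by (auto simp: ok_def nth_append)
      then show ?thesis using True by (metis nth_append order.strict_trans)
    next
      case False
      with v have "v - length xs < length ys" "ys ! (v - length xs) = Leaf C"
        by (auto simp: nth_append)
      with that(2) consider "C \<in> K" | "C \<in> lemmas_of xs"
        | u where "u < v - length xs" "input_resolution_tree (ys ! u)" "root_clause (ys ! u) = C"
        unfolding ok_def by blast
      then show ?thesis
      proof cases
        case 2
        then obtain u where "u < length xs" "input_resolution_tree (xs ! u)" "root_clause (xs ! u) = C"
          by (auto simp: lemmas_of_def in_set_conv_nth)
        then show ?thesis using False by (intro disjI2 exI[of _ u]) (auto simp: nth_append)
      next
        case 3
        then show ?thesis using False by (intro disjI2 exI[of _ "length xs + u"]) auto
      qed auto
    qed
  qed
  have "supported K T \<Longrightarrow> ok K (post_order T)" for K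
  proof (induction T arbitrary: K)
    case (Leaf C)
    then show ?case by (auto simp: ok_def)
  next
    case (Node x C l r)
    have "ok K' [Node x C l r]" for K' by (auto simp: ok_def)
    with Node show ?case by (auto intro!: append simp: Un_assoc)
  qed
  from this[OF assms] show ?thesis by (auto simp: leaves_correct_def ok_def Let_def)
qed

lemma dag_path_from_trancl:
  assumes "(w, v) \<in> (edges D)\<^sup>+" "acyclic (edges D)" "\<forall>v<length D. correct_node F
      D (D ! v)"
  shows "\<exists>p. dag_path D (w # p @ [v])"
  using assms(1)
proof (induction rule: trancl_induct)
  case (base y)
  have "w < length D" using base assms(3)
    by (cases "D ! y") (auto simp: edges_def)
  then show ?case using base by (intro exI[of _ "[]"]) (auto simp: dag_path_def edges_def)
next
  case (step y z)
  then obtain p where "dag_path D (w # p @ [y])" by auto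
  then show ?case using step(2)
    by (intro exI[of _ "p @ [y]"])
      (auto simp: dag_path_def edges_def successively_append_iff simp flip: append_Cons)
qed

text \<open>A nonempty chain of edges is a path, on which two ends with the same variable would
  count twice. From here on reachability replaces explicit paths.\<close>

lemma regular_dag_trancl:
  assumes "regular_dag D" "acyclic (edges D)" "\<forall>v<length D. correct_node F D (D ! v)"
    and "(w, v) \<in> (edges D)\<^sup>+" "node_var (D ! w) = Some x"
  shows "node_var (D ! v) \<noteq> Some x"
proof
  assume v: "node_var (D ! v) = Some x"
  obtain p where "dag_path D (w # p @ [v])" using dag_path_from_trancl assms by blast
  then have "length (filter (\<lambda>v. node_var (D ! v) = Some x) (w # p @ [v])) \<le> 1"
    using assms(1) unfolding regular_dag_def by blast
  then show False using v assms(5) by simp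
qed

lemma correct_nodeD:
  assumes "\<forall>v<length D. correct_node F D (D ! v)" "v < length D" "D ! v = Derived x C i j"
  shows "i < length D" "j < length D" "(i, v) \<in> edges D" "(j, v) \<in> edges D"
    "is_resolvent x (node_clause (D ! i)) (node_clause (D ! j)) C"
  using assms by (auto simp: edges_def dest!: spec[of _ v])

lemma wf_edges: "acyclic (edges D) \<Longrightarrow> \<forall>v<length D. correct_node F D (D ! v)
    \<Longrightarrow> wf (edges D)"
proof (rule finite_acyclic_wf)
  assume c: "\<forall>v<length D. correct_node F D (D ! v)"
  have "edges D \<subseteq> {..<length D} \<times> {..<length D}"
  proof (auto simp: edges_def)
    fix a b assume "b < length D" "a \<in> preds (D ! b)"
    with c show "a < length D" by (cases "D ! b") auto
  qed
  then show "finite (edges D)" by (rule finite_subset) auto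
qed

section \<open>Unfolding a regular dag into a tree\<close>

text \<open>In binary this number consists of \<open>k\<close> ones, so a program writes it by
  copying a unary counter. It exceeds every number with fewer than \<open>k\<close> bits.\<close>

definition fresh :: "nat \<Rightarrow> nat" where "fresh k = 2 ^ k - 1"

lemma fresh_mono: "k \<le> l \<Longrightarrow> fresh k \<le> fresh l"
  unfolding fresh_def by (intro diff_le_mono power_increasing) auto

lemma fresh_eq_iff [simp]: "fresh k = fresh l \<longleftrightarrow> k = l"
proof -
  have "(2::nat) ^ k \<ge> 1" "(2::nat) ^ l \<ge> 1" by auto
  then have "fresh k = fresh l \<longleftrightarrow> (2::nat) ^ k = 2 ^ l" unfolding fresh_def by
      linarith
  then show ?thesis by simp
qed

text \<open>\<open>D\<close> and \<open>k\<close> are the state of the depth-first traversal: the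
  unvisited inferences are the derived nodes, and \<open>k\<close> is the exponent of the next fresh
  variable. A node is marked before its premises are visited, which is harmless because the dag is
  acyclic. Both copies follow the same rule, so that a program can treat them alike; that the second
  collapses to leaves is a consequence.\<close>

inductive expand :: "dag \<Rightarrow> nat \<Rightarrow> nat \<Rightarrow> rtree \<Rightarrow> dag
    \<Rightarrow> nat \<Rightarrow> bool" where
  expand_Source: "D ! v = Source C \<Longrightarrow> expand D k v (Leaf C) D k"
| expand_Derived: "D ! v = Derived x C i j \<Longrightarrow>
    expand (D[v := Source C]) (Suc k) i Ti D1 k1 \<Longrightarrow> expand D1 k1 j Tj D2 k2
        \<Longrightarrow>
    expand D2 k2 i Ti' D3 k3 \<Longrightarrow> expand D3 k3 j Tj' D4 k4 \<Longrightarrow>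
    expand D k v (Node (fresh k) C (Node x C Ti Tj) (Node x C Ti' Tj')) D4 k4"

definition derived_count :: "dag \<Rightarrow> nat" where
  "derived_count D = length (filter (\<lambda>n. node_var n \<noteq> None) D)"

lemma derived_count_update:
  "v < length D \<Longrightarrow> D ! v = Derived x C i j \<Longrightarrow> derived_count D = Suc
      (derived_count (D[v := Source C']))"
  by (subst id_take_nth_drop[of v D], simp, subst upd_conv_take_nth_drop)
    (auto simp: derived_count_def)

lemma derived_count_le: "derived_count D \<le> length D"
  by (simp add: derived_count_def)

locale regRD_dag =
  fixes F :: "clause set" and D0 :: dag
  assumes refutation: "regRD_refutation F D0"
begin

lemma acyclic: "acyclic (edges D0)"
  and correct: "\<forall>v<length D0. correct_node F D0 (D0 ! v)"
  and regular: "regular_dag D0"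
  using refutation by (auto simp: regRD_refutation_def)

definition marked :: "dag \<Rightarrow> bool" where
  "marked D \<longleftrightarrow> length D = length D0 \<and>
     (\<forall>v<length D0. D ! v = D0 ! v \<or> D ! v = Source (node_clause (D0 ! v)))"

lemma marked_D0: "marked D0"
  by (simp add: marked_def)

lemma marked_Derived:
  assumes "marked D" "v < length D0" "D ! v = Derived x C i j"
  shows "D0 ! v = Derived x C i j" "i < length D0" "j < length D0" "(i, v) \<in> edges D0"
    "(j, v) \<in> edges D0" "is_resolvent x (node_clause (D0 ! i)) (node_clause (D0 ! j)) C"
    "marked (D[v := Source C])"
proof -
  show *: "D0 ! v = Derived x C i j" using assms by (auto simp: marked_def)
  show "i < length D0" "j < length D0" "(i, v) \<in> edges D0" "(j, v) \<in> edges D0"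
    "is_resolvent x (node_clause (D0 ! i)) (node_clause (D0 ! j)) C"
    using correct_nodeD[OF correct assms(2) *] by auto
  show "marked (D[v := Source C])" using assms * by (auto simp: marked_def nth_list_update)
qed

text \<open>Where the 6 comes from: an expansion creates three tree nodes and four subtrees, each of
  which starts at 1, and 3 + 4 = 1 + 6. One derived node and one fresh variable are used up each
  time.\<close>

lemma expand_marked:
  "expand D k v T D' k' \<Longrightarrow> marked D \<Longrightarrow> v < length D0 \<Longrightarrow>
     marked D' \<and> root_clause T = node_clause (D0 ! v) \<and> inferences_correct T \<and>
     D' ! v = Source (node_clause (D0 ! v)) \<and> (\<forall>w C. D ! w = Source C
         \<longrightarrow> D' ! w = Source C) \<and>
     length (post_order T) + 6 * derived_count D' = 1 + 6 * derived_count D \<and>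
     k' + derived_count D' = k + derived_count D"
proof (induction rule: expand.induct)
  case (expand_Source D v C k)
  then show ?case by (auto simp: marked_def)
next
  case (expand_Derived D v x C i j k Ti D1 k1 Tj D2 k2 Ti' D3 k3 Tj' D4 k4)
  note m = marked_Derived[OF expand_Derived.prems expand_Derived.hyps(1)]
  have len: "length D = length D0" using expand_Derived.prems by (simp add: marked_def)
  have w: "is_w_resolvent (fresh k) C C C" by (auto simp: is_w_resolvent_def resolvent_def)
  have r: "is_w_resolvent x (node_clause (D0 ! i)) (node_clause (D0 ! j)) C"
    using m(6) by (auto simp: is_resolvent_def is_w_resolvent_def)
  note 1 = expand_Derived.IH(1)[OF m(7,2)]
  note 2 = expand_Derived.IH(2)[OF conjunct1[OF 1] m(3)]
  note 3 = expand_Derived.IH(3)[OF conjunct1[OF 2] m(2)]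
  note 4 = expand_Derived.IH(4)[OF conjunct1[OF 3] m(3)]
  have v: "D4 ! v = Source C"
    using 1 2 3 4 expand_Derived.prems(2) len by (metis nth_list_update_eq)
  have "D4 ! u = Source E" if "D ! u = Source E" for u E
  proof -
    have "u \<noteq> v" using that expand_Derived.hyps(1) by auto
    then show ?thesis using that 1 2 3 4 by simp
  qed
  moreover have "derived_count D = Suc (derived_count (D[v := Source C]))"
    using derived_count_update expand_Derived.hyps(1) expand_Derived.prems(2) len by simp
  ultimately show ?case using 1 2 3 4 m(1) w r v by simp
qed

lemma expand_exists:
  "v < length D0 \<Longrightarrow> marked D \<Longrightarrow> \<exists>T D' k'. expand D k v T D' k'"
proof (induction v arbitrary: D k rule: wf_induct_rule[OF wf_edges[OF acyclic correct]])
  case (1 v)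
  show ?case
  proof (cases "D ! v")
    case (Source C)
    then show ?thesis using expand_Source by blast
  next
    case (Derived x C i j)
    note m = marked_Derived[OF 1(3,2) Derived]
    obtain Ti D1 k1 where e1: "expand (D[v := Source C]) (Suc k) i Ti D1 k1"
      using 1(1)[OF m(4) m(2) m(7)] by blast
    then have m1: "marked D1" using expand_marked m by blast
    obtain Tj D2 k2 where e2: "expand D1 k1 j Tj D2 k2" using 1(1)[OF m(5) m(3) m1] by blast
    then have m2: "marked D2" using expand_marked m m1 by blast
    obtain Ti' D3 k3 where e3: "expand D2 k2 i Ti' D3 k3" using 1(1)[OF m(4) m(2) m2] by blast
    then have m3: "marked D3" using expand_marked m m2 by blast
    obtain Tj' D4 k4 where e4: "expand D3 k3 j Tj' D4 k4" using 1(1)[OF m(5) m(3) m3] by blast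
    show ?thesis using expand_Derived[OF Derived e1 e2 e3 e4] by blast
  qed
qed

definition vars_above :: "nat \<Rightarrow> nat set" where
  "vars_above v = {x. \<exists>w. (w, v) \<in> (edges D0)\<^sup>* \<and> w < length D0 \<and>
      node_var (D0 ! w) = Some x}"

lemma vars_above_pred: "(i, v) \<in> edges D0 \<Longrightarrow> vars_above i \<subseteq> vars_above v"
  by (auto simp: vars_above_def intro: rtrancl_into_rtrancl)

lemma var_notin_vars_above_pred:
  assumes "(i, v) \<in> edges D0" "node_var (D0 ! v) = Some x"
  shows "x \<notin> vars_above i"
proof
  assume "x \<in> vars_above i"
  then obtain w where w: "(w, i) \<in> (edges D0)\<^sup>*" "node_var (D0 ! w) = Some x"
    by (auto simp: vars_above_def)
  then have "(w, v) \<in> (edges D0)\<^sup>+" using assms(1) by auto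
  then show False using regular_dag_trancl[OF regular acyclic correct _ w(2)] assms(2) by blast
qed

text \<open>A branch carries two kinds of variables. Those of the dag are distinct because the
  variable of a node does not occur above its premises. The fresh ones come from the counter range
  consumed by the subtree, which lies beyond \<open>k\<close>, and they exceed all dag variables as
  the counter starts at \<open>L\<close> or later.\<close>

lemma expand_distinct:
  assumes "\<forall>v<length D0. \<forall>x. node_var (D0 ! v) = Some x \<longrightarrow> x < fresh L"
  shows "expand D k v T D' k' \<Longrightarrow> marked D \<Longrightarrow> v < length D0
      \<Longrightarrow> L \<le> k \<Longrightarrow>
     k \<le> k' \<and> (\<forall>p\<in>branch_vars T. distinct p \<and> set p \<subseteq>
         vars_above v \<union> fresh ` {k..<k'})"
proof (induction rule: expand.induct)
  case (expand_Source D v C k)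
  then show ?case by auto
next
  case (expand_Derived D v x C i j k Ti D1 k1 Tj D2 k2 Ti' D3 k3 Tj' D4 k4)
  note m = marked_Derived[OF expand_Derived.prems(1,2) expand_Derived.hyps(1)]
  have m1: "marked D1" using expand_marked[OF expand_Derived.hyps(2) m(7,2)] by simp
  have m2: "marked D2" using expand_marked[OF expand_Derived.hyps(3) m1 m(3)] by simp
  have m3: "marked D3" using expand_marked[OF expand_Derived.hyps(4) m2 m(2)] by simp
  note 1 = expand_Derived.IH(1)[OF m(7,2)]
  note 2 = expand_Derived.IH(2)[OF m1 m(3)]
  note 3 = expand_Derived.IH(3)[OF m2 m(2)]
  note 4 = expand_Derived.IH(4)[OF m3 m(3)]
  have le: "Suc k \<le> k1" "k1 \<le> k2" "k2 \<le> k3" "k3 \<le> k4"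
    using 1 2 3 4 expand_Derived.prems(3) by auto
  have small: "y < fresh L" if "y \<in> vars_above v" for y
    using that assms by (auto simp: vars_above_def)
  have freshv: "fresh l \<notin> vars_above v" if "l \<ge> k" for l
    using small[of "fresh l"] fresh_mono[of L l] that expand_Derived.prems(3) by auto
  have xv: "x \<in> vars_above v"
    using m(1) expand_Derived.prems(2) by (auto simp: vars_above_def intro!: exI[of _ v])
  have sub: "vars_above i \<subseteq> vars_above v" "vars_above j \<subseteq> vars_above v"
    using vars_above_pred m by auto
  have xnot: "x \<notin> vars_above i" "x \<notin> vars_above j"
    using var_notin_vars_above_pred m by auto
  \<comment> \<open>One statement for all four subtrees: \<open>u\<close> is the premise and
    \<open>{a..<b}\<close> the counter range consumed by its expansion.\<close>
  have *: "distinct (fresh k # x # p) \<and> set (fresh k # x # p) \<subseteq> vars_above v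
      \<union> fresh ` {k..<k4}"
    if "distinct p" "set p \<subseteq> vars_above u \<union> fresh ` {a..<b}" "u = i \<or> u = j"
        "a \<ge> Suc k" "b \<le> k4"
    for p u a b
  proof -
    have su: "vars_above u \<subseteq> vars_above v" "x \<notin> vars_above u" using sub xnot
        that(3) by auto
    have "fresh k \<noteq> x" using freshv[of k] xv by auto
    moreover have "x \<notin> fresh ` {a..<b}" using freshv xv that(4) by force
    moreover have "fresh k \<notin> vars_above u" using freshv[of k] su by auto
    moreover have "fresh k \<notin> fresh ` {a..<b}" using that(4) by auto
    moreover have "fresh ` {a..<b} \<subseteq> fresh ` {k..<k4}" using that by (intro image_mono) auto
    moreover have "fresh k \<in> fresh ` {k..<k4}" using le by auto
    ultimately have "fresh k \<notin> set p" "x \<notin> set p" "fresh k \<noteq> x" "fresh k \<in>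
        fresh ` {k..<k4}"
      and "set p \<subseteq> vars_above v \<union> fresh ` {k..<k4}"
      using that(2) su xv by (blast, blast, blast, blast, meson Un_mono order_trans)
    then show ?thesis using that(1) xv by simp
  qed
  have "distinct p \<and> set p \<subseteq> vars_above v \<union> fresh ` {k..<k4}"
    if "p \<in> branch_vars (Node (fresh k) C (Node x C Ti Tj) (Node x C Ti' Tj'))" for p
  proof -
    from that obtain q where p: "p = fresh k # x # q"
      and "q \<in> branch_vars Ti \<or> q \<in> branch_vars Tj \<or> q \<in> branch_vars Ti' \<or>
          q \<in> branch_vars Tj'"
      by auto
    then consider "q \<in> branch_vars Ti" | "q \<in> branch_vars Tj" | "q \<in> branch_vars Ti'"
      | "q \<in> branch_vars Tj'" by blast
    then show ?thesis
    proof cases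
      case 1
      then show ?thesis unfolding p
        using *[of q i "Suc k" k1] expand_Derived.IH(1)[OF m(7,2)] le expand_Derived.prems(3) by auto
    next
      case 2
      then show ?thesis unfolding p
        using *[of q j k1 k2] expand_Derived.IH(2)[OF m1 m(3)] le expand_Derived.prems(3) by auto
    next
      case 3
      then show ?thesis unfolding p
        using *[of q i k2 k3] expand_Derived.IH(3)[OF m2 m(2)] le expand_Derived.prems(3) by auto
    next
      case 4
      then show ?thesis unfolding p
        using *[of q j k3 k4] expand_Derived.IH(4)[OF m3 m(3)] le expand_Derived.prems(3) by auto
    qed
  qed
  then show ?case using le by auto
qed

text \<open>\<open>B\<close> collects the nodes on the current branch: they are marked before their
    clauses have
  been derived.\<close>

lemma expand_supported:
  "expand D k v T D' k' \<Longrightarrow> marked D \<Longrightarrow> v < length D0 \<Longrightarrow>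
     (\<forall>w\<in>B. (w, v) \<notin> (edges D0)\<^sup>*) \<Longrightarrow>
     (\<forall>w<length D0. \<forall>C. w \<notin> B \<longrightarrow> D ! w = Source C
         \<longrightarrow> C \<in> K) \<Longrightarrow>
     supported K T \<and>
     (\<forall>w<length D0. \<forall>C. w \<notin> B \<longrightarrow> D' ! w = Source C
         \<longrightarrow> C \<in> K \<union> tree_lemmas T)"
proof (induction arbitrary: B K rule: expand.induct)
  case (expand_Source D v C k)
  then show ?case by auto
next
  case (expand_Derived D v x C i j k Ti D1 k1 Tj D2 k2 Ti' D3 k3 Tj' D4 k4)
  note m = marked_Derived[OF expand_Derived.prems(1,2) expand_Derived.hyps(1)]
  note e1 = expand_marked[OF expand_Derived.hyps(2) m(7,2)]
  then have m1: "marked D1" by simp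
  note e2 = expand_marked[OF expand_Derived.hyps(3) m1 m(3)]
  then have m2: "marked D2" by simp
  \<comment> \<open>By now both premises are marked, so their second visits yield leaves. The second
    copy is then a single inference between two leaves, an input tree, and this makes
    \<open>C\<close> citable.\<close>
  have leaf3: "Ti' = Leaf (node_clause (D0 ! i)) \<and> D3 = D2"
    using expand_Derived.hyps(4) e1 e2 by (auto elim: expand.cases)
  have leaf4: "Tj' = Leaf (node_clause (D0 ! j)) \<and> D4 = D2"
    using expand_Derived.hyps(5) e1 e2 leaf3 by (auto elim: expand.cases)
  have len: "length D = length D0" using expand_Derived.prems by (simp add: marked_def)
  let ?B = "insert v B"
  have B: "\<forall>w\<in>?B. (w, u) \<notin> (edges D0)\<^sup>*" if "(u, v) \<in> edges D0" for u
  proof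
    fix w assume "w \<in> ?B"
    show "(w, u) \<notin> (edges D0)\<^sup>*"
    proof
      assume "(w, u) \<in> (edges D0)\<^sup>*"
      then have "(w, v) \<in> (edges D0)\<^sup>+" using that by auto
      then show False using \<open>w \<in> ?B\<close> acyclic expand_Derived.prems(3)
        by (auto simp: acyclic_def dest: trancl_into_rtrancl)
    qed
  qed
  have K0: "\<forall>w<length D0. \<forall>E. w \<notin> ?B \<longrightarrow> D[v := Source C] ! w
      = Source E \<longrightarrow> E \<in> K"
    using expand_Derived.prems(4) by (auto simp: nth_list_update)
  note s1 = expand_Derived.IH(1)[OF m(7,2) B[OF m(4)] K0]
  note s2 = expand_Derived.IH(2)[OF m1 m(3) B[OF m(5)] conjunct2[OF s1]]
  have "i \<notin> ?B" "j \<notin> ?B" using B[OF m(4)] B[OF m(5)] by auto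
  then have ij: "node_clause (D0 ! i) \<in> K \<union> tree_lemmas Ti \<union> tree_lemmas Tj"
     "node_clause (D0 ! j) \<in> K \<union> tree_lemmas Ti \<union> tree_lemmas Tj"
    using s2 e1 e2 m(2,3) by blast+
  let ?U = "Node x C Ti' Tj'"
  let ?T = "Node (fresh k) C (Node x C Ti Tj) ?U"
  have U: "input_resolution_tree ?U" using leaf3 leaf4 m(6) by simp
  have sup: "supported K ?T"
    using s1 s2 ij leaf3 leaf4 by (auto simp: tree_lemmas_Node)
  have C: "C \<in> tree_lemmas ?T" using U by (simp only: tree_lemmas_Node) auto
  have D4: "D4 ! v = Source C"
    using e1 e2 leaf4 expand_Derived.prems(2) len by (metis nth_list_update_eq)
  have sub: "tree_lemmas Ti \<union> tree_lemmas Tj \<subseteq> tree_lemmas ?T"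
    by (simp only: tree_lemmas_Node) auto
  have "\<forall>w<length D0. \<forall>E. w \<notin> B \<longrightarrow> D4 ! w = Source E
      \<longrightarrow> E \<in> K \<union> tree_lemmas ?T"
  proof (intro allI impI)
    fix w E assume w: "w < length D0" "w \<notin> B" "D4 ! w = Source E"
    show "E \<in> K \<union> tree_lemmas ?T"
    proof (cases "w = v")
      case True
      then show ?thesis using D4 w C by simp
    next
      case False
      then have "E \<in> K \<union> tree_lemmas Ti \<union> tree_lemmas Tj"
        using s2 w leaf4 by blast
      then show ?thesis using sub by blast
    qed
  qed
  then show ?case using sup by blast
qed

text \<open>The premises of a genuine resolution contain the resolved literals, so a node with the
  empty clause has no successor. A program may therefore take the first empty clause it meets for
  the sink.\<close>

lemma sink_unique:
  assumes "s < length D0" "node_clause (D0 ! s) = {||}" "u < length D0" "node_clause (D0 ! u) = {||}"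
  shows "s = u"
proof -
  obtain r where r: "\<forall>v<length D0. (\<forall>w. (v, w) \<notin> edges D0)
      \<longleftrightarrow> v = r"
    using refutation by (auto simp: regRD_refutation_def)
  have "v = r" if v: "v < length D0" "node_clause (D0 ! v) = {||}" for v
  proof (rule ccontr)
    assume "v \<noteq> r"
    then obtain w where w: "(v, w) \<in> edges D0" using r v by blast
    then have "w < length D0" "v \<in> preds (D0 ! w)" by (auto simp: edges_def)
    then obtain x C i j where d: "D0 ! w = Derived x C i j" "v = i \<or> v = j"
      by (cases "D0 ! w") auto
    then have "is_resolvent x (node_clause (D0 ! i)) (node_clause (D0 ! j)) C"
      using correct_nodeD(5)[OF correct \<open>w < length D0\<close>] by blast
    then show False using d v by (auto simp: is_resolvent_def)
  qed
  then show ?thesis using assms by metis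
qed

lemma expand_refutes:
  assumes "\<forall>v<length D0. \<forall>x. node_var (D0 ! v) = Some x \<longrightarrow> x < fresh L"
    and "s < length D0" "node_clause (D0 ! s) = {||}" "expand D0 L s T D' k'"
  shows "regWRTI_refutation F T" "length (post_order T) \<le> 1 + 6 * length D0"
proof -
  note m = expand_marked[OF assms(4) marked_D0 assms(2)]
  have "\<forall>w<length D0. \<forall>C. w \<notin> {} \<longrightarrow> D0 ! w = Source C
      \<longrightarrow> C \<in> F"
    using correct by (metis correct_node.simps(1))
  then have "supported F T"
    using expand_supported[OF assms(4) marked_D0 assms(2), of "{}" F] by auto
  moreover have "\<forall>p\<in>branch_vars T. distinct p"
    using expand_distinct[OF assms(1,4) marked_D0 assms(2)] by auto
  ultimately show "regWRTI_refutation F T"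
    using m assms(3) by (simp add: regWRTI_refutation_def supported_imp_leaves_correct)
  show "length (post_order T) \<le> 1 + 6 * length D0"
    using m derived_count_le[of D0] by linarith
qed

end

section \<open>Programs\<close>

text \<open>Upper bounds instead of exact times: they add up under composition and can be weakened
  to a common value over different branches.\<close>

definition halts :: "program \<Rightarrow> store \<Rightarrow> nat \<Rightarrow> store
    \<Rightarrow> bool" where
  "halts c s T s' \<longleftrightarrow> (\<exists>t\<le>T. exec c s t s')"

lemma halts_weaken: "halts c s T s' \<Longrightarrow> T \<le> T' \<Longrightarrow> halts c s T' s'"
  by (auto simp: halts_def intro: order_trans)

lemma halts_1: "exec c s 1 s' \<Longrightarrow> halts c s (Suc 0) s'"
  unfolding halts_def by (metis One_nat_def order_refl)

lemma halts_Skip: "halts Skip s (Suc 0) s"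
  by (rule halts_1[OF exec.skip])

lemma halts_Push: "s(r := a # s r) = s' \<Longrightarrow> halts (Push r a) s (Suc 0) s'"
  using halts_1[OF exec.push] by blast

lemma halts_Pop: "s(r := tl (s r)) = s' \<Longrightarrow> halts (Pop r) s (Suc 0) s'"
  using halts_1[OF exec.pop] by blast

lemma halts_Seq: "halts c s t1 s1 \<Longrightarrow> halts d s1 t2 s2 \<Longrightarrow> halts (Seq c
    d) s (t1 + t2) s2"
  by (auto simp: halts_def) (metis exec.seq add_mono)

lemma halts_Cond_True: "s r = a # u \<Longrightarrow> halts c s t s' \<Longrightarrow> halts (Cond
    r a c d) s (Suc t) s'"
  by (auto simp: halts_def) (metis Suc_le_mono exec.cond_true list.sel(1) list.distinct(1))

lemma halts_Cond_False: "s r = [] \<or> hd (s r) \<noteq> a \<Longrightarrow> halts d s t s'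
    \<Longrightarrow> halts (Cond r a c d) s (Suc t) s'"
  unfolding halts_def by (metis Suc_le_mono exec.cond_false)

lemma halts_Loop_end: "s r = [] \<Longrightarrow> halts (Loop r c) s (Suc 0) s"
  using halts_1[OF exec.loop_end] by blast

lemma halts_Loop_step:
  "s r \<noteq> [] \<Longrightarrow> halts c s t1 s1 \<Longrightarrow> halts (Loop r c) s1 t2 s2
      \<Longrightarrow> halts (Loop r c) s (Suc (t1 + t2)) s2"
  by (auto simp: halts_def) (metis Suc_le_mono exec.loop_step add_mono)

text \<open>The last branch is reached for \<open>Close\<close>, but also for an empty stack, so the
  stack has to be known nonempty.\<close>

definition sw :: "nat \<Rightarrow> (symbol \<Rightarrow> program) \<Rightarrow> program" where
  "sw a f = Cond a Zero (f Zero) (Cond a One (f One) (Cond a Open (f Open) (f Close)))"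

lemma halts_sw:
  assumes "s a = x # u" "halts (f x) s t s'"
  shows "halts (sw a f) s (t + 3) s'"
proof (rule halts_weaken)
  show "halts (sw a f) s (case x of Zero \<Rightarrow> Suc t | One \<Rightarrow> Suc (Suc t) | _
      \<Rightarrow> Suc (Suc (Suc t))) s'"
  proof (cases x)
    case Zero
    then show ?thesis using assms unfolding sw_def by (simp add: halts_Cond_True)
  next
    case One
    then show ?thesis using assms unfolding sw_def
      by (simp add: halts_Cond_False[OF _ halts_Cond_True])
  next
    case Open
    then show ?thesis using assms unfolding sw_def
      by (simp add: halts_Cond_False[OF _ halts_Cond_False[OF _ halts_Cond_True]])
  next
    case Close
    then show ?thesis using assms unfolding sw_def
      by (simp add: halts_Cond_False[OF _ halts_Cond_False[OF _ halts_Cond_False]])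
  qed
qed (auto split: symbol.splits)

definition clear :: "nat \<Rightarrow> program" where "clear a = Loop a (Pop a)"

definition move1 :: "nat \<Rightarrow> nat \<Rightarrow> program" where
  "move1 a b = Seq (sw a (Push b)) (Pop a)"

text \<open>A transfer reverses the word, hence the recurring detours through a scratch stack that
  restore the order.\<close>

definition xfer1 :: "nat \<Rightarrow> nat \<Rightarrow> program" where
  "xfer1 a b = Loop a (move1 a b)"

definition xfer2 :: "nat \<Rightarrow> nat \<Rightarrow> nat \<Rightarrow> program" where
  "xfer2 a b c = Loop a (Seq (sw a (\<lambda>x. Seq (Push b x) (Push c x))) (Pop a))"

lemma halts_clear: "s(a := []) = s' \<Longrightarrow> halts (clear a) s (2 * length (s a) + 1) s'"
  unfolding clear_def
proof (induction "s a" arbitrary: s)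
  case Nil
  have "s' = s" unfolding Nil(2)[symmetric] using Nil(1) by (auto simp: fun_eq_iff)
  then show ?case using Nil(1) halts_Loop_end by simp
next
  case (Cons x u)
  have "halts (Loop a (Pop a)) (s(a := u)) (2 * length u + 1) s'"
    using Cons.hyps(1)[of "s(a := u)"] Cons.prems by simp
  moreover have "halts (Pop a) s (Suc 0) (s(a := u))"
    by (rule halts_Pop) (simp flip: Cons.hyps(2))
  ultimately have "halts (Loop a (Pop a)) s (Suc (Suc 0 + (2 * length u + 1))) s'"
    using Cons.hyps(2) by (intro halts_Loop_step[of s a]) auto
  then show ?case by (simp flip: Cons.hyps(2))
qed

lemma halts_move1: "s a = x # u \<Longrightarrow> a \<noteq> b \<Longrightarrow> s(a := u, b := x #
    s b) = s' \<Longrightarrow> halts (move1 a b) s 5 s'"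
proof -
  assume *: "s a = x # u" "a \<noteq> b" and s': "s(a := u, b := x # s b) = s'"
  have "halts (Pop a) (s(b := x # s b)) (Suc 0) s'"
    unfolding s'[symmetric] using * by (intro halts_Pop) (simp add: fun_upd_twist)
  moreover have "halts (sw a (Push b)) s (Suc 0 + 3) (s(b := x # s b))"
    by (rule halts_sw) (rule *(1), rule halts_Push[OF refl])
  ultimately have "halts (move1 a b) s (Suc 0 + 3 + Suc 0) s'"
    unfolding move1_def by (intro halts_Seq)
  then show ?thesis by (simp add: numeral_eq_Suc)
qed

lemma halts_xfer1:
  "a \<noteq> b \<Longrightarrow> s(a := [], b := rev (s a) @ s b) = s' \<Longrightarrow> halts
      (xfer1 a b) s (6 * length (s a) + 1) s'"
  unfolding xfer1_def
proof (induction "s a" arbitrary: s)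
  case Nil
  have "s' = s" unfolding Nil(3)[symmetric] using Nil(1) by (auto simp: fun_eq_iff)
  then show ?case using Nil(1) halts_Loop_end by simp
next
  case (Cons x u)
  let ?s = "s(a := u, b := x # s b)"
  have "halts (Loop a (move1 a b)) ?s (6 * length u + 1) s'"
    using Cons.hyps(1)[of ?s] Cons.hyps(2)[symmetric] Cons.prems by (simp add: fun_upd_twist)
  then have "halts (Loop a (move1 a b)) s (Suc (5 + (6 * length u + 1))) s'"
    using Cons.hyps(2)[symmetric] Cons.prems(1) by (intro halts_Loop_step halts_move1) auto
  then show ?case by (simp flip: Cons.hyps(2))
qed

lemma halts_xfer2:
  "distinct [a, b, c] \<Longrightarrow> s(a := [], b := rev (s a) @ s b, c := rev (s a) @ s c) = s'
      \<Longrightarrow>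
     halts (xfer2 a b c) s (7 * length (s a) + 1) s'"
  unfolding xfer2_def
proof (induction "s a" arbitrary: s)
  case Nil
  have "s' = s" unfolding Nil(3)[symmetric] using Nil(1) by (auto simp: fun_eq_iff)
  then show ?case using Nil(1) halts_Loop_end by simp
next
  case (Cons x u)
  let ?c = "Seq (sw a (\<lambda>x. Seq (Push b x) (Push c x))) (Pop a)"
  let ?s = "s(a := u, b := x # s b, c := x # s c)"
  have 1: "halts (Loop a ?c) ?s (7 * length u + 1) s'"
    using Cons.hyps(1)[of ?s] Cons.hyps(2)[symmetric] Cons.prems by (simp add: fun_upd_twist)
  have "halts (Pop a) (s(b := x # s b, c := x # s c)) (Suc 0) ?s"
    using Cons.hyps(2)[symmetric] Cons.prems(1) by (intro halts_Pop) (simp add: fun_upd_twist)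
  moreover have "halts (Seq (Push b x) (Push c x)) s (Suc 0 + Suc 0) (s(b := x # s b, c := x # s c))"
    using Cons.prems(1) by (intro halts_Seq[OF halts_Push[OF refl] halts_Push]) simp
  ultimately have "halts ?c s ((Suc 0 + Suc 0 + 3) + Suc 0) ?s"
    using Cons.hyps(2)[symmetric] by (intro halts_Seq[OF halts_sw])
  from halts_Loop_step[OF _ this 1]
  have "halts (Loop a ?c) s (Suc (6 + (7 * length u + 1))) s'"
    using Cons.hyps(2)[symmetric] by simp
  then show ?case by (simp flip: Cons.hyps(2))
qed

section \<open>Bracket structure of the encodings\<close>

fun bal :: "nat \<Rightarrow> word \<Rightarrow> bool" where
  "bal 0 w \<longleftrightarrow> w = []"
| "bal (Suc d) [] \<longleftrightarrow> False"
| "bal (Suc d) (Open # w) \<longleftrightarrow> bal (Suc (Suc d)) w"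
| "bal (Suc d) (Close # w) \<longleftrightarrow> bal d w"
| "bal (Suc d) (Zero # w) \<longleftrightarrow> bal (Suc d) w"
| "bal (Suc d) (One # w) \<longleftrightarrow> bal (Suc d) w"

text \<open>The first symbol of a block is arbitrary: it plays the role of the opening bracket.\<close>

definition block :: "word \<Rightarrow> bool" where
  "block w \<longleftrightarrow> (\<exists>a u. w = a # u \<and> bal 1 u)"

text \<open>Balancedness expressed through all continuations at positive depth, a form that is
  closed under concatenation.\<close>

definition neutral :: "word \<Rightarrow> bool" where
  "neutral u \<longleftrightarrow> (\<forall>d w. bal (Suc d) (u @ w) \<longleftrightarrow> bal
      (Suc d) w)"

lemma neutral_Nil: "neutral []"
  by (simp add: neutral_def)

lemma neutral_append: "neutral u \<Longrightarrow> neutral v \<Longrightarrow> neutral (u @ v)"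
  by (simp add: neutral_def)

lemma neutral_concat: "(\<And>w. w \<in> set ws \<Longrightarrow> neutral w) \<Longrightarrow>
    neutral (concat ws)"
  by (induction ws) (auto intro!: neutral_append neutral_Nil)

lemma neutral_bracket: "(\<And>w. w \<in> set ws \<Longrightarrow> neutral w) \<Longrightarrow>
    neutral (bracket ws)"
  using neutral_concat[of ws] by (simp add: neutral_def bracket_def)

lemma neutral_bits: "neutral (bits n)"
proof (induction n rule: bits.induct)
  case (1 n)
  then show ?case by (subst bits.simps) (auto simp: neutral_def)
qed

lemma neutral_nat_word: "neutral (nat_word n)"
  by (auto simp: nat_word_def intro!: neutral_bracket neutral_bits)

lemma neutral_clause_word: "neutral (clause_word C)"
  by (auto simp: clause_word_def intro!: neutral_bracket neutral_nat_word)

lemma block_neutral: "neutral u \<Longrightarrow> block (a # u @ [Close])"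
  by (auto simp: block_def neutral_def)

lemma block_nat_word: "block (nat_word n)"
  using block_neutral[OF neutral_bits] by (simp add: nat_word_def bracket_def)

lemma block_clause_word: "block (clause_word C)"
proof -
  have "neutral (concat (map nat_word (sorted_list_of_fset (literal_index |`| C))))"
    using neutral_nat_word by (intro neutral_concat) auto
  then show ?thesis using block_neutral by (simp add: clause_word_def bracket_def)
qed

lemma node_word_Source: "node_word (Source C) = Open # clause_word C @ [Close]"
  by (simp add: bracket_def)

lemma node_word_Derived:
  "node_word (Derived x C i j) = Open # nat_word x @ clause_word C @ nat_word i @ nat_word j @ [Close]"
  by (simp add: bracket_def)

lemma tree_word_Leaf: "tree_word (Leaf C) = Open # clause_word C @ [Close]"
  by (simp add: bracket_def)

lemma tree_word_Node:
  "tree_word (Node x C l r) = Open # nat_word x @ clause_word C @ tree_word l @ tree_word r @ [Close]"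
  by (simp add: bracket_def)

declare node_word.simps [simp del] tree_word.simps [simp del]

lemma block_node_word: "block (node_word n)"
proof (cases n)
  case (Source C)
  then show ?thesis using block_neutral[OF neutral_clause_word] by (simp add: node_word_Source)
next
  case (Derived x C i j)
  have "neutral (nat_word x @ clause_word C @ nat_word i @ nat_word j)"
    by (intro neutral_append neutral_nat_word neutral_clause_word)
  from block_neutral[OF this, of Open] show ?thesis using Derived by (simp add: node_word_Derived)
qed

text \<open>Stack 13 holds the bracket depth in unary, so an empty stack signals the end of the
  block. The \<open>One\<close> pushed at the start accounts for the opening symbol just
  moved.\<close>

definition move_block :: "nat \<Rightarrow> nat \<Rightarrow> program" where
  "move_block a b = Seq (move1 a b) (Seq (Push 13 One)
     (Loop 13 (Seq (Cond a Open (Push 13 One) (Cond a Close (Pop 13) Skip)) (move1 a b))))"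

lemma halts_move_block:
  assumes "s a = w @ rest" "block w" "a \<noteq> b" "a \<noteq> 13" "b \<noteq> 13" "s 13 = []"
    and "s(a := rest, b := rev w @ s b) = s'"
  shows "halts (move_block a b) s (10 * length w) s'"
proof -
  let ?c = "Seq (Cond a Open (Push 13 One) (Cond a Close (Pop 13) Skip)) (move1 a b)"
  have step: "halts ?c s 8 (s(a := u, b := y # s b, 13 := r))"
    if "s a = y # u" "halts (Cond a Open (Push 13 One) (Cond a Close (Pop 13) Skip)) s 3 (s(13 := r))"
    for s y u r
  proof -
    have "halts (move1 a b) (s(13 := r)) 5 (s(a := u, b := y # s b, 13 := r))"
      using that(1) assms(3-5) by (intro halts_move1) (auto simp: fun_upd_twist)
    from halts_Seq[OF that(2) this] show ?thesis by simp
  qed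
  \<comment> \<open>One round of the loop with the new depth \<open>r\<close> left open; the symbols
    differ in nothing else.\<close>
  have iterate: "halts (Loop 13 ?c) s (9 * length (y # w) + 1) (s(a := rest, b := rev (y # w) @ s b, 13 := []))"
    if s: "s a = y # w @ rest" "s 13 \<noteq> []"
      and c: "halts (Cond a Open (Push 13 One) (Cond a Close (Pop 13) Skip)) s 3 (s(13 := r))"
      and IH: "\<And>s. s a = w @ rest \<Longrightarrow> s 13 = r \<Longrightarrow>
        halts (Loop 13 ?c) s (9 * length w + 1) (s(a := rest, b := rev w @ s b, 13 := []))"
    for s y w r
  proof -
    let ?s = "s(a := w @ rest, b := y # s b, 13 := r)"
    have eq: "?s(a := rest, b := rev w @ ?s b, 13 := []) = s(a := rest, b := rev (y # w) @ s b, 13 := [])"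
      using assms(3-5) by (auto simp: fun_eq_iff)
    have "halts (Loop 13 ?c) ?s (9 * length w + 1) (s(a := rest, b := rev (y # w) @ s b, 13 := []))"
      unfolding eq[symmetric] using assms(3-5) by (intro IH) auto
    from halts_Loop_step[OF s(2) step[OF s(1) c] this] show ?thesis
      by (rule halts_weaken) simp
  qed
  have loop: "halts (Loop 13 ?c) s (9 * length u + 1) (s(a := rest, b := rev u @ s b, 13 := []))"
    if "s a = u @ rest" "s 13 = replicate d One" "bal d u" for s u d
    using that(3,1,2)
  proof (induction d u arbitrary: s rule: bal.induct)
    case (1 w)
    then have eq: "s(a := rest, b := rev w @ s b, 13 := []) = s" by (auto simp: fun_eq_iff)
    show ?case unfolding eq using 1 halts_Loop_end by simp
  next
    case (3 d w)
    have "halts (Cond a Open (Push 13 One) (Cond a Close (Pop 13) Skip)) s 3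
        (s(13 := replicate (Suc (Suc d)) One))"
      by (rule halts_weaken, rule halts_Cond_True, use 3(3) in simp, rule halts_Push)
        (use 3(4) in simp_all)
    then show ?case by (rule iterate[rotated 2], intro 3(1)) (use 3(2-4) in auto)
  next
    case (4 d w)
    have "halts (Cond a Open (Push 13 One) (Cond a Close (Pop 13) Skip)) s 3
        (s(13 := replicate d One))"
      by (rule halts_weaken, rule halts_Cond_False, use 4(3) in simp, rule halts_Cond_True,
          use 4(3) in simp, rule halts_Pop) (use 4(4) in simp_all)
    then show ?case by (rule iterate[rotated 2], intro 4(1)) (use 4(2-4) in auto)
  next
    case (5 d w)
    have "halts (Cond a Open (Push 13 One) (Cond a Close (Pop 13) Skip)) s 3
        (s(13 := replicate (Suc d) One))"
      unfolding 5(4)[symmetric] fun_upd_triv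
      by (rule halts_weaken, rule halts_Cond_False, use 5(3) in simp, rule halts_Cond_False,
          use 5(3) in simp, rule halts_Skip) simp
    then show ?case by (rule iterate[rotated 2], intro 5(1)) (use 5(2-4) in auto)
  next
    case (6 d w)
    have "halts (Cond a Open (Push 13 One) (Cond a Close (Pop 13) Skip)) s 3
        (s(13 := replicate (Suc d) One))"
      unfolding 6(4)[symmetric] fun_upd_triv
      by (rule halts_weaken, rule halts_Cond_False, use 6(3) in simp, rule halts_Cond_False,
          use 6(3) in simp, rule halts_Skip) simp
    then show ?case by (rule iterate[rotated 2], intro 6(1)) (use 6(2-4) in auto)
  qed auto
  obtain y u where w: "w = y # u" "bal 1 u" using assms(2) by (auto simp: block_def)
  let ?s = "s(a := u @ rest, b := y # s b)"
  have "halts (move1 a b) s 5 ?s" using assms w by (intro halts_move1) auto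
  moreover have "halts (Push 13 One) ?s (Suc 0) (?s(13 := [One]))"
    using assms by (intro halts_Push) (auto simp: fun_eq_iff)
  moreover have "halts (Loop 13 ?c) (?s(13 := [One])) (9 * length u + 1)
      ((?s(13 := [One]))(a := rest, b := rev u @ (?s(13 := [One])) b, 13 := []))"
    using assms w by (intro loop[where d = 1]) auto
  moreover have "(?s(13 := [One]))(a := rest, b := rev u @ (?s(13 := [One])) b, 13 := []) = s'"
    unfolding assms(7)[symmetric] using assms(1-6) w by (auto simp: fun_eq_iff)
  ultimately have "halts (move_block a b) s (5 + (Suc 0 + (9 * length u + 1))) s'"
    unfolding move_block_def by (metis halts_Seq)
  then show ?thesis using w by (auto intro: halts_weaken)
qed

text \<open>Registers: 0 holds the nodes still to be scanned, 1 the agenda, 2 the reversed output,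
  3 the unary exponent of the next fresh variable and 4 the nodes already scanned, reversed; the
  others are scratch space. An agenda item is \<open>Close\<close>, a node header starting with \<open>One\<close>,
  or the index of a dag node whose expansion is still to be written.\<close>

definition mk :: "word list \<Rightarrow> store" where
  "mk l = (\<lambda>r. if r < length l then l ! r else [])"

lemma mk_app: "r < length l \<Longrightarrow> mk l r = l ! r"
  by (simp add: mk_def)

lemma mk_upd: "r < length l \<Longrightarrow> (mk l)(r := w) = mk (l[r := w])"
  by (auto simp: mk_def fun_eq_iff)

lemma list_update_numeral: "(x # xs)[numeral k := y] = x # xs[pred_numeral k := y]"
  by (simp add: numeral_eq_Suc)

lemmas mk_simps = mk_app mk_upd list_update_numeral

abbreviation st :: "word \<Rightarrow> word \<Rightarrow> word \<Rightarrow> nat \<Rightarrow> word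
    \<Rightarrow> store" where
  "st A G Out k B \<equiv> mk [A, G, Out, replicate k One, B, [], [], [], [], [], [], [], [], [], []]"

notation Seq (infixr ";;" 55)

text \<open>After the first block of a source only \<open>Close\<close> is left, while in a derived
  node the clause follows the variable; the test relies on this. The word of a derived node with
  \<open>One\<close> in place of its opening bracket already is the agenda segment for one copy: a
  header with variable and clause, two indices and a \<open>Close\<close>. It is pushed twice, on
  top of the outer \<open>Close\<close> and below the outer header with the fresh variable. On stack
  0 the node is rewritten as a source, and the last transfer rewinds the scanned nodes.\<close>

definition process_node :: program where
  "process_node =
     move_block 0 5 ;; xfer2 5 6 7 ;; Pop 6 ;; move_block 6 8 ;;
     Cond 6 Close
       (Pop 6 ;; xfer1 7 5 ;; xfer1 5 0 ;; xfer1 8 6 ;; Push 2 Open ;; xfer1 6 2 ;; Push 2 Close)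
       (clear 8 ;; move_block 6 8 ;; clear 6 ;; Push 1 Close ;;
        xfer1 7 5 ;; xfer2 5 1 7 ;; Pop 1 ;; Push 1 One ;;
        xfer1 7 5 ;; xfer1 5 1 ;; Pop 1 ;; Push 1 One ;;
        Push 0 Close ;; xfer2 8 0 1 ;; Push 0 Open ;;
        Push 1 Close ;; xfer2 3 9 1 ;; xfer1 9 3 ;; Push 3 One ;; Push 1 Open ;; Push 1 One) ;;
     xfer1 4 0"

abbreviation nodes_word :: "dag \<Rightarrow> word" where
  "nodes_word D \<equiv> concat (map node_word D)"

lemma nodes_word_update:
  "v < length D \<Longrightarrow> nodes_word (take v D) @ node_word n @ nodes_word (drop (Suc v) D)
      = nodes_word (D[v := n])"
  by (simp add: upd_conv_take_nth_drop)

lemma bits_fresh: "bits (fresh k) = replicate k One"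
proof (induction k)
  case 0
  then show ?case by (simp add: fresh_def bits.simps)
next
  case (Suc k)
  have "fresh (Suc k) = 2 * fresh k + 1"
    using one_le_power[of "2::nat" k] unfolding fresh_def power_Suc by linarith
  then show ?case using Suc by (subst bits.simps) auto
qed

lemma nat_word_fresh: "nat_word (fresh k) = Open # replicate k One @ [Close]"
  by (simp add: nat_word_def bracket_def bits_fresh)

lemma replicate_append_One: "replicate k a @ a # w = a # replicate k a @ w"
  by (simp add: replicate_app_Cons_same)

lemma halts_process_Source:
  assumes "v < length D" "D ! v = Source C"
  shows "halts process_node
     (st (nodes_word (drop v D) @ [Close]) G Out k (rev (nodes_word (take v D))))
     (100 * (length (nodes_word D) + 1))
     (st (nodes_word D @ [Close]) G (rev (tree_word (Leaf C)) @ Out) k [])"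
proof -
  let ?A = "nodes_word (drop (Suc v) D) @ [Close]"
  let ?B = "rev (nodes_word (take v D))"
  have A: "nodes_word (drop v D) @ [Close] = Open # clause_word C @ Close # ?A"
    using assms by (simp add: node_word_Source flip: Cons_nth_drop_Suc)
  have A': "nodes_word D @ [Close] = nodes_word (take v D) @ Open # clause_word C @ Close # ?A"
    using nodes_word_update[OF assms(1), of "Source C"] list_update_id[of D v] assms(2)
    by (simp add: node_word_Source)
  have len: "length (nodes_word D) = length (nodes_word (take v D)) + length (clause_word C) + 2 +
      length (nodes_word (drop (Suc v) D))"
    using arg_cong[OF A', of length] by simp
  show ?thesis
    unfolding process_node_def A A'
    apply (rule halts_weaken)
     apply (rule halts_Seq)
      apply (rule halts_move_block[where w = "Open # clause_word C @ [Close]" and rest = "?A"])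
            apply (simp add: mk_simps)
           apply (rule block_neutral[OF neutral_clause_word])
          apply (simp_all add: mk_simps)[5]
     apply (rule halts_Seq)
      apply (rule halts_xfer2, simp, simp add: mk_simps)
     apply (rule halts_Seq)
      apply (rule halts_Pop, simp add: mk_simps)
     apply (rule halts_Seq)
      apply (rule halts_move_block[where w = "clause_word C" and rest = "[Close]"])
            apply (simp add: mk_simps)
           apply (rule block_clause_word)
          apply (simp_all add: mk_simps)[5]
     apply (rule halts_Seq)
      apply (rule halts_Cond_True)
       apply (simp add: mk_simps)
      apply (rule halts_Seq, rule halts_Pop, simp add: mk_simps)
      apply (rule halts_Seq, rule halts_xfer1, simp, simp add: mk_simps)
      apply (rule halts_Seq, rule halts_xfer1, simp, simp add: mk_simps)
      apply (rule halts_Seq, rule halts_xfer1, simp, simp add: mk_simps)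
      apply (rule halts_Seq, rule halts_Push, simp add: mk_simps)
      apply (rule halts_Seq, rule halts_xfer1, simp, simp add: mk_simps)
      apply (rule halts_Push, simp add: mk_simps)
     apply (rule halts_xfer1, simp, simp add: mk_simps tree_word_Leaf)
    apply (simp add: mk_simps len)
    done
qed

lemma halts_process_Derived:
  assumes "v < length D" "D ! v = Derived x C i j"
  defines "W \<equiv> nat_word x @ clause_word C @ nat_word i @ nat_word j @ [Close]"
  shows "halts process_node
     (st (nodes_word (drop v D) @ [Close]) G Out k (rev (nodes_word (take v D))))
     (200 * (length (nodes_word D) + k + 1))
     (st (nodes_word (D[v := Source C]) @ [Close])
        (One # nat_word (fresh k) @ clause_word C @ One # W @ One # W @ Close # G) Out (Suc k) [])"
proof -
  let ?A = "nodes_word (drop (Suc v) D) @ [Close]"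
  let ?B = "rev (nodes_word (take v D))"
  have A: "nodes_word (drop v D) @ [Close] =
      Open # nat_word x @ clause_word C @ nat_word i @ nat_word j @ Close # ?A"
    using assms by (simp add: node_word_Derived flip: Cons_nth_drop_Suc)
  have A': "nodes_word (D[v := Source C]) @ [Close] =
      nodes_word (take v D) @ Open # clause_word C @ Close # ?A"
    using nodes_word_update[OF assms(1), of "Source C"] assms(2)[symmetric]
    by (simp add: node_word_Source)
  have "nodes_word D @ [Close] = nodes_word (take v D) @
      Open # nat_word x @ clause_word C @ nat_word i @ nat_word j @ Close # ?A"
    using nodes_word_update[OF assms(1), of "Derived x C i j"] list_update_id[of D v] assms(2)
    by (simp add: node_word_Derived)
  from arg_cong[OF this, of length]
  have len: "length (nodes_word D) = length (nodes_word (take v D)) + length (clause_word C) + 2 +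
      length (nodes_word (drop (Suc v) D)) + length (nat_word x) + length (nat_word i) + length
          (nat_word j)"
    by simp
  have n: "neutral (nat_word x @ clause_word C @ nat_word i @ nat_word j)"
    by (intro neutral_append neutral_nat_word neutral_clause_word)
  have hd: "hd (clause_word C @ u) \<noteq> Close" for u
    by (simp add: clause_word_def bracket_def)
  show ?thesis
    unfolding process_node_def A A' W_def nat_word_fresh
    apply (rule halts_weaken)
     apply (rule halts_Seq)
      apply (rule halts_move_block[where
          w = "Open # nat_word x @ clause_word C @ nat_word i @ nat_word j @ [Close]" and rest = "?A"])
            apply (simp add: mk_simps)
           apply (use block_neutral[OF n] in simp)
          apply (simp_all add: mk_simps)[5]
     apply (rule halts_Seq, rule halts_xfer2, simp, simp add: mk_simps)
     apply (rule halts_Seq, rule halts_Pop, simp add: mk_simps)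
     apply (rule halts_Seq)
      apply (rule halts_move_block[where w = "nat_word x" and
          rest = "clause_word C @ nat_word i @ nat_word j @ [Close]"])
            apply (simp add: mk_simps)
           apply (rule block_nat_word)
          apply (simp_all add: mk_simps)[5]
     apply (rule halts_Seq)
      apply (rule halts_Cond_False)
       apply (simp add: mk_simps hd)
      apply (rule halts_Seq, rule halts_clear, simp add: mk_simps)
      apply (rule halts_Seq)
       apply (rule halts_move_block[where w = "clause_word C" and rest = "nat_word i @ nat_word j @
           [Close]"])
             apply (simp add: mk_simps)
            apply (rule block_clause_word)
           apply (simp_all add: mk_simps)[5]
      apply (rule halts_Seq, rule halts_clear, simp add: mk_simps)
      apply (rule halts_Seq, rule halts_Push, simp add: mk_simps)
      apply (rule halts_Seq, rule halts_xfer1, simp, simp add: mk_simps)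
      apply (rule halts_Seq, rule halts_xfer2, simp, simp add: mk_simps)
      apply (rule halts_Seq, rule halts_Pop, simp add: mk_simps)
      apply (rule halts_Seq, rule halts_Push, simp add: mk_simps)
      apply (rule halts_Seq, rule halts_xfer1, simp, simp add: mk_simps)
      apply (rule halts_Seq, rule halts_xfer1, simp, simp add: mk_simps)
      apply (rule halts_Seq, rule halts_Pop, simp add: mk_simps)
      apply (rule halts_Seq, rule halts_Push, simp add: mk_simps)
      apply (rule halts_Seq, rule halts_Push, simp add: mk_simps)
      apply (rule halts_Seq, rule halts_xfer2, simp, simp add: mk_simps)
      apply (rule halts_Seq, rule halts_Push, simp add: mk_simps)
      apply (rule halts_Seq, rule halts_Push, simp add: mk_simps)
      apply (rule halts_Seq, rule halts_xfer2, simp, simp add: mk_simps)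
      apply (rule halts_Seq, rule halts_xfer1, simp, simp add: mk_simps)
      apply (rule halts_Seq, rule halts_Push, simp add: mk_simps)
      apply (rule halts_Seq, rule halts_Push, simp add: mk_simps)
      apply (rule halts_Push, simp add: mk_simps)
     apply (rule halts_xfer1, simp, simp add: mk_simps)
    apply (simp add: mk_simps len)
    done
qed

section \<open>Decoding an index and moving to its node\<close>

definition double :: program where
  "double = Loop 10 (Pop 10 ;; Push 11 One ;; Push 11 One) ;; xfer1 11 10"

text \<open>\<open>move_block\<close> delivers an index reversed, most significant bit first, as
  Horner's rule needs it. The unary value may be exponential in the length of the word, but an index
  is smaller than the number of nodes.\<close>

definition unary :: program where
  "unary = Loop 12 (Cond 12 One (double ;; Push 10 One) (Cond 12 Zero double Skip) ;; Pop 12)"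

fun horner :: "nat \<Rightarrow> word \<Rightarrow> nat" where
  "horner u [] = u"
| "horner u (One # w) = horner (2 * u + 1) w"
| "horner u (Zero # w) = horner (2 * u) w"
| "horner u (Open # w) = horner u w"
| "horner u (Close # w) = horner u w"

lemma horner_append: "horner u (v @ w) = horner (horner u v) w"
  by (induction u v rule: horner.induct) auto

lemma horner_ge: "u \<le> horner u w"
  by (induction u w rule: horner.induct) auto

lemma horner_rev_bits: "horner 0 (rev (bits n)) = n"
proof (induction n rule: bits.induct)
  case (1 n)
  then show ?case by (cases "n = 0") (simp_all add: bits.simps[of n] bits.simps[of 0] horner_append)
qed

lemma horner_rev_nat_word: "horner 0 (rev (nat_word n)) = n"
  by (simp add: nat_word_def bracket_def horner_append horner_rev_bits)

lemma length_bits: "length (bits n) \<le> n"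
proof (induction n rule: bits.induct)
  case (1 n)
  then show ?case by (subst bits.simps) (cases "n = 0"; force)
qed

lemma length_nat_word: "length (nat_word n) \<le> n + 2"
  using length_bits[of n] by (simp add: nat_word_def bracket_def)

lemma halts_double:
  assumes "s 10 = replicate u One" "s 11 = []" "s(10 := replicate (2 * u) One) = s'"
  shows "halts double s (16 * u + 2) s'"
proof -
  let ?c = "Pop 10 ;; Push 11 One ;; Push 11 One"
  have loop: "halts (Loop 10 ?c) s (4 * u + 1) (s(10 := [], 11 := replicate (2 * u) One @ s 11))"
    if "s 10 = replicate u One" for s
    using that
  proof (induction u arbitrary: s)
    case 0
    then have eq: "s(10 := [], 11 := replicate (2 * 0) One @ s 11) = s" by (auto simp: fun_eq_iff)
    show ?case unfolding eq using 0 halts_Loop_end by simp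
  next
    case (Suc u)
    let ?s = "s(10 := replicate u One, 11 := One # One # s 11)"
    have eq: "?s(10 := [], 11 := replicate (2 * u) One @ ?s 11) =
        s(10 := [], 11 := replicate (2 * Suc u) One @ s 11)"
      by (auto simp: fun_eq_iff replicate_append_One)
    have "halts (Loop 10 ?c) ?s (4 * u + 1) (s(10 := [], 11 := replicate (2 * Suc u) One @ s 11))"
      unfolding eq[symmetric] by (rule Suc.IH) simp
    moreover have "halts ?c s (Suc 0 + (Suc 0 + Suc 0)) ?s"
      by (intro halts_Seq, rule halts_Pop, rule refl, rule halts_Push, rule refl, rule halts_Push)
        (use Suc.prems in \<open>auto simp: fun_eq_iff\<close>)
    ultimately have "halts (Loop 10 ?c) s (Suc ((Suc 0 + (Suc 0 + Suc 0)) + (4 * u + 1)))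
        (s(10 := [], 11 := replicate (2 * Suc u) One @ s 11))"
      using Suc.prems by (intro halts_Loop_step) auto
    then show ?case by (rule halts_weaken) simp
  qed
  from loop[of s, OF assms(1)]
  have "halts double s ((4 * u + 1) + (6 * length ((s(10 := [], 11 := replicate (2 * u) One @ s
      11)) 11) + 1)) s'"
    unfolding double_def assms(3)[symmetric]
    by (rule halts_Seq, intro halts_xfer1) (use assms(1,2) in \<open>auto simp: fun_eq_iff\<close>)
  then show ?thesis by (rule halts_weaken) (simp add: assms)
qed

text \<open>A doubling costs time linear in the current value, and no intermediate value exceeds the
  final one; this gives length times value.\<close>

lemma halts_unary:
  assumes "s 12 = w" "s 10 = replicate u One" "s 11 = []"
  shows "halts unary s (length w * (16 * horner u w + 10) + 1)
    (s(12 := [], 10 := replicate (horner u w) One))"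
  using assms unfolding unary_def
proof (induction w arbitrary: s u)
  case Nil
  then have eq: "s(12 := [], 10 := replicate (horner u []) One) = s" by (auto simp: fun_eq_iff)
  show ?case unfolding eq using Nil halts_Loop_end by simp
next
  case (Cons a w)
  let ?d = "Cond 12 One (double ;; Push 10 One) (Cond 12 Zero double Skip)"
  let ?h = "horner u [a]"
  have h: "horner u (a # w) = horner ?h w"
    using horner_append[of u "[a]" w] by simp
  let ?s = "s(12 := w, 10 := replicate ?h One)"
  have d: "halts ?d s (16 * u + 6) (s(10 := replicate ?h One))"
  proof (cases a)
    case Zero
    have "halts double s (16 * u + 2) (s(10 := replicate ?h One))"
      using Zero Cons.prems by (intro halts_double) auto
    then show ?thesis
      using Zero Cons.prems
      by (intro halts_weaken[OF halts_Cond_False[OF _ halts_Cond_True]]) auto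
  next
    case One
    have "halts double s (16 * u + 2) (s(10 := replicate (2 * u) One))"
      using Cons.prems by (intro halts_double) auto
    then have "halts (double ;; Push 10 One) s (16 * u + 2 + Suc 0) (s(10 := replicate ?h One))"
      by (rule halts_Seq, intro halts_Push) (auto simp: One fun_eq_iff)
    then show ?thesis
      using One Cons.prems by (intro halts_weaken[OF halts_Cond_True]) auto
  next
    case Open
    then have eq: "s(10 := replicate ?h One) = s" using Cons.prems by (auto simp: fun_eq_iff)
    show ?thesis unfolding eq
      using Open Cons.prems by (intro halts_weaken[OF halts_Cond_False[OF _ halts_Cond_False[OF _
          halts_Skip]]]) auto
  next
    case Close
    then have eq: "s(10 := replicate ?h One) = s" using Cons.prems by (auto simp: fun_eq_iff)
    show ?thesis unfolding eq
      using Close Cons.prems by (intro halts_weaken[OF halts_Cond_False[OF _ halts_Cond_False[OF _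
          halts_Skip]]]) auto
  qed
  have "halts (?d ;; Pop 12) s (16 * u + 6 + Suc 0) ?s"
    using d by (rule halts_Seq, intro halts_Pop) (use Cons.prems in \<open>auto simp: fun_eq_iff\<close>)
  moreover have eq: "?s(12 := [], 10 := replicate (horner ?h w) One) =
      s(12 := [], 10 := replicate (horner u (a # w)) One)"
    by (auto simp: fun_eq_iff h)
  have "halts (Loop 12 (?d ;; Pop 12)) ?s (length w * (16 * horner ?h w + 10) + 1)
      (s(12 := [], 10 := replicate (horner u (a # w)) One))"
    unfolding eq[symmetric] using Cons.prems by (intro Cons.IH) auto
  ultimately have "halts (Loop 12 (?d ;; Pop 12)) s
      (Suc ((16 * u + 6 + Suc 0) + (length w * (16 * horner ?h w + 10) + 1)))
      (s(12 := [], 10 := replicate (horner u (a # w)) One))"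
    using Cons.prems by (intro halts_Loop_step) auto
  then show ?case
    by (rule halts_weaken) (use horner_ge[of u "a # w"] h in \<open>simp add: algebra_simps\<close>)
qed

definition locate :: program where
  "locate = Loop 10 (Pop 10 ;; move_block 0 4)"

lemma halts_locate:
  assumes "s 10 = replicate v One" "s 0 = nodes_word D @ rest" "s 13 = []" "v \<le> length D"
  shows "halts locate s (2 * v + 10 * length (nodes_word D) + 1)
    (s(0 := nodes_word (drop v D) @ rest, 4 := rev (nodes_word (take v D)) @ s 4, 10 := []))"
  using assms unfolding locate_def
proof (induction v arbitrary: s D)
  case 0
  then have eq: "s(0 := nodes_word (drop 0 D) @ rest, 4 := rev (nodes_word (take 0 D)) @ s 4, 10 :=
      []) = s"
    by (auto simp: fun_eq_iff)
  show ?case unfolding eq using 0 by (intro halts_weaken[OF halts_Loop_end]) auto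
next
  case (Suc v)
  then obtain n E where D: "D = n # E" by (cases D) auto
  let ?s = "s(0 := nodes_word E @ rest, 4 := rev (node_word n) @ s 4, 10 := replicate v One)"
  have eq: "?s(0 := nodes_word (drop v E) @ rest, 4 := rev (nodes_word (take v E)) @ ?s 4, 10 := []) =
      s(0 := nodes_word (drop (Suc v) D) @ rest, 4 := rev (nodes_word (take (Suc v) D)) @ s 4, 10 := [])"
    by (auto simp: fun_eq_iff D)
  have 1: "halts (Loop 10 (Pop 10 ;; move_block 0 4)) ?s (2 * v + 10 * length (nodes_word E) + 1)
      (s(0 := nodes_word (drop (Suc v) D) @ rest, 4 := rev (nodes_word (take (Suc v) D)) @ s 4, 10
          := []))"
    unfolding eq[symmetric] using Suc.prems by (intro Suc.IH) (auto simp: D)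
  have "halts (Pop 10) s (Suc 0) (s(10 := replicate v One))"
    using Suc.prems by (intro halts_Pop) simp
  moreover have "halts (move_block 0 4) (s(10 := replicate v One)) (10 * length (node_word n)) ?s"
    using Suc.prems D
    by (intro halts_move_block[where w = "node_word n" and rest = "nodes_word E @ rest"] block_node_word)
      (auto simp: fun_eq_iff)
  ultimately have "halts (Pop 10 ;; move_block 0 4) s (Suc 0 + 10 * length (node_word n)) ?s"
    by (rule halts_Seq)
  from halts_Loop_step[OF _ this 1] Suc.prems(1)
  have "halts (Loop 10 (Pop 10 ;; move_block 0 4)) s
      (Suc (Suc 0 + 10 * length (node_word n) + (2 * v + 10 * length (nodes_word E) + 1)))
      (s(0 := nodes_word (drop (Suc v) D) @ rest, 4 := rev (nodes_word (take (Suc v) D)) @ s 4, 10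
          := []))"
    by simp
  then show ?case by (rule halts_weaken) (simp add: D)
qed

section \<open>The agenda loop\<close>

definition body :: program where
  "body = Cond 1 Close (Pop 1 ;; Push 2 Close)
     (Cond 1 One (Pop 1 ;; Push 2 Open ;; move_block 1 2 ;; move_block 1 2)
        (move_block 1 12 ;; unary ;; locate ;; process_node))"

text \<open>Quadratic because of the conversion to unary: an index has at most 2M symbols, and each
  costs time linear in M.\<close>

definition step_bound :: "nat \<Rightarrow> nat" where "step_bound M = 1000 * (M * M)"

lemma linear_le_step_bound: "0 < M \<Longrightarrow> t \<le> 1000 * M \<Longrightarrow> t \<le>
    step_bound M"
  by (cases M) (auto simp: step_bound_def)

text \<open>A backward step: a bound for the rest of the loop gives one for the loop that includes
  this round. The other kinds of agenda items are treated in the same form, so that rounds chain by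
  plain implication.\<close>

lemma loop_close:
  assumes "halts (Loop 1 body) (st A G (Close # Out) k []) t s" "0 < M"
  shows "halts (Loop 1 body) (st A (Close # G) Out k []) (t + step_bound M) s"
proof -
  have "halts body (st A (Close # G) Out k []) (Suc (Suc 0 + Suc 0)) (st A G (Close # Out) k [])"
    unfolding body_def
    apply (rule halts_Cond_True)
     apply (simp add: mk_simps)
    apply (rule halts_Seq, rule halts_Pop, simp add: mk_simps)
    apply (rule halts_Push, simp add: mk_simps)
    done
  from halts_Loop_step[OF _ this assms(1)]
  have "halts (Loop 1 body) (st A (Close # G) Out k []) (Suc (Suc (Suc 0 + Suc 0) + t)) s"
    by (simp add: mk_simps)
  then show ?thesis
    by (rule halts_weaken) (use linear_le_step_bound[OF assms(2), of 4] assms(2) in simp)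
qed

lemma loop_header:
  assumes "halts (Loop 1 body) (st A G (rev (Open # nat_word x @ clause_word C) @ Out) k []) t s"
    and "length (nat_word x) + length (clause_word C) \<le> 2 * M" "0 < M"
  shows "halts (Loop 1 body) (st A (One # nat_word x @ clause_word C @ G) Out k []) (t + step_bound M) s"
proof -
  have "halts body (st A (One # nat_word x @ clause_word C @ G) Out k [])
      (Suc (Suc (Suc 0 + (Suc 0 + (10 * length (nat_word x) + 10 * length (clause_word C))))))
      (st A G (rev (Open # nat_word x @ clause_word C) @ Out) k [])"
    unfolding body_def
    apply (rule halts_Cond_False)
     apply (simp add: mk_simps)
    apply (rule halts_Cond_True)
     apply (simp add: mk_simps)
    apply (rule halts_Seq, rule halts_Pop, simp add: mk_simps)
    apply (rule halts_Seq, rule halts_Push, simp add: mk_simps)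
    apply (rule halts_Seq)
     apply (rule halts_move_block[where w = "nat_word x" and rest = "clause_word C @ G"])
           apply (simp add: mk_simps)
          apply (rule block_nat_word)
         apply (simp_all add: mk_simps)[5]
    apply (rule halts_move_block[where w = "clause_word C" and rest = "G"])
          apply (simp add: mk_simps)
         apply (rule block_clause_word)
        apply (simp_all add: mk_simps)
    done
  from halts_Loop_step[OF _ this assms(1)]
  have "halts (Loop 1 body) (st A (One # nat_word x @ clause_word C @ G) Out k [])
      (Suc (Suc (Suc (Suc 0 + (Suc 0 + (10 * length (nat_word x) + 10 * length (clause_word C)))))
          + t)) s"
    by (simp add: mk_simps)
  then show ?thesis
    by (rule halts_weaken) (use assms(2,3) linear_le_step_bound[OF assms(3),
          of "5 + 10 * length (nat_word x) + 10 * length (clause_word C)"] in simp)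
qed

text \<open>The effect of \<open>process_node\<close> is a hypothesis, so that sources and derived
  nodes share the analysis of decoding and seeking.\<close>

lemma halts_body_visit:
  assumes "v < length D" "length (nodes_word D) + k + 1 \<le> M"
    and "halts process_node (st (nodes_word (drop v D) @ [Close]) G Out k (rev (nodes_word (take v D))))
      (200 * (length (nodes_word D) + k + 1)) s"
  shows "halts body (st (nodes_word D @ [Close]) (nat_word v @ G) Out k []) (400 * (M * M)) s"
proof -
  have le: "length D \<le> length (nodes_word D)"
  proof (induction D)
    case (Cons n D)
    then show ?case by (cases n) (auto simp: node_word_Source node_word_Derived)
  qed auto
  have hd: "hd (nat_word v @ G) = Open" for G by (simp add: nat_word_def bracket_def)
  let ?w = "nat_word v"
  have run: "halts body (st (nodes_word D @ [Close]) (nat_word v @ G) Out k [])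
      (Suc (Suc (10 * length ?w + ((length (rev ?w) * (16 * horner 0 (rev ?w) + 10) + 1) +
         ((2 * v + 10 * length (nodes_word D) + 1) + (200 * (length (nodes_word D) + k + 1))))))) s"
    unfolding body_def
    apply (rule halts_Cond_False)
     apply (simp add: mk_simps hd)
    apply (rule halts_Cond_False)
     apply (simp add: mk_simps hd)
    apply (rule halts_Seq)
     apply (rule halts_move_block[where w = ?w and rest = G])
           apply (simp add: mk_simps)
          apply (rule block_nat_word)
         apply (simp_all add: mk_simps)[5]
    apply (rule halts_Seq)
     apply (rule halts_unary[where u = 0])
       apply (simp_all add: mk_simps)[3]
    apply (rule halts_Seq)
     apply (rule halts_locate[where v = v and D = D and rest = "[Close]"])
        apply (use assms(1) in \<open>simp_all add: mk_simps horner_rev_nat_word\<close>)[4]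
    apply (use assms(3) in \<open>simp add: mk_simps\<close>)
    done
  have v: "v + 1 \<le> M" using assms(1,2) le by linarith
  have w: "length ?w \<le> 2 * M" using length_nat_word[of v] v by linarith
  have "length ?w * (16 * v + 10) \<le> (2 * M) * (26 * M)"
    using w v by (intro mult_mono) auto
  then have "length ?w * (16 * v + 10) \<le> 52 * (M * M)" by simp
  moreover have "M \<le> M * M" by (cases M) auto
  moreover have "10 * a + ((p + 1) + ((2 * v + 10 * n + 1) + 200 * (n + k + 1))) + 2 \<le> 400 * q"
    if "p \<le> 52 * q" "M \<le> q" "a \<le> 2 * M" "v + 1 \<le> M" "n + k + 1 \<le> M" for a p q n
  proof -
    have "10 * a \<le> 20 * M" "2 * v \<le> 2 * M" "10 * n \<le> 10 * M" "200 * (n + k + 1) \<le>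
        200 * M" "1 \<le> M"
      using that by simp_all
    then show ?thesis using that(1,2) by linarith
  qed
  ultimately have "Suc (Suc (10 * length ?w + ((length ?w * (16 * v + 10) + 1) +
      ((2 * v + 10 * length (nodes_word D) + 1) + 200 * (length (nodes_word D) + k + 1))))) \<le>
          400 * (M * M)"
    using w v assms(2)
    by (metis add_2_eq_Suc')
  then show ?thesis
    by (intro halts_weaken[OF run]) (simp only: length_rev horner_rev_nat_word)
qed

lemma loop_Source:
  assumes "halts (Loop 1 body) (st (nodes_word D @ [Close]) G (rev (tree_word (Leaf C)) @ Out) k []) t s"
    and "v < length D" "D ! v = Source C" "length (nodes_word D) + k + 1 \<le> M"
  shows "halts (Loop 1 body) (st (nodes_word D @ [Close]) (nat_word v @ G) Out k []) (t +
      step_bound M) s"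
proof -
  have "nat_word v @ G \<noteq> []" by (simp add: nat_word_def bracket_def)
  moreover have "halts body (st (nodes_word D @ [Close]) (nat_word v @ G) Out k []) (400 * (M * M))
      (st (nodes_word D @ [Close]) G (rev (tree_word (Leaf C)) @ Out) k [])"
    by (rule halts_body_visit[OF assms(2,4)], rule halts_weaken, rule halts_process_Source[OF
        assms(2,3)]) simp
  ultimately have "halts (Loop 1 body) (st (nodes_word D @ [Close]) (nat_word v @ G) Out k [])
      (Suc (400 * (M * M) + t)) s"
    using assms(1) by (intro halts_Loop_step) (simp add: mk_simps)
  moreover have "1 \<le> M * M" using assms(4) by (cases M) auto
  ultimately show ?thesis by (elim halts_weaken) (simp add: step_bound_def)
qed

lemma loop_Derived:
  assumes "halts (Loop 1 body) (st (nodes_word (D[v := Source C]) @ [Close])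
        (One # nat_word (fresh k) @ clause_word C @
         One # (nat_word x @ clause_word C @ nat_word i @ nat_word j @ [Close]) @
         One # (nat_word x @ clause_word C @ nat_word i @ nat_word j @ [Close]) @ Close # G)
        Out (Suc k) []) t s"
    and "v < length D" "D ! v = Derived x C i j" "length (nodes_word D) + k + 1 \<le> M"
  shows "halts (Loop 1 body) (st (nodes_word D @ [Close]) (nat_word v @ G) Out k []) (t +
      step_bound M) s"
proof -
  have "nat_word v @ G \<noteq> []" by (simp add: nat_word_def bracket_def)
  moreover note halts_body_visit[OF assms(2,4) halts_process_Derived[OF assms(2,3)]]
  ultimately have "halts (Loop 1 body) (st (nodes_word D @ [Close]) (nat_word v @ G) Out k [])
      (Suc (400 * (M * M) + t)) s"
    using assms(1) by (intro halts_Loop_step) (simp_all add: mk_simps)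
  moreover have "1 \<le> M * M" using assms(4) by (cases M) auto
  ultimately show ?thesis by (elim halts_weaken) (simp add: step_bound_def)
qed

lemma length_node_word_le: "v < length D \<Longrightarrow> length (node_word (D ! v)) \<le> length
    (nodes_word D)"
  using arg_cong[OF nodes_word_update[of v D "D ! v"], of length] by simp

lemma length_le_nodes_word: "length D \<le> length (nodes_word D)"
proof (induction D)
  case (Cons n D)
  then show ?case by (cases n) (auto simp: node_word_Source node_word_Derived)
qed auto

lemma length_nodes_word_update:
  assumes "v < length D" "D ! v = Derived x C i j"
  shows "length (nodes_word (D[v := Source C])) \<le> length (nodes_word D)"
  using arg_cong[OF nodes_word_update[OF assms(1), of "Source C"], of length]
    arg_cong[OF nodes_word_update[OF assms(1), of "D ! v"], of length] assms(2) list_update_id[of D v]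
  by (simp add: node_word_Source node_word_Derived)

text \<open>Continuation-passing style: \<open>G\<close> is the rest of the agenda.\<close>

definition emits :: "nat \<Rightarrow> nat \<Rightarrow> dag \<Rightarrow> nat \<Rightarrow> word
    \<Rightarrow> rtree \<Rightarrow> dag \<Rightarrow> nat \<Rightarrow> bool" where
  "emits M b D k g T D' k' \<longleftrightarrow> (\<forall>G Out t s.
     halts (Loop 1 body) (st (nodes_word D' @ [Close]) G (rev (tree_word T) @ Out) k' []) t s
         \<longrightarrow>
     halts (Loop 1 body) (st (nodes_word D @ [Close]) (g @ G) Out k []) (t + b * step_bound M) s)"

definition expansion_word :: "nat \<Rightarrow> nat \<Rightarrow> clause \<Rightarrow> nat
    \<Rightarrow> nat \<Rightarrow> word" where
  "expansion_word k x C i j = (let W = nat_word x @ clause_word C @ nat_word i @ nat_word j @ [Close]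
     in One # nat_word (fresh k) @ clause_word C @ One # W @ One # W @ [Close])"

lemma emits_weaken: "emits M b D k g T D' k' \<Longrightarrow> b \<le> b' \<Longrightarrow> emits M
    b' D k g T D' k'"
  unfolding emits_def by (meson add_left_mono halts_weaken mult_le_mono1)

text \<open>The 6 rounds besides the four subtrees are three headers and three closing brackets. The
  agenda is traversed from its end to its beginning, since \<open>emits\<close> transforms bounds
  for continuations.\<close>

lemma emits_expansion:
  assumes e: "emits M b1 D (Suc k) (nat_word i) Ti D1 k1" "emits M b2 D1 k1 (nat_word j) Tj D2 k2"
      "emits M b3 D2 k2 (nat_word i) Ti' D3 k3" "emits M b4 D3 k3 (nat_word j) Tj' D4 k4"
    and le: "length (nat_word x) + length (clause_word C) \<le> M" "k + 2 \<le> M"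
  shows "emits M (6 + (b1 + b2 + b3 + b4)) D (Suc k) (expansion_word k x C i j)
     (Node (fresh k) C (Node x C Ti Tj) (Node x C Ti' Tj')) D4 k4"
  unfolding emits_def
proof (intro allI impI)
  fix G Out t s
  let ?h = "rev (Open # nat_word (fresh k) @ clause_word C) @ Out"
  let ?h1 = "rev (Open # nat_word x @ clause_word C) @ ?h"
  let ?i1 = "rev (tree_word Ti) @ ?h1"
  let ?j1 = "Close # rev (tree_word Tj) @ ?i1"
  let ?h2 = "rev (Open # nat_word x @ clause_word C) @ ?j1"
  let ?i2 = "rev (tree_word Ti') @ ?h2"
  let ?j2 = "Close # Close # rev (tree_word Tj') @ ?i2"
  let ?K = "step_bound M"
  assume "halts (Loop 1 body) (st (nodes_word D4 @ [Close]) G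
     (rev (tree_word (Node (fresh k) C (Node x C Ti Tj) (Node x C Ti' Tj'))) @ Out) k4 []) t s"
  then have "halts (Loop 1 body) (st (nodes_word D4 @ [Close]) G ?j2 k4 []) t s"
    by (simp add: tree_word_Node)
  then have "halts (Loop 1 body) (st (nodes_word D4 @ [Close]) (Close # G)
      (Close # rev (tree_word Tj') @ ?i2) k4 []) (t + ?K) s"
    by (rule loop_close) (use le in simp)
  then have "halts (Loop 1 body) (st (nodes_word D4 @ [Close]) (Close # Close # G)
      (rev (tree_word Tj') @ ?i2) k4 []) (t + ?K + ?K) s"
    by (rule loop_close) (use le in simp)
  then have "halts (Loop 1 body) (st (nodes_word D3 @ [Close]) (nat_word j @ Close # Close # G)
      ?i2 k3 []) (t + ?K + ?K + b4 * ?K) s"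
    using e(4) unfolding emits_def by blast
  then have "halts (Loop 1 body) (st (nodes_word D2 @ [Close]) (nat_word i @ nat_word j @ Close #
      Close # G)
      ?h2 k2 []) (t + ?K + ?K + b4 * ?K + b3 * ?K) s"
    using e(3) unfolding emits_def by blast
  then have "halts (Loop 1 body) (st (nodes_word D2 @ [Close]) (One # nat_word x @ clause_word C @
      nat_word i @ nat_word j @ Close # Close # G)
      ?j1 k2 []) (t + ?K + ?K + b4 * ?K + b3 * ?K + ?K) s"
    by (rule loop_header) (use le in simp_all)
  then have "halts (Loop 1 body) (st (nodes_word D2 @ [Close]) (Close # One # nat_word x @
      clause_word C @
      nat_word i @ nat_word j @ Close # Close # G)
      (rev (tree_word Tj) @ ?i1) k2 []) (t + ?K + ?K + b4 * ?K + b3 * ?K + ?K + ?K) s"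
    by (rule loop_close) (use le in simp)
  then have "halts (Loop 1 body) (st (nodes_word D1 @ [Close]) (nat_word j @ Close # One # nat_word
      x @ clause_word C @
      nat_word i @ nat_word j @ Close # Close # G)
      ?i1 k1 []) (t + ?K + ?K + b4 * ?K + b3 * ?K + ?K + ?K + b2 * ?K) s"
    using e(2) unfolding emits_def by blast
  then have "halts (Loop 1 body) (st (nodes_word D @ [Close]) (nat_word i @ nat_word j @ Close #
      One # nat_word x @ clause_word C @
      nat_word i @ nat_word j @ Close # Close # G)
      ?h1 (Suc k) []) (t + ?K + ?K + b4 * ?K + b3 * ?K + ?K + ?K + b2 * ?K + b1 * ?K) s"
    using e(1) unfolding emits_def by blast
  then have "halts (Loop 1 body) (st (nodes_word D @ [Close]) (One # nat_word x @ clause_word C @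
      nat_word i @ nat_word j @ Close # One # nat_word x @ clause_word C @
      nat_word i @ nat_word j @ Close # Close # G)
      ?h (Suc k) []) (t + ?K + ?K + b4 * ?K + b3 * ?K + ?K + ?K + b2 * ?K + b1 * ?K + ?K) s"
    by (rule loop_header) (use le in simp_all)
  then have "halts (Loop 1 body) (st (nodes_word D @ [Close]) (One # nat_word (fresh k) @
      clause_word C @ One # nat_word x @ clause_word C @ nat_word i @ nat_word j @ Close # One #
      nat_word x @ clause_word C @
      nat_word i @ nat_word j @ Close # Close # G)
      Out (Suc k) []) (t + ?K + ?K + b4 * ?K + b3 * ?K + ?K + ?K + b2 * ?K + b1 * ?K + ?K + ?K) s"
    by (rule loop_header) (use le in \<open>simp_all add: nat_word_fresh\<close>)
  from halts_weaken[OF this, of "t + (6 + (b1 + b2 + b3 + b4)) * ?K"]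
  show "halts (Loop 1 body) (st (nodes_word D @ [Close]) (expansion_word k x C i j @ G) Out (Suc k) [])
      (t + (6 + (b1 + b2 + b3 + b4)) * ?K) s"
    by (simp add: expansion_word_def algebra_simps)
qed

context regRD_dag
begin

text \<open>\<open>M\<close> survives the traversal: node words only shrink, and every increment of
  the counter is paid for by a derived node turned into a source. An expansion takes 6 rounds and
  one for each of its four visits, while one derived node disappears; 12 rounds per derived node
  cover this. The claim about \<open>expansion_word\<close> serves the root, which is processed
  without ever being an agenda item.\<close>

lemma emits_expand:
  "expand D k v T D' k' \<Longrightarrow> marked D \<Longrightarrow> v < length D0 \<Longrightarrow>
     length (nodes_word D) + k + derived_count D + 1 \<le> M \<Longrightarrow>
     length (nodes_word D') + k' + derived_count D' + 1 \<le> M \<and>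
     (\<forall>x C i j. D ! v = Derived x C i j \<longrightarrow>
        emits M (12 * (derived_count D - derived_count D')) (D[v := Source C]) (Suc k)
          (expansion_word k x C i j) T D' k') \<and>
     emits M (1 + 12 * (derived_count D - derived_count D')) D k (nat_word v) T D' k'"
proof (induction rule: expand.induct)
  case (expand_Source D v C k)
  have v: "v < length D" using expand_Source.prems by (simp add: marked_def)
  have "emits M 1 D k (nat_word v) (Leaf C) D k"
    unfolding emits_def
  proof (intro allI impI)
    fix G Out t s
    assume "halts (Loop 1 body) (st (nodes_word D @ [Close]) G (rev (tree_word (Leaf C)) @ Out) k
        []) t s"
    then have "halts (Loop 1 body) (st (nodes_word D @ [Close]) (nat_word v @ G) Out k []) (t +
        step_bound M) s"
      by (rule loop_Source[OF _ v expand_Source.hyps]) (use expand_Source.prems in simp)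
    then show "halts (Loop 1 body) (st (nodes_word D @ [Close]) (nat_word v @ G) Out k []) (t + 1 *
        step_bound M) s"
      by simp
  qed
  then show ?case using expand_Source by simp
next
  case (expand_Derived D v x C i j k Ti D1 k1 Tj D2 k2 Ti' D3 k3 Tj' D4 k4)
  let ?D = "D[v := Source C]"
  note m = marked_Derived[OF expand_Derived.prems(1,2) expand_Derived.hyps(1)]
  note m1 = expand_marked[OF expand_Derived.hyps(2) m(7,2)]
  note m2 = expand_marked[OF expand_Derived.hyps(3) conjunct1[OF m1] m(3)]
  note m3 = expand_marked[OF expand_Derived.hyps(4) conjunct1[OF m2] m(2)]
  note m4 = expand_marked[OF expand_Derived.hyps(5) conjunct1[OF m3] m(3)]
  have pos: "length (post_order T) \<ge> 1" for T by (cases T) auto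
  have v: "v < length D" using expand_Derived.prems by (simp add: marked_def)
  have dc: "derived_count D = Suc (derived_count ?D)"
    using derived_count_update[OF v expand_Derived.hyps(1)] by simp
  have "length (nodes_word ?D) + Suc k + derived_count ?D + 1 \<le> M"
    using length_nodes_word_update[OF v expand_Derived.hyps(1)] dc expand_Derived.prems(3) by linarith
  note 1 = expand_Derived.IH(1)[OF m(7,2) this]
  note 2 = expand_Derived.IH(2)[OF conjunct1[OF m1] m(3) conjunct1[OF 1]]
  note 3 = expand_Derived.IH(3)[OF conjunct1[OF m2] m(2) conjunct1[OF 2]]
  note 4 = expand_Derived.IH(4)[OF conjunct1[OF m3] m(3) conjunct1[OF 3]]
  have d: "derived_count D1 \<le> derived_count ?D" "derived_count D2 \<le> derived_count D1"
    "derived_count D3 \<le> derived_count D2" "derived_count D4 \<le> derived_count D3"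
    using m1 m2 m3 m4 pos[of Ti] pos[of Tj] pos[of Ti'] pos[of Tj'] by linarith+
  have w: "length (nat_word x) + length (clause_word C) \<le> M" "k + 2 \<le> M"
    using length_node_word_le[OF v] expand_Derived.prems(3) expand_Derived.hyps(1) dc
    by (simp_all add: node_word_Derived)
  let ?T = "Node (fresh k) C (Node x C Ti Tj) (Node x C Ti' Tj')"
  have "emits M (6 + ((1 + 12 * (derived_count ?D - derived_count D1)) +
      (1 + 12 * (derived_count D1 - derived_count D2)) + (1 + 12 * (derived_count D2 -
          derived_count D3)) +
      (1 + 12 * (derived_count D3 - derived_count D4)))) ?D (Suc k) (expansion_word k x C i j) ?T D4 k4"
    using 1 2 3 4 w by (intro emits_expansion) auto
  then have e: "emits M (12 * (derived_count D - derived_count D4)) ?D (Suc k) (expansion_word k x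
      C i j) ?T D4 k4"
    by (rule emits_weaken) (use d dc in linarith)
  have "emits M (1 + 12 * (derived_count D - derived_count D4)) D k (nat_word v) ?T D4 k4"
    unfolding emits_def
  proof (intro allI impI)
    fix G Out t s
    assume "halts (Loop 1 body) (st (nodes_word D4 @ [Close]) G (rev (tree_word ?T) @ Out) k4 []) t s"
    then have "halts (Loop 1 body) (st (nodes_word ?D @ [Close]) (expansion_word k x C i j @ G) Out
        (Suc k) [])
        (t + (12 * (derived_count D - derived_count D4)) * step_bound M) s"
      using e unfolding emits_def by blast
    then have "halts (Loop 1 body) (st (nodes_word D @ [Close]) (nat_word v @ G) Out k [])
        (t + (12 * (derived_count D - derived_count D4)) * step_bound M + step_bound M) s"
      by (intro loop_Derived[OF _ v expand_Derived.hyps(1)])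
        (use expand_Derived.prems(3) in \<open>simp_all add: expansion_word_def\<close>)
    then show "halts (Loop 1 body) (st (nodes_word D @ [Close]) (nat_word v @ G) Out k [])
        (t + (1 + 12 * (derived_count D - derived_count D4)) * step_bound M) s"
      by (simp add: algebra_simps)
  qed
  then show ?case using 4 e expand_Derived.hyps(1) by simp
qed

end

section \<open>Locating the sink and starting up\<close>

definition parse_entry :: program where
  "parse_entry = move_block 0 5 ;; xfer2 5 6 7 ;; Pop 6 ;; move_block 6 8 ;;
     Cond 6 Close Skip (clear 8 ;; move_block 6 8) ;; clear 6"

text \<open>The clause word lies reversed on stack 8. Once its last bracket is popped, an
  \<open>Open\<close> on top means that nothing stood between the brackets; otherwise the
  \<open>Close\<close> of the last literal appears. Stack 14 is the flag that keeps the search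
  going.\<close>

definition test_entry :: program where
  "test_entry = Pop 8 ;; Cond 8 Open (Pop 14 ;; xfer1 7 5 ;; xfer1 5 0) (xfer1 7 4) ;; clear 8"

definition find_sink :: program where
  "find_sink = Push 14 One ;; Loop 14 (parse_entry ;; test_entry)"

abbreviation sst :: "word \<Rightarrow> word \<Rightarrow> word \<Rightarrow> nat \<Rightarrow>
    word \<Rightarrow> word \<Rightarrow> store" where
  "sst A G Out k B f \<equiv> mk [A, G, Out, replicate k One, B, [], [], [], [], [], [], [], [], [], f]"

abbreviation pst :: "word \<Rightarrow> word \<Rightarrow> word \<Rightarrow> nat \<Rightarrow>
    word \<Rightarrow> word \<Rightarrow> word \<Rightarrow> word \<Rightarrow> store" where
  "pst A G Out k B V Z f \<equiv> mk [A, G, Out, replicate k One, B, [], [], V, Z, [], [], [], [],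
      [], f]"

lemma clause_word_cases:
  obtains u where "clause_word C = Open # u @ [Close]" "neutral u" "C = {||} \<longleftrightarrow>
      u = []"
    "u \<noteq> [] \<Longrightarrow> last u = Close"
proof
  let ?l = "sorted_list_of_fset (literal_index |`| C)"
  let ?u = "concat (map nat_word ?l)"
  show "clause_word C = Open # ?u @ [Close]" by (simp add: clause_word_def bracket_def)
  show "neutral ?u" by (intro neutral_concat) (auto simp: neutral_nat_word)
  have n: "nat_word y = Open # bits y @ [Close]" for y by (simp add: nat_word_def bracket_def)
  have "?l = [] \<longleftrightarrow> literal_index |`| C = {||}"
    by (metis sorted_list_of_fset_simps(1) fset_of_list_simps(1) sorted_list_of_fset.rep_eq
      sorted_list_of_set.set_sorted_key_list_of_set finite_fset set_empty bot_fset.rep_eq fset_inject)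
  then show "C = {||} \<longleftrightarrow> ?u = []"
    by (cases ?l) (auto simp: n)
  show "last ?u = Close" if "?u \<noteq> []"
    using that by (cases ?l rule: rev_cases) (auto simp: n)
qed

lemma halts_parse_entry:
  "halts parse_entry
     (sst (node_word n @ R) G Out k B f) (100 * length (node_word n))
     (pst R G Out k B (node_word n) (rev (clause_word (node_clause n))) f)"
proof (cases n)
  case (Source C)
  show ?thesis unfolding Source node_word_Source parse_entry_def
    apply (rule halts_weaken)
     apply (rule halts_Seq)
      apply (rule halts_move_block[where w = "Open # clause_word C @ [Close]" and rest = R])
            apply (simp add: mk_simps)
           apply (rule block_neutral[OF neutral_clause_word])
          apply (simp_all add: mk_simps)[5]
     apply (rule halts_Seq, rule halts_xfer2, simp, simp add: mk_simps)
     apply (rule halts_Seq, rule halts_Pop, simp add: mk_simps)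
     apply (rule halts_Seq)
      apply (rule halts_move_block[where w = "clause_word C" and rest = "[Close]"])
            apply (simp add: mk_simps)
           apply (rule block_clause_word)
          apply (simp_all add: mk_simps)[5]
     apply (rule halts_Seq)
      apply (rule halts_Cond_True)
       apply (simp add: mk_simps)
      apply (rule halts_Skip)
     apply (rule halts_clear, simp add: mk_simps)
    apply (simp add: mk_simps)
    done
next
  case (Derived x C i j)
  have n: "neutral (nat_word x @ clause_word C @ nat_word i @ nat_word j)"
    by (intro neutral_append neutral_nat_word neutral_clause_word)
  have hd: "hd (clause_word C @ u) \<noteq> Close" for u
    by (simp add: clause_word_def bracket_def)
  show ?thesis unfolding Derived node_word_Derived parse_entry_def
    apply (rule halts_weaken)
     apply (rule halts_Seq)
      apply (rule halts_move_block[where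
          w = "Open # nat_word x @ clause_word C @ nat_word i @ nat_word j @ [Close]" and rest = R])
            apply (simp add: mk_simps)
           apply (use block_neutral[OF n] in simp)
          apply (simp_all add: mk_simps)[5]
     apply (rule halts_Seq, rule halts_xfer2, simp, simp add: mk_simps)
     apply (rule halts_Seq, rule halts_Pop, simp add: mk_simps)
     apply (rule halts_Seq)
      apply (rule halts_move_block[where w = "nat_word x" and
          rest = "clause_word C @ nat_word i @ nat_word j @ [Close]"])
            apply (simp add: mk_simps)
           apply (rule block_nat_word)
          apply (simp_all add: mk_simps)[5]
     apply (rule halts_Seq)
      apply (rule halts_Cond_False)
       apply (simp add: mk_simps hd)
      apply (rule halts_Seq, rule halts_clear, simp add: mk_simps)
      apply (rule halts_move_block[where w = "clause_word C" and rest = "nat_word i @ nat_word j @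
          [Close]"])
            apply (simp add: mk_simps)
           apply (rule block_clause_word)
          apply (simp_all add: mk_simps)[5]
     apply (rule halts_clear, simp add: mk_simps)
    apply (simp add: mk_simps)
    done
qed

lemma length_clause_word_le: "length (clause_word (node_clause n)) \<le> length (node_word n)"
  by (cases n) (auto simp: node_word_Source node_word_Derived)

lemma halts_find_sink_skip:
  assumes "node_clause n \<noteq> {||}"
  shows "halts (parse_entry ;; test_entry) (sst (node_word n @ R) G Out k B [One])
     (200 * length (node_word n)) (sst R G Out k (rev (node_word n) @ B) [One])"
proof -
  obtain u where u: "clause_word (node_clause n) = Open # u @ [Close]" "u \<noteq> []" "last u = Close"
    using assms by (cases rule: clause_word_cases[of "node_clause n"]) auto
  have hd: "hd (rev u @ [Open]) = Close" using u by (simp add: hd_rev)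
  have len: "length u + 2 \<le> length (node_word n)"
    using length_clause_word_le[of n] u(1) by simp
  have "halts test_entry
     (pst R G Out k B (node_word n) (rev (clause_word (node_clause n))) [One]) (50 * length
         (node_word n))
     (sst R G Out k (rev (node_word n) @ B) [One])"
    unfolding u(1) test_entry_def
    apply (rule halts_weaken)
     apply (rule halts_Seq, rule halts_Pop, simp add: mk_simps)
     apply (rule halts_Seq)
      apply (rule halts_Cond_False)
       apply (simp add: mk_simps hd)
      apply (rule halts_xfer1, simp, simp add: mk_simps)
     apply (rule halts_clear, simp add: mk_simps)
    apply (use len in \<open>simp add: mk_simps\<close>)
    done
  from halts_Seq[OF halts_parse_entry this] show ?thesis
    by (rule halts_weaken) simp
qed

lemma halts_find_sink_stop:
  assumes "node_clause n = {||}"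
  shows "halts (parse_entry ;; test_entry) (sst (node_word n @ R) G Out k B [One])
     (200 * length (node_word n)) (sst (node_word n @ R) G Out k B [])"
proof -
  have u: "clause_word (node_clause n) = [Open, Close]"
    using assms by (cases rule: clause_word_cases[of "node_clause n"]) auto
  have len: "2 \<le> length (node_word n)"
    using length_clause_word_le[of n] u(1) by simp
  have "halts test_entry
     (pst R G Out k B (node_word n) (rev (clause_word (node_clause n))) [One]) (50 * length
         (node_word n))
     (sst (node_word n @ R) G Out k B [])"
    unfolding u(1) test_entry_def
    apply (rule halts_weaken)
     apply (rule halts_Seq, rule halts_Pop, simp add: mk_simps)
     apply (rule halts_Seq)
      apply (rule halts_Cond_True)
       apply (simp add: mk_simps)
      apply (rule halts_Seq, rule halts_Pop, simp add: mk_simps)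
      apply (rule halts_Seq, rule halts_xfer1, simp, simp add: mk_simps)
      apply (rule halts_xfer1, simp, simp add: mk_simps)
     apply (rule halts_clear, simp add: mk_simps)
    apply (use len in \<open>simp add: mk_simps\<close>)
    done
  from halts_Seq[OF halts_parse_entry this] show ?thesis
    by (rule halts_weaken) simp
qed

lemma halts_find_sink_loop:
  assumes "\<forall>m\<in>set D1. node_clause m \<noteq> {||}" "node_clause n = {||}"
  shows "halts (Loop 14 (parse_entry ;; test_entry)) (sst (nodes_word (D1 @ [n]) @ R) G Out k B [One])
     (201 * length (nodes_word (D1 @ [n])) + 1)
     (sst (node_word n @ R) G Out k (rev (nodes_word D1) @ B) [])"
  using assms(1)
proof (induction D1 arbitrary: B)
  case Nil
  have "node_word n \<noteq> []" by (cases n) (auto simp: node_word_Source node_word_Derived)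
  then have "1 \<le> length (node_word n)" by (cases "node_word n") auto
  have "halts (Loop 14 (parse_entry ;; test_entry)) (sst (node_word n @ R) G Out k B [One])
      (Suc (200 * length (node_word n) + Suc 0)) (sst (node_word n @ R) G Out k B [])"
    by (rule halts_Loop_step, simp add: mk_simps, rule halts_find_sink_stop[OF assms(2)],
        rule halts_Loop_end, simp add: mk_simps)
  then show ?case using \<open>1 \<le> length (node_word n)\<close> by (auto elim: halts_weaken)
next
  case (Cons m D1)
  have "node_word m \<noteq> []" by (cases m) (auto simp: node_word_Source node_word_Derived)
  then have l: "1 \<le> length (node_word m)" by (cases "node_word m") auto
  have "halts (parse_entry ;; test_entry) (sst (node_word m @ nodes_word (D1 @ [n]) @ R) G Out k B [One])
     (200 * length (node_word m)) (sst (nodes_word (D1 @ [n]) @ R) G Out k (rev (node_word m) @ B)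
         [One])"
    using Cons.prems by (intro halts_find_sink_skip) auto
  moreover have "halts (Loop 14 (parse_entry ;; test_entry))
      (sst (nodes_word (D1 @ [n]) @ R) G Out k (rev (node_word m) @ B) [One])
     (201 * length (nodes_word (D1 @ [n])) + 1)
     (sst (node_word n @ R) G Out k (rev (nodes_word D1) @ rev (node_word m) @ B) [])"
    using Cons.prems by (intro Cons.IH) auto
  ultimately have "halts (Loop 14 (parse_entry ;; test_entry))
      (sst (node_word m @ nodes_word (D1 @ [n]) @ R) G Out k B [One])
      (Suc (200 * length (node_word m) + (201 * length (nodes_word (D1 @ [n])) + 1)))
      (sst (node_word n @ R) G Out k (rev (nodes_word D1) @ rev (node_word m) @ B) [])"
    by (intro halts_Loop_step) (simp_all add: mk_simps)
  from halts_weaken[OF this, of "201 * length (nodes_word ((m # D1) @ [n])) + 1"] show ?case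
    using l by simp
qed

lemma halts_find_sink:
  assumes "v < length D" "\<forall>w<v. node_clause (D ! w) \<noteq> {||}" "node_clause (D ! v) = {||}"
  shows "halts find_sink (st (nodes_word D @ [Close]) G Out k [])
     (201 * length (nodes_word D) + 2)
     (st (nodes_word (drop v D) @ [Close]) G Out k (rev (nodes_word (take v D))))"
proof -
  have D: "D = take v D @ [D ! v] @ drop (Suc v) D"
    using id_take_nth_drop[OF assms(1)] by simp
  have "\<forall>m\<in>set (take v D). node_clause m \<noteq> {||}"
    using assms(1,2) by (auto simp: in_set_conv_nth)
  have eq: "nodes_word (take v D @ [D ! v]) @ nodes_word (drop (Suc v) D) @ [Close] = nodes_word D
      @ [Close]"
      "node_word (D ! v) @ nodes_word (drop (Suc v) D) @ [Close] = nodes_word (drop v D) @ [Close]"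
    using nodes_word_update[OF assms(1), of "D ! v"] Cons_nth_drop_Suc[OF assms(1), symmetric] by
        simp_all
  from halts_find_sink_loop[OF \<open>\<forall>m\<in>set (take v D). node_clause m \<noteq>
      {||}\<close> assms(3), of "nodes_word (drop (Suc v) D) @ [Close]" G Out k "[]"]
  have "halts (Loop 14 (parse_entry ;; test_entry)) (sst (nodes_word D @ [Close]) G Out k [] [One])
     (201 * length (nodes_word (take v D @ [D ! v])) + 1)
     (st (nodes_word (drop v D) @ [Close]) G Out k (rev (nodes_word (take v D))))"
    unfolding eq append_Nil2 .
  moreover have "length (nodes_word (take v D @ [D ! v])) \<le> length (nodes_word D)"
    using nodes_word_update[OF assms(1), of "D ! v", symmetric] by simp
  ultimately have "halts (Loop 14 (parse_entry ;; test_entry)) (sst (nodes_word D @ [Close]) G Out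
      k [] [One])
     (201 * length (nodes_word D) + 1)
     (st (nodes_word (drop v D) @ [Close]) G Out k (rev (nodes_word (take v D))))"
    by (elim halts_weaken) simp
  moreover have "halts (Push 14 One) (st (nodes_word D @ [Close]) G Out k []) (Suc 0)
      (sst (nodes_word D @ [Close]) G Out k [] [One])"
    by (rule halts_Push) (simp add: mk_simps)
  ultimately show ?thesis unfolding find_sink_def
    by (intro halts_weaken[OF halts_Seq]) auto
qed

text \<open>Every input symbol also puts a \<open>One\<close> on stack 3, so the counter starts at
  the length of the input, where fresh variables exceed all variables occurring in it. The final pop
  drops the bracket that opens the list of nodes.\<close>

definition setup_stacks :: program where
  "setup_stacks = Loop 0 (sw 0 (\<lambda>x. Push 5 x ;; Push 3 One) ;; Pop 0) ;; xfer1 5 0 ;; Pop 0"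

lemma halts_setup_stacks:
  "halts setup_stacks (input_store w) (20 * length w + 20) (st (tl w) [] [] (length w) [])"
proof -
  let ?c = "sw 0 (\<lambda>x. Push 5 x ;; Push 3 One) ;; Pop 0"
  have loop: "halts (Loop 0 ?c) s (8 * length (s 0) + 1)
      (s(0 := [], 5 := rev (s 0) @ s 5, 3 := replicate (length (s 0)) One @ s 3))" for s
  proof (induction "s 0" arbitrary: s)
    case Nil
    then have eq: "s(0 := [], 5 := rev (s 0) @ s 5, 3 := replicate (length (s 0)) One @ s 3) = s"
      by (auto simp: fun_eq_iff)
    show ?case unfolding eq using Nil halts_Loop_end[of s 0] by simp
  next
    case (Cons x u)
    let ?s = "s(0 := u, 5 := x # s 5, 3 := One # s 3)"
    have eq: "?s(0 := [], 5 := rev (?s 0) @ ?s 5, 3 := replicate (length (?s 0)) One @ ?s 3) =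
        s(0 := [], 5 := rev (s 0) @ s 5, 3 := replicate (length (s 0)) One @ s 3)"
      using Cons.hyps(2)[symmetric] by (auto simp: fun_eq_iff replicate_append_One)
    have 1: "halts (Loop 0 ?c) ?s (8 * length (?s 0) + 1)
        (s(0 := [], 5 := rev (s 0) @ s 5, 3 := replicate (length (s 0)) One @ s 3))"
      unfolding eq[symmetric] by (rule Cons.hyps(1)) simp
    have "halts (Push 5 x ;; Push 3 One) s (Suc 0 + Suc 0) (s(5 := x # s 5, 3 := One # s 3))"
      by (rule halts_Seq, rule halts_Push, rule refl, rule halts_Push) simp
    then have "halts ?c s (Suc 0 + Suc 0 + 3 + Suc 0) ?s"
      by (intro halts_Seq[OF halts_sw] halts_Pop) (use Cons.hyps(2)[symmetric] in \<open>auto simp: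
          fun_eq_iff\<close>)
    from halts_Loop_step[OF _ this 1]
    have "halts (Loop 0 ?c) s (Suc (Suc 0 + Suc 0 + 3 + Suc 0 + (8 * length (?s 0) + 1)))
        (s(0 := [], 5 := rev (s 0) @ s 5, 3 := replicate (length (s 0)) One @ s 3))"
      using Cons.hyps(2)[symmetric] by simp
    then show ?case by (rule halts_weaken) (simp flip: Cons.hyps(2))
  qed
  have i: "input_store w = st w [] [] 0 []"
    by (auto simp: input_store_def mk_def fun_eq_iff nth_Cons' split: if_splits)
  have "halts setup_stacks (st w [] [] 0 [])
      ((8 * length ((st w [] [] 0 []) 0) + 1) + ((6 * length (rev w) + 1) + Suc 0)) (st (tl w) []
          [] (length w) [])"
    unfolding setup_stacks_def
    apply (rule halts_Seq, rule loop)
    apply (rule halts_Seq)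
     apply (rule halts_weaken, rule halts_xfer1, simp, simp add: mk_simps)
     apply (simp add: mk_simps)
    apply (rule halts_Pop, simp add: mk_simps)
    done
  then show ?thesis unfolding i by (rule halts_weaken) (simp add: mk_simps)
qed

definition translate :: program where
  "translate = (setup_stacks ;; find_sink) ;; (process_node ;; Loop 1 body) ;; clear 0 ;; xfer1 2 0"

text \<open>A unit of time lengthens a stack by at most one symbol. Hence the running time also
  bounds the length of the output, and with it the cost of copying the output to stack 0.\<close>

lemma exec_length: "exec c s t s' \<Longrightarrow> length (s' r) \<le> length (s r) + t"
  by (induction rule: exec.induct) auto

text \<open>The variable is written in binary inside the input, so it has fewer bits than the input
  has symbols.\<close>

lemma var_less_fresh:
  assumes "v < length D" "node_var (D ! v) = Some x"
  shows "x < fresh (length (dag_word D))"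
proof -
  have *: "n < 2 ^ length (bits n)" for n
  proof (induction n rule: bits.induct)
    case (1 n)
    then show ?case by (subst bits.simps) (cases "n = 0"; force)
  qed
  obtain C i j where "D ! v = Derived x C i j" using assms(2) by (cases "D ! v") auto
  then have "length (bits x) + 1 \<le> length (node_word (D ! v))"
    by (simp add: node_word_Derived nat_word_def bracket_def)
  also have "\<dots> \<le> length (nodes_word D)" by (rule length_node_word_le[OF assms(1)])
  also have "\<dots> \<le> length (dag_word D)" by (simp add: dag_word_def bracket_def)
  finally have "fresh (length (bits x) + 1) \<le> fresh (length (dag_word D))" by (rule fresh_mono)
  moreover have "x < fresh (length (bits x) + 1)"
    using *[of x] by (simp add: fresh_def)
  ultimately show ?thesis by simp
qed

context regRD_dag
begin

lemma halts_translate: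
  assumes v: "v < length D0" "node_clause (D0 ! v) = {||}"
    and T: "expand D0 (length (dag_word D0)) v T D' k'"
  shows "\<exists>s. halts translate (input_store (dag_word D0)) (20000000 * (length (dag_word D0)
      + 1) ^ 3) s \<and>
    s 0 = tree_word T"
proof -
  define L where "L = length (dag_word D0)"
  \<comment> \<open>Three summands, each at most about \<open>L\<close>: the node words, the initial
    counter and the number of derived nodes.\<close>
  define M where "M = 3 * (L + 1)"
  have N: "length (nodes_word D0) + 2 = L" by (simp add: L_def dag_word_def bracket_def)
  have dc: "derived_count D0 \<le> length (nodes_word D0)"
    using derived_count_le[of D0] length_le_nodes_word[of D0] by linarith
  have first: "\<forall>w<v. node_clause (D0 ! w) \<noteq> {||}"
    using sink_unique[OF v] v(1) by (metis less_trans nat_neq_iff)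
  have tl: "tl (dag_word D0) = nodes_word D0 @ [Close]"
    by (simp add: dag_word_def bracket_def)
  let ?s1 = "st (nodes_word (drop v D0) @ [Close]) [] [] L (rev (nodes_word (take v D0)))"
  have start: "halts (setup_stacks ;; find_sink) (input_store (dag_word D0)) (300 * (L + 1)) ?s1"
    using halts_Seq[OF halts_setup_stacks[of "dag_word D0", unfolded tl] halts_find_sink[OF v(1)
        first v(2)]] N
    unfolding L_def[symmetric] by (elim halts_weaken) simp
  let ?s3 = "st (nodes_word D' @ [Close]) [] (rev (tree_word T)) k' []"
  note m = expand_marked[OF T[folded L_def] marked_D0 v(1)]
  have pos: "length (post_order T) \<ge> 1" by (cases T) auto
  have k: "k' \<le> 2 * L" "length (nodes_word D') \<le> M"
    using emits_expand[OF T[folded L_def] marked_D0 v(1), of M] m dc N pos by (auto simp: M_def)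
  have main: "halts (process_node ;; Loop 1 body) ?s1 ((200 + 12 * (L + 1)) * step_bound M) ?s3"
    using T unfolding L_def[symmetric]
  proof (cases rule: expand.cases)
    case (expand_Source C)
    have "halts (Loop 1 body) ?s3 (Suc 0) ?s3" by (rule halts_Loop_end) (simp add: mk_simps)
    then have "halts (Loop 1 body) (st (nodes_word D0 @ [Close]) [] (rev (tree_word (Leaf C)) @ [])
        L []) (Suc 0) ?s3"
      using expand_Source by simp
    from halts_Seq[OF halts_process_Source[OF v(1) \<open>D0 ! v = Source C\<close>] this]
    show ?thesis
      by (rule halts_weaken) (use N in \<open>simp add: step_bound_def M_def algebra_simps\<close>)
  next
    case (expand_Derived x C i j Ti D1 k1 Tj D2 k2 Ti' D3 k3 Tj')
    have "emits M (12 * (derived_count D0 - derived_count D')) (D0[v := Source C]) (Suc L)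
        (expansion_word L x C i j) T D' k'"
      using emits_expand[OF T[folded L_def] marked_D0 v(1), of M] expand_Derived dc N by (auto
          simp: M_def)
    moreover have "halts (Loop 1 body) ?s3 (Suc 0) ?s3" by (rule halts_Loop_end) (simp add: mk_simps)
    ultimately have "halts (Loop 1 body)
        (st (nodes_word (D0[v := Source C]) @ [Close]) (expansion_word L x C i j @ []) [] (Suc L) [])
        (Suc 0 + (12 * (derived_count D0 - derived_count D')) * step_bound M) ?s3"
      unfolding emits_def by (metis append_Nil2)
    then have "halts (Loop 1 body)
        (st (nodes_word (D0[v := Source C]) @ [Close])
          (One # nat_word (fresh L) @ clause_word C @
           One # (nat_word x @ clause_word C @ nat_word i @ nat_word j @ [Close]) @
           One # (nat_word x @ clause_word C @ nat_word i @ nat_word j @ [Close]) @ Close # []) []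
               (Suc L) [])
        (Suc 0 + (12 * (derived_count D0 - derived_count D')) * step_bound M) ?s3"
      by (simp add: expansion_word_def Let_def)
    from halts_Seq[OF halts_process_Derived[OF v(1) \<open>D0 ! v = Derived x C i j\<close>] this]
    show ?thesis
    proof (rule halts_weaken)
      have "(12 * (derived_count D0 - derived_count D')) * step_bound M \<le> (12 * (L + 1)) *
          step_bound M"
        using dc N by (intro mult_le_mono1) simp
      moreover have "200 * (length (nodes_word D0) + L + 1) + Suc 0 \<le> 200 * step_bound M"
        using N by (simp add: step_bound_def M_def algebra_simps)
      ultimately show "200 * (length (nodes_word D0) + L + 1) +
          (Suc 0 + 12 * (derived_count D0 - derived_count D') * step_bound M)
          \<le> (200 + 12 * (L + 1)) * step_bound M"
        by (simp add: algebra_simps)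
    qed
  qed
  define R where "R = (200 + 12 * (L + 1)) * step_bound M"
  have "length (tree_word T) \<le> R" unfolding R_def
  proof -
    obtain t where "t \<le> (200 + 12 * (L + 1)) * step_bound M" "exec (process_node ;; Loop 1
        body) ?s1 t ?s3"
      using main by (auto simp: halts_def)
    with exec_length[OF this(2), of 2]
    show "length (tree_word T) \<le> (200 + 12 * (L + 1)) * step_bound M" by (simp add: mk_simps)
  qed
  have "halts (clear 0 ;; xfer1 2 0) ?s3 ((2 * (M + 1) + 1) + (6 * length (tree_word T) + 1))
      (st (tree_word T) [] [] k' [])"
    apply (rule halts_Seq)
     apply (rule halts_weaken, rule halts_clear, simp add: mk_simps)
     apply (use k in \<open>simp add: mk_simps\<close>)
    apply (rule halts_weaken, rule halts_xfer1, simp, simp add: mk_simps)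
    apply (simp add: mk_simps)
    done
  then have "halts (clear 0 ;; xfer1 2 0) ?s3 ((2 * (M + 1) + 1) + (6 * R + 1)) (st (tree_word T)
      [] [] k' [])"
    by (rule halts_weaken) (use \<open>length (tree_word T) \<le> R\<close> in simp)
  from halts_Seq[OF start halts_Seq[OF main[folded R_def] this]]
  have "halts translate (input_store (dag_word D0))
      (300 * (L + 1) + (R + ((2 * (M + 1) + 1) + (6 * R + 1)))) (st (tree_word T) [] [] k' [])"
    unfolding translate_def .
  moreover have "300 * (L + 1) + (R + ((2 * (M + 1) + 1) + (6 * R + 1))) \<le> 20000000 * (L + 1) ^ 3"
  proof -
    define n where "n = L + 1"
    have n: "1 \<le> n" "n \<le> n ^ 3" by (simp_all add: n_def self_le_power)
    have M: "M = 3 * n" by (simp add: M_def n_def)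
    have "R \<le> (212 * n) * step_bound M"
      unfolding R_def n_def by (intro mult_le_mono1) simp
    also have "\<dots> = 1908000 * n ^ 3"
      using M by (simp add: step_bound_def power3_eq_cube)
    finally have "7 * R \<le> 13356000 * n ^ 3" by simp
    moreover have "306 * n + 4 \<le> 310 * n ^ 3" using n by linarith
    moreover have "300 * n + (R + ((2 * (3 * n + 1) + 1) + (6 * R + 1))) = 7 * R + (306 * n + 4)" by simp
    ultimately show ?thesis unfolding M n_def[symmetric] by linarith
  qed
  ultimately have "halts translate (input_store (dag_word D0)) (20000000 * (L + 1) ^ 3) (st
      (tree_word T) [] [] k' [])"
    by (rule halts_weaken)
  then show ?thesis unfolding L_def by (auto simp: mk_simps)
qed

end

text \<open>\<open>halts_translate\<close> holds for every tree that \<open>expand\<close> relates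
  to the dag, so an arbitrary choice among them is computed correctly and functionality of
  \<open>expand\<close> need not be established.\<close>

definition unfold_dag :: "dag \<Rightarrow> rtree" where
  "unfold_dag D = (SOME T. \<exists>v D' k'. v < length D \<and> node_clause (D ! v) = {||} \<and>
     expand D (length (dag_word D)) v T D' k')"

lemma (in regRD_dag) unfold_dag:
  obtains v D' k' where "v < length D0" "node_clause (D0 ! v) = {||}"
    "expand D0 (length (dag_word D0)) v (unfold_dag D0) D' k'"
proof -
  obtain v where v: "v < length D0" "node_clause (D0 ! v) = {||}"
    using refutation by (auto simp: regRD_refutation_def)
  obtain T D' k' where "expand D0 (length (dag_word D0)) v T D' k'"
    using expand_exists[OF v(1) marked_D0] by blast
  with v have "\<exists>v D' k'. v < length D0 \<and> node_clause (D0 ! v) = {||} \<and>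
      expand D0 (length (dag_word D0)) v T D' k'" by blast
  then have "\<exists>v D' k'. v < length D0 \<and> node_clause (D0 ! v) = {||} \<and>
      expand D0 (length (dag_word D0)) v (unfold_dag D0) D' k'"
    unfolding unfold_dag_def by (rule someI)
  then show thesis using that by blast
qed

theorem regWRTI_p_simulates_regRD: "p_simulates regWRTI regRD"
  unfolding p_simulates_def
proof (intro exI conjI allI impI)
  fix F D assume "refutes regRD F D"
  then interpret regRD_dag F D by unfold_locales (simp add: regRD_def)
  obtain v D' k' where "v < length D" "node_clause (D ! v) = {||}"
    "expand D (length (dag_word D)) v (unfold_dag D) D' k'" by (rule unfold_dag)
  note * = expand_refutes[OF _ this]
  show "refutes regWRTI F (unfold_dag D)"
    using *(1) var_less_fresh by (auto simp: regWRTI_def)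
  show "nodes regWRTI (unfold_dag D) \<le> poly [:1, 6:] (nodes regRD D)"
    using *(2) var_less_fresh by (auto simp: regWRTI_def regRD_def)
next
  show "polytime_computable_on {D. \<exists>F. refutes regRD F D} (code regRD) (code regWRTI) unfold_dag"
    unfolding polytime_computable_on_def
  proof (rule exI, rule exI, rule ballI)
    fix D assume "D \<in> {D. \<exists>F. refutes regRD F D}"
    then obtain F where "regRD_refutation F D" by (auto simp: regRD_def)
    then interpret regRD_dag F D by unfold_locales
    obtain v D' k' where "v < length D" "node_clause (D ! v) = {||}"
      "expand D (length (dag_word D)) v (unfold_dag D) D' k'" by (rule unfold_dag)
    from halts_translate[OF this]
    obtain t s where "t \<le> 20000000 * (length (dag_word D) + 1) ^ 3"
      "exec translate (input_store (dag_word D)) t s" "s 0 = tree_word (unfold_dag D)"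
      by (auto simp: halts_def)
    moreover have "poly (smult 20000000 ([:1, 1:] ^ 3)) n = 20000000 * (n + 1) ^ 3" for n :: nat
      by (simp add: poly_power add.commute)
    ultimately show "\<exists>t s. exec translate (input_store (code regRD D)) t s \<and>
        s 0 = code regWRTI (unfold_dag D) \<and>
        t \<le> poly (smult 20000000 ([:1, 1:] ^ 3)) (length (code regRD D))"
      unfolding regRD_def regWRTI_def by - (rule exI[of _ t], rule exI[of _ s], simp)
  qed
qed

section \<open>Trees that learn the clauses of a derivation\<close>

fun lit_var :: "literal \<Rightarrow> nat" where
  "lit_var (Pos x) = x"
| "lit_var (Neg x) = x"

fun neg :: "literal \<Rightarrow> literal" where
  "neg (Pos x) = Neg x"
| "neg (Neg x) = Pos x"

definition clause_vars :: "clause \<Rightarrow> nat set" where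
  "clause_vars C = lit_var ` fset C"

definition tautology :: "clause \<Rightarrow> bool" where
  "tautology C \<longleftrightarrow> (\<exists>l. l |\<in>| C \<and> neg l |\<in>| C)"

lemma neg_neg [simp]: "neg (neg l) = l"
  by (cases l) auto

lemma neg_neq [simp]: "neg l \<noteq> l" "l \<noteq> neg l"
  by (cases l; simp)+

lemma lit_var_neg [simp]: "lit_var (neg l) = lit_var l"
  by (cases l) auto

lemma lit_var_eq_iff: "lit_var l = lit_var m \<longleftrightarrow> l = m \<or> l = neg m"
  by (cases l; cases m) auto

lemma is_resolvent_literal:
  "l |\<in>| C \<Longrightarrow> neg l |\<in>| D \<Longrightarrow> is_resolvent (lit_var l) C D ((C
      |-| {|l|}) |\<union>| (D |-| {|neg l|}))"
  by (cases l) (auto simp: is_resolvent_def resolvent_def funion_commute)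

text \<open>Each step is a single genuine resolution between known clauses, hence an input tree with
  two leaves. The side conditions prepare the elimination of \<open>E\<close>: its literals have
  distinct variables other than \<open>x\<close>, so the branch stays regular, and at least one
  literal exists, so that the unit clause enters.\<close>

inductive learns :: "nat set \<Rightarrow> nat \<Rightarrow> clause set \<Rightarrow> clause set
    \<Rightarrow> bool" for V where
  learns_refl: "learns V 0 K K"
| learns_step: "learns V m K K' \<Longrightarrow> C \<in> K' \<Longrightarrow> D \<in> K'
    \<Longrightarrow> is_resolvent x C D E \<Longrightarrow>
    x \<in> V \<Longrightarrow> x \<notin> clause_vars E \<Longrightarrow> clause_vars E
        \<subseteq> V \<Longrightarrow> \<not> tautology E \<Longrightarrow> E \<noteq> {||}
        \<Longrightarrow>
    learns V (Suc m) K (insert E K')"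

lemma learns_subset: "learns V m K K' \<Longrightarrow> K \<subseteq> K'"
  by (induction rule: learns.induct) auto

lemma learns_trans: "learns V m' K' K'' \<Longrightarrow> learns V m K K' \<Longrightarrow> learns
    V (m + m') K K''"
  by (induction rule: learns.induct) (auto intro: learns.intros)

definition reach :: "nat set \<Rightarrow> nat \<Rightarrow> clause set \<Rightarrow> clause
    \<Rightarrow> bool" where
  "reach V c K E \<longleftrightarrow> (\<forall>L. K \<subseteq> L \<longrightarrow>
      (\<exists>m\<le>c. \<exists>L'. learns V m L L' \<and> E \<in> L'))"

lemma reach_in: "E \<in> K \<Longrightarrow> reach V c K E"
  unfolding reach_def by (meson learns_refl subsetD zero_le)

lemma reach_mono: "reach V c K E \<Longrightarrow> K \<subseteq> K' \<Longrightarrow> c \<le> c'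
    \<Longrightarrow> reach V c' K' E"
  unfolding reach_def by (meson order_trans)

text \<open>Each clause of \<open>A\<close> is learned once and shared afterwards, so costs add up
  as in a dag and not as in a tree.\<close>

lemma reach_cut_set:
  assumes "finite A" "\<And>B. B \<in> A \<Longrightarrow> reach V c K B" "reach V d (K \<union> A) E"
  shows "reach V (c * card A + d) K E"
  unfolding reach_def
proof (intro allI impI)
  fix L assume L: "K \<subseteq> L"
  have "\<exists>m\<le>c * card A. \<exists>L'. learns V m L L' \<and> A \<subseteq> L'"
    using assms(1,2)
  proof (induction A)
    case empty
    then show ?case using learns_refl by fastforce
  next
    case (insert B A)
    then obtain m L' where m: "m \<le> c * card A" "learns V m L L'" "A \<subseteq> L'" by auto
    moreover have "K \<subseteq> L'" using learns_subset[OF m(2)] L by auto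
    ultimately obtain m' L'' where "m' \<le> c" "learns V m' L' L''" "B \<in> L''"
      using insert.prems unfolding reach_def by blast
    moreover from this have "learns V (m + m') L L''" "L' \<subseteq> L''"
      using learns_trans m(2) learns_subset by blast+
    ultimately show ?case
      using m insert.hyps by (intro exI[of _ "m + m'"] conjI exI[of _ L'']) auto
  qed
  then obtain m L' where m: "m \<le> c * card A" "learns V m L L'" "A \<subseteq> L'" by auto
  moreover have "K \<union> A \<subseteq> L'" using learns_subset[OF m(2)] L m(3) by auto
  ultimately obtain m' L'' where "m' \<le> d" "learns V m' L' L''" "E \<in> L''"
    using assms(3) unfolding reach_def by blast
  then show "\<exists>m\<le>c * card A + d. \<exists>L'. learns V m L L' \<and> E \<in> L'"
    using m learns_trans[of V m' L' L'' m L] by (intro exI[of _ "m + m'"]) (auto intro: add_mono)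
qed

lemma reach_cut: "reach V c K A \<Longrightarrow> reach V d (insert A K) E \<Longrightarrow> reach
    V (c + d) K E"
  using reach_cut_set[of "{A}" V c K d E] by simp

lemma reach_resolve:
  assumes "reach V c K C" "reach V d K D" "l |\<in>| C" "neg l |\<in>| D"
    and E: "E = (C |-| {|l|}) |\<union>| (D |-| {|neg l|})"
    and V: "lit_var l \<in> V" "lit_var l \<notin> clause_vars E" "clause_vars E \<subseteq> V"
        "\<not> tautology E" "E \<noteq> {||}"
  shows "reach V (Suc (c + d)) K E"
proof -
  have "reach V 1 (insert D (insert C K)) E"
    unfolding reach_def
  proof (intro allI impI)
    fix L assume L: "insert D (insert C K) \<subseteq> L"
    have "learns V (Suc 0) L (insert E L)"
      using L V is_resolvent_literal[OF assms(3,4)] E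
      by (intro learns_step[OF learns_refl, of C L D "lit_var l"]) auto
    then show "\<exists>m\<le>1. \<exists>L'. learns V m L L' \<and> E \<in> L'" by auto
  qed
  moreover have "reach V d (insert C K) D" using assms(2) by (rule reach_mono) auto
  ultimately have "reach V (d + 1) (insert C K) E" by (intro reach_cut)
  from reach_cut[OF assms(1) this] show ?thesis by simp
qed

text \<open>A w-resolution with the unit clause \<open>{Pos 2}\<close> weakens away an arbitrary literal;
  variable 2 occurs nowhere else.\<close>

fun eliminate :: "literal list \<Rightarrow> rtree \<Rightarrow> rtree" where
  "eliminate [] T = T"
| "eliminate (l # ls) T = Node (lit_var l) ((root_clause (eliminate ls T) |-| {|l|}) |\<union>|
    {|Pos 2|})
     (eliminate ls T) (Leaf {|Pos 2|})"

lemma root_eliminate: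
  "Pos 2 \<notin> set ls \<Longrightarrow> ls \<noteq> [] \<Longrightarrow> root_clause (eliminate
      ls T) = (root_clause T |-| fset_of_list ls) |\<union>| {|Pos 2|}"
proof (induction ls)
  case (Cons l ls)
  then show ?case by (cases "ls = []") auto
qed auto

lemma eliminate_inferences:
  "inferences_correct T \<Longrightarrow> \<forall>l\<in>set ls. lit_var l \<noteq> 2
      \<Longrightarrow> inferences_correct (eliminate ls T)"
proof (induction ls)
  case (Cons l ls)
  then show ?case by (cases l) (auto simp: is_w_resolvent_def resolvent_def)
qed auto

lemma eliminate_supported:
  "supported K T \<Longrightarrow> {|Pos 2|} \<in> K \<Longrightarrow> supported K (eliminate ls T)"
  by (induction ls) auto

lemma eliminate_lemmas: "tree_lemmas T \<subseteq> tree_lemmas (eliminate ls T)"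
  by (induction ls) (auto simp: tree_lemmas_Node)

lemma eliminate_branches:
  "\<forall>p\<in>branch_vars T. distinct p \<and> set p \<subseteq> X \<Longrightarrow> distinct
      (map lit_var ls) \<Longrightarrow>
     lit_var ` set ls \<inter> X = {} \<Longrightarrow>
     p \<in> branch_vars (eliminate ls T) \<Longrightarrow> distinct p \<and> set p \<subseteq>
         lit_var ` set ls \<union> X"
proof (induction ls arbitrary: p)
  case (Cons l ls)
  then consider "p = [lit_var l]" | q where "p = lit_var l # q" "q \<in> branch_vars (eliminate ls T)"
    by auto
  then show ?case
  proof cases
    case 2
    with Cons have "distinct q \<and> set q \<subseteq> lit_var ` set ls \<union> X" by auto
    moreover have "lit_var l \<notin> lit_var ` set ls \<union> X" using Cons.prems by auto
    ultimately show ?thesis using 2 by auto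
  qed auto
qed auto

lemma eliminate_size: "length (post_order (eliminate ls T)) = length (post_order T) + 2 * length ls"
  by (induction ls) auto

text \<open>The root of the spine always carries the unit clause; only lemmas carry information. A
  step attaches a side tree that infers the new clause from two leaves and eliminates all its
  literals. Spine and side tree are joined by a w-resolution of the unit clause with itself on
  \<open>3 * m + 5\<close>. Such numbers are congruent to 2 modulo 3 and differ from 2, so they
  avoid \<open>V\<close> as well as the variable of the unit clause. A step adds the joining node,
  three nodes of the inference and at most \<open>2 * card V\<close> for the elimination.\<close>

lemma learns_spine:
  assumes "learns V m K K'" "{|Pos 2|} \<in> K" "finite V" "\<forall>x\<in>V. x mod 3 \<noteq> 2"
  shows "\<exists>T. root_clause T = {|Pos 2|} \<and> inferences_correct T \<and> supported K T \<and>
    K' \<subseteq> K \<union> tree_lemmas T \<and>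
    (\<forall>p\<in>branch_vars T. distinct p \<and> set p \<subseteq> V \<union> (\<lambda>k. 3 *
        k + 5) ` {..<m}) \<and>
    length (post_order T) \<le> 1 + m * (2 * card V + 4)"
  using assms(1,2)
proof (induction rule: learns.induct)
  case (learns_refl K)
  then show ?case by (intro exI[of _ "Leaf {|Pos 2|}"]) auto
next
  case (learns_step m K K' C D x E)
  then obtain T where T: "root_clause T = {|Pos 2|}" "inferences_correct T" "supported K T"
    "K' \<subseteq> K \<union> tree_lemmas T"
    "\<forall>p\<in>branch_vars T. distinct p \<and> set p \<subseteq> V \<union> (\<lambda>k. 3 *
        k + 5) ` {..<m}"
    "length (post_order T) \<le> 1 + m * (2 * card V + 4)" by auto
  have two: "2 \<notin> V" "3 * m + 5 \<notin> V" using assms(4) by force+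
  obtain ls where ls: "set ls = fset E" "distinct ls" using finite_distinct_list[of "fset E"] by auto
  have lne: "ls \<noteq> []" using ls learns_step.hyps by auto
  have lsV: "lit_var ` set ls \<subseteq> V" using ls learns_step.hyps by (simp add: clause_vars_def)
  have inj: "distinct (map lit_var ls)"
    using ls learns_step.hyps(8) by (auto simp: distinct_map inj_on_def lit_var_eq_iff tautology_def)
  have "length ls = card (lit_var ` set ls)"
    using inj distinct_card by fastforce
  also have "\<dots> \<le> card V" using lsV assms(3) by (intro card_mono)
  finally have len: "length ls \<le> card V" .
  let ?T0 = "Node x E (Leaf C) (Leaf D)"
  let ?S = "eliminate ls ?T0"
  have "root_clause ?S = (E |-| fset_of_list ls) |\<union>| {|Pos 2|}"
    using lne lsV two by (subst root_eliminate) force+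
  also have "E |-| fset_of_list ls = {||}"
    using ls(1) by (auto simp: fset_of_list_elem)
  finally have root: "root_clause ?S = {|Pos 2|}" by simp
  have inp: "input_resolution_tree ?T0" using learns_step.hyps by simp
  have w0: "is_w_resolvent x C D E"
    using learns_step.hyps by (auto simp: is_resolvent_def is_w_resolvent_def)
  have S: "inferences_correct ?S"
    using lsV two w0 by (intro eliminate_inferences) auto
  have supp: "supported (K \<union> tree_lemmas T) ?S"
    using T(4) learns_step.hyps learns_step.prems by (intro eliminate_supported) auto
  have lem: "E \<in> tree_lemmas ?S"
  proof -
    have "E \<in> tree_lemmas ?T0" using inp by (simp only: tree_lemmas_Node) simp
    then show ?thesis using eliminate_lemmas by blast
  qed
  have br: "distinct p \<and> set p \<subseteq> V" if "p \<in> branch_vars ?S" for p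
  proof -
    have "distinct p \<and> set p \<subseteq> lit_var ` set ls \<union> {x}"
    proof (rule eliminate_branches[OF _ inj _ that])
      show "lit_var ` set ls \<inter> {x} = {}" using ls learns_step.hyps(6) by (auto simp:
          clause_vars_def)
    qed auto
    then show ?thesis using lsV learns_step.hyps(5) by blast
  qed
  let ?T = "Node (3 * m + 5) {|Pos 2|} T ?S"
  show ?case
  proof (intro exI[of _ ?T] conjI)
    show "inferences_correct ?T"
      using T S root by (auto simp: is_w_resolvent_def resolvent_def)
    show "insert E K' \<subseteq> K \<union> tree_lemmas ?T" using T(4) lem by (auto simp:
        tree_lemmas_Node)
    show "\<forall>p\<in>branch_vars ?T. distinct p \<and> set p \<subseteq> V \<union>
        (\<lambda>k. 3 * k + 5) ` {..<Suc m}"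
    proof
      fix p assume "p \<in> branch_vars ?T"
      then obtain q where q: "p = (3 * m + 5) # q" "q \<in> branch_vars T \<or> q \<in> branch_vars
          ?S" by auto
      then have "distinct q" "set q \<subseteq> V \<union> (\<lambda>k. 3 * k + 5) ` {..<m}" using
          T(5) br by auto
      moreover have "3 * m + 5 \<notin> V \<union> (\<lambda>k. 3 * k + 5) ` {..<m}" using two by auto
      ultimately show "distinct p \<and> set p \<subseteq> V \<union> (\<lambda>k. 3 * k + 5) `
          {..<Suc m}"
        using q(1) by (auto simp: lessThan_Suc)
    qed
    show "length (post_order ?T) \<le> 1 + Suc m * (2 * card V + 4)"
      using T(6) len by (simp add: eliminate_size)
  qed (use T supp in auto)
qed

text \<open>Once both units on \<open>x\<close> are lemmas of the spine, two leaves give the empty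
  clause. The spine must come first in post-order, so it becomes the left child of a last
  w-resolution on variable 2, which discards its unit clause.\<close>

lemma reach_refutation:
  assumes "reach V c F {|Pos x|}" "reach V d F {|Neg x|}" "x \<in> V"
    and "{|Pos 2|} \<in> F" "finite V" "\<forall>x\<in>V. x mod 3 \<noteq> 2"
  shows "\<exists>T. regWRTI_refutation F T \<and> length (post_order T) \<le> 5 + (c + d) * (2 *
      card V + 4)"
proof -
  obtain m L where m: "m \<le> c" "learns V m F L" "{|Pos x|} \<in> L"
    using assms(1) unfolding reach_def by blast
  moreover have "F \<subseteq> L" using learns_subset[OF m(2)] .
  ultimately obtain m' L' where m': "m' \<le> d" "learns V m' L L'" "{|Neg x|} \<in> L'"
    using assms(2) unfolding reach_def by blast
  have L': "learns V (m + m') F L'" "{|Pos x|} \<in> L'"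
    using learns_trans[OF m'(2) m(2)] learns_subset[OF m'(2)] m(3) by auto
  obtain T where T: "root_clause T = {|Pos 2|}" "inferences_correct T" "supported F T"
    "L' \<subseteq> F \<union> tree_lemmas T"
    "\<forall>p\<in>branch_vars T. distinct p \<and> set p \<subseteq> V \<union> (\<lambda>k. 3 *
        k + 5) ` {..<m + m'}"
    "length (post_order T) \<le> 1 + (m + m') * (2 * card V + 4)"
    using learns_spine[OF L'(1) assms(4-6)] by auto
  have two: "2 \<notin> V \<union> (\<lambda>k. 3 * k + 5) ` {..<m + m'}" "x \<noteq> 2" using
      assms(3,6) by force+
  let ?R = "Node x {||} (Leaf {|Pos x|}) (Leaf {|Neg x|})"
  let ?T = "Node 2 {||} T ?R"
  have "supported F ?T" using T(3,4) L'(2) m'(3) by (auto simp: lemmas_of_def)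
  moreover have "inferences_correct ?T"
    using T by (auto simp: is_w_resolvent_def resolvent_def)
  moreover have "\<forall>p\<in>branch_vars ?T. distinct p"
    using T(5) two by (auto simp: subset_iff)
  moreover have "length (post_order ?T) \<le> 5 + (c + d) * (2 * card V + 4)"
  proof -
    have "(m + m') * (2 * card V + 4) \<le> (c + d) * (2 * card V + 4)"
      using m m' by (intro mult_le_mono1) auto
    moreover have "length (post_order ?T) = length (post_order T) + 4" by simp
    ultimately show ?thesis using T(6) by linarith
  qed
  ultimately show ?thesis
    by (intro exI[of _ ?T]) (auto simp: regWRTI_refutation_def intro: supported_imp_leaves_correct)
qed

section \<open>The guarded ordering formula\<close>

text \<open>Residues modulo 3 keep the variables apart: 0 for comparisons, 1 for selectors, 2 for
  the unit clause and the variables of the spine.\<close>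

definition order_var :: "nat \<Rightarrow> nat \<Rightarrow> nat" where
  "order_var a b = 3 * prod_encode (a, b)"

definition guard_var :: "nat \<Rightarrow> nat \<Rightarrow> nat" where
  "guard_var a y = 3 * prod_encode (a, y) + 1"

text \<open>\<open>lt a b\<close> says that \<open>a\<close> precedes \<open>b\<close>. Each pair has a single variable, so
  that the order is total and antisymmetric by construction.\<close>

definition lt :: "nat \<Rightarrow> nat \<Rightarrow> literal" where
  "lt a b = (if a < b then Pos (order_var a b) else Neg (order_var b a))"

text \<open>Excludes the cycle a < b < c < a: the literals are the negations of its three
  comparisons.\<close>

definition cycle_clause :: "nat \<Rightarrow> nat \<Rightarrow> nat \<Rightarrow> clause" where
  "cycle_clause a b c = {|lt b a, lt c b, lt a c|}"

text \<open>Says that \<open>a\<close> is not the minimum of the first \<open>k\<close> elements;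
  \<open>k\<close> decreases as the largest elements are eliminated.\<close>

definition below :: "nat \<Rightarrow> nat \<Rightarrow> clause" where
  "below k a = Abs_fset {lt b a |b. b < k \<and> b \<noteq> a}"

text \<open>Comparisons with \<open>a\<close> itself are excluded, so that making \<open>a\<close>
  minimal does not decide \<open>y\<close>.\<close>

definition guards :: "nat \<Rightarrow> nat \<Rightarrow> nat set" where
  "guards n a = {order_var b c |b c. b < c \<and> c < n \<and> b \<noteq> a \<and> c \<noteq> a}"

definition selector_clause :: "nat \<Rightarrow> nat \<Rightarrow> clause" where
  "selector_clause n a = below n a |\<union>| Abs_fset (Pos ` guard_var a ` guards n a)"

text \<open>The formula contains it for both literals on \<open>y\<close>. Under the selector they
  amount to \<open>below n a\<close>, but only after a resolution on \<open>y\<close>.\<close>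

definition guarded :: "nat \<Rightarrow> nat \<Rightarrow> nat \<Rightarrow> literal \<Rightarrow>
    clause" where
  "guarded n a y l = finsert (Neg (guard_var a y)) (finsert l (below n a))"

definition formula :: "nat \<Rightarrow> clause set" where
  "formula n =
     {cycle_clause a b c |a b c. a < n \<and> b < n \<and> c < n \<and> a \<noteq> b \<and> b
         \<noteq> c \<and> a \<noteq> c} \<union>
     {guarded n a y l |a y l. a < n \<and> y \<in> guards n a \<and> lit_var l = y} \<union>
     {selector_clause n a |a. a < n} \<union> {{|Pos 2|}}"

lemma order_var_eq_iff [simp]: "order_var a b = order_var c d \<longleftrightarrow> a = c \<and> b = d"
  by (simp add: order_var_def)

lemma guard_var_eq_iff [simp]: "guard_var a y = guard_var b z \<longleftrightarrow> a = b \<and> y = z"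
  by (simp add: guard_var_def)

lemma var_kinds [simp]:
  "order_var a b \<noteq> guard_var c y" "guard_var c y \<noteq> order_var a b" "order_var a b
      \<noteq> 2" "guard_var c y \<noteq> 2"
  "order_var a b mod 3 \<noteq> 2" "guard_var c y mod 3 \<noteq> 2"
  unfolding order_var_def guard_var_def by presburger+

lemma lt_eq_iff: "a \<noteq> b \<Longrightarrow> c \<noteq> d \<Longrightarrow> lt a b = lt c d
    \<longleftrightarrow> a = c \<and> b = d"
  by (auto simp: lt_def split: if_splits)

lemma neg_lt: "a \<noteq> b \<Longrightarrow> neg (lt a b) = lt b a"
  by (auto simp: lt_def)

lemma lit_var_lt: "lit_var (lt a b) = order_var (min a b) (max a b)"
  by (auto simp: lt_def min_def max_def)

lemma finite_guards [simp]: "finite (guards n a)"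
proof -
  have "guards n a \<subseteq> (\<lambda>(b, c). order_var b c) ` ({..<n} \<times> {..<n})" by
      (force simp: guards_def)
  then show ?thesis by (rule finite_subset) auto
qed

lemma fset_Abs [simp]: "finite S \<Longrightarrow> fset (Abs_fset S) = S"
  by (simp add: Abs_fset_inverse)

lemma fset_below [simp]: "fset (below k a) = {lt b a |b. b < k \<and> b \<noteq> a}"
  unfolding below_def by (rule fset_Abs) simp

lemma fset_selector_clause [simp]:
  "fset (selector_clause n a) = {lt b a |b. b < n \<and> b \<noteq> a} \<union> Pos ` guard_var a `
      guards n a"
  unfolding selector_clause_def by simp

definition formula_vars :: "nat \<Rightarrow> nat set" where
  "formula_vars n = (\<lambda>(a, b). order_var a b) ` ({..<n} \<times> {..<n}) \<union>
     (\<lambda>(a, y). guard_var a y) ` ({..<n} \<times> (\<lambda>(a, b). order_var a b) ` ({..<n}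
         \<times> {..<n}))"

lemma finite_formula_vars: "finite (formula_vars n)"
  by (simp add: formula_vars_def)

lemma card_formula_vars: "card (formula_vars n) \<le> n ^ 2 + n ^ 3"
proof -
  let ?O = "(\<lambda>(a, b). order_var a b) ` ({..<n} \<times> {..<n})"
  have O: "card ?O \<le> n ^ 2"
    using card_image_le[of "{..<n} \<times> {..<n}" "\<lambda>(a, b). order_var a b"]
    by (simp add: power2_eq_square)
  have "card ((\<lambda>(a, y). guard_var a y) ` ({..<n} \<times> ?O)) \<le> card ({..<n} \<times> ?O)"
    by (intro card_image_le) auto
  also have "\<dots> = n * card ?O" by (simp only: card_cartesian_product card_lessThan)
  also have "\<dots> \<le> n * n ^ 2" using O by (intro mult_le_mono) auto
  finally have "card ((\<lambda>(a, y). guard_var a y) ` ({..<n} \<times> ?O)) \<le> n ^ 3"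
    by (simp add: power3_eq_cube power2_eq_square)
  then show ?thesis
    unfolding formula_vars_def using O card_Un_le[of ?O] by (meson add_mono order_trans)
qed

lemma formula_vars_mod: "\<forall>x\<in>formula_vars n. x mod 3 \<noteq> 2"
  by (auto simp: formula_vars_def)

lemma lt_var_in: "a < n \<Longrightarrow> b < n \<Longrightarrow> lit_var (lt a b) \<in> formula_vars n"
  by (auto simp: formula_vars_def lit_var_lt)

lemma guards_subset: "y \<in> guards n a \<Longrightarrow> y \<in> formula_vars n"
  by (force simp: formula_vars_def guards_def)

lemma guard_var_in: "a < n \<Longrightarrow> y \<in> guards n a \<Longrightarrow> guard_var a y
    \<in> formula_vars n"
  by (force simp: formula_vars_def guards_def)

lemma guard_neq_lt [simp]:
  "Pos (guard_var a y) \<noteq> lt b c" "Neg (guard_var a y) \<noteq> lt b c"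
  "lt b c \<noteq> Pos (guard_var a y)" "lt b c \<noteq> Neg (guard_var a y)"
  by (auto simp: lt_def)

lemma lit_var_lt_neq_guard [simp]: "lit_var (lt b c) \<noteq> guard_var a y" "guard_var a y
    \<noteq> lit_var (lt b c)"
  by (auto simp: lit_var_lt)

lemma in_below_iff: "l |\<in>| below n a \<longleftrightarrow> (\<exists>b<n. b \<noteq> a \<and> l
    = lt b a)"
  by auto

lemma neg_notin_below: "l |\<in>| below n a \<Longrightarrow> neg l |\<notin>| below n a"
  unfolding in_below_iff by (metis neg_lt lt_eq_iff)

lemma neg_eq_iff [simp]: "neg l = Neg x \<longleftrightarrow> l = Pos x" "neg l = Pos x
    \<longleftrightarrow> l = Neg x"
  by (cases l; auto)+

lemma guard_notin_below [simp]: "Pos (guard_var a y) |\<notin>| below n b" "Neg (guard_var a y)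
    |\<notin>| below n b"
  by auto

lemma clause_vars_below: "clause_vars (below n a) = {lit_var (lt b a) |b. b < n \<and> b \<noteq> a}"
  by (auto simp: clause_vars_def)

lemma clause_vars_finsert: "clause_vars (finsert l C) = insert (lit_var l) (clause_vars C)"
  by (simp add: clause_vars_def)

lemma clause_vars_funion: "clause_vars (C |\<union>| D) = clause_vars C \<union> clause_vars D"
  by (auto simp: clause_vars_def)

declare fset_below [simp del] fset_selector_clause [simp del]

lemma clause_vars_below_subset: "a < n \<Longrightarrow> clause_vars (below n a) \<subseteq>
    formula_vars n"
  by (auto simp: clause_vars_below intro: lt_var_in)

section \<open>A short derivation from the formula\<close>

lemma reach_guarded:
  assumes "a < n" "y \<in> guards n a"
  shows "reach (formula_vars n) 1 (formula n) (finsert (Neg (guard_var a y)) (below n a))"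
proof -
  have y: "y \<noteq> guard_var a y" "\<And>b. lit_var (lt b a) \<noteq> y"
    using assms(2) by (auto simp: guards_def lit_var_lt min_def max_def)
  have "guarded n a y l \<in> formula n" if "lit_var l = y" for l
    using assms that unfolding formula_def by blast
  then have 1: "reach (formula_vars n) 0 (formula n) (guarded n a y (Pos y))"
    "reach (formula_vars n) 0 (formula n) (guarded n a y (Neg y))"
    by (simp_all add: reach_in)
  have "reach (formula_vars n) (Suc (0 + 0)) (formula n) (finsert (Neg (guard_var a y)) (below n a))"
  proof (rule reach_resolve[OF 1, of "Pos y"])
    have "Pos y |\<notin>| below n a" "Neg y |\<notin>| below n a"
      using y(2) unfolding in_below_iff by (metis lit_var.simps)+
    then show "finsert (Neg (guard_var a y)) (below n a) =
        (guarded n a y (Pos y) |-| {|Pos y|}) |\<union>| (guarded n a y (Neg y) |-| {|neg (Pos y)|})"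
      using y(1) by (auto simp: guarded_def)
    show "clause_vars (finsert (Neg (guard_var a y)) (below n a)) \<subseteq> formula_vars n"
      using assms by (simp add: clause_vars_finsert clause_vars_below_subset guard_var_in)
    show "\<not> tautology (finsert (Neg (guard_var a y)) (below n a))"
      by (auto simp: tautology_def dest: neg_notin_below)
    show "lit_var (Pos y) \<notin> clause_vars (finsert (Neg (guard_var a y)) (below n a))"
      using y by (auto simp: clause_vars_finsert clause_vars_below)
  qed (use assms in \<open>auto simp: guarded_def guards_subset\<close>)
  then show ?thesis by simp
qed

text \<open>The selectors leave the clause one at a time. Each takes two steps: learning the guarded
  clause without its comparison, and resolving on the selector.\<close>

lemma reach_below_guards:
  assumes "a < n" "2 \<le> n" "finite J"
  shows "J \<subseteq> guards n a \<Longrightarrow>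
    reach (formula_vars n) c (formula n) (below n a |\<union>| Abs_fset (Pos ` guard_var a ` J))
        \<Longrightarrow>
    reach (formula_vars n) (2 * card J + c) (formula n) (below n a)"
  using assms(3)
proof (induction J arbitrary: c)
  case empty
  then show ?case by (simp add: bot_fset.abs_eq[symmetric])
next
  case (insert y J)
  let ?E = "below n a |\<union>| Abs_fset (Pos ` guard_var a ` J)"
  let ?C = "below n a |\<union>| Abs_fset (Pos ` guard_var a ` insert y J)"
  let ?D = "finsert (Neg (guard_var a y)) (below n a)"
  have fin: "finite (Pos ` guard_var a ` J)" "finite (Pos ` guard_var a ` insert y J)"
    using insert.hyps by auto
  have fA: "l |\<in>| Abs_fset (Pos ` guard_var a ` J) \<longleftrightarrow> l \<in> Pos `
      guard_var a ` J" for l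
    using fset_Abs[OF fin(1)] by auto
  have fB: "l |\<in>| Abs_fset (insert (Pos (guard_var a y)) (Pos ` guard_var a ` J))
      \<longleftrightarrow>
      l = Pos (guard_var a y) \<or> l \<in> Pos ` guard_var a ` J" for l
    using fset_Abs[OF fin(2)] by auto
  obtain b where b: "b < n" "b \<noteq> a" using assms(2) by (metis less_2_cases_iff less_le_trans
      pos2 zero_neq_one one_less_numeral_iff semiring_norm(76))
  have "reach (formula_vars n) (Suc (c + 1)) (formula n) ?E"
  proof (rule reach_resolve[OF insert.prems(2) reach_guarded[OF assms(1)], of y "Pos (guard_var a y)"])
    show "y \<in> guards n a" using insert.prems by simp
    show "Pos (guard_var a y) |\<in>| ?C" by (simp add: fB)
    show "neg (Pos (guard_var a y)) |\<in>| ?D" by simp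
    show "?E = (?C |-| {|Pos (guard_var a y)|}) |\<union>| (?D |-| {|neg (Pos (guard_var a y))|})"
      using insert.hyps(2) by (intro fset_eqI) (auto simp: fA fB)
    show "lit_var (Pos (guard_var a y)) \<in> formula_vars n"
      using insert.prems assms by (auto intro: guard_var_in)
    show "lit_var (Pos (guard_var a y)) \<notin> clause_vars ?E"
      using insert.hyps by (auto simp: clause_vars_funion clause_vars_below) (auto simp: clause_vars_def)
    show "clause_vars ?E \<subseteq> formula_vars n"
      using insert.prems(1) assms(1) fin clause_vars_below_subset[OF assms(1)]
      by (auto simp: clause_vars_funion) (auto simp: clause_vars_def intro!: guard_var_in)
    show "\<not> tautology ?E"
      by (auto simp: tautology_def fA dest: neg_notin_below)
    show "?E \<noteq> {||}" using b by (metis in_below_iff fempty_iff funion_iff)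
  qed
  then have "reach (formula_vars n) (2 * card J + Suc (c + 1)) (formula n) (below n a)"
    using insert.prems by (intro insert.IH) auto
  then show ?case using insert.hyps by simp
qed

lemma card_guards: "card (guards n a) \<le> n ^ 2"
proof -
  have "guards n a \<subseteq> (\<lambda>(b, c). order_var b c) ` ({..<n} \<times> {..<n})" by
      (force simp: guards_def)
  then have "card (guards n a) \<le> card ({..<n} \<times> {..<n})"
    by (rule surj_card_le[rotated]) auto
  then show ?thesis by (simp add: power2_eq_square)
qed

lemma reach_below:
  assumes "a < n" "2 \<le> n"
  shows "reach (formula_vars n) (2 * n ^ 2) (formula n) (below n a)"
proof -
  have "selector_clause n a \<in> formula n" using assms unfolding formula_def by blast
  then have "reach (formula_vars n) 0 (formula n) (below n a |\<union>| Abs_fset (Pos ` guard_var a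
      ` guards n a))"
    unfolding selector_clause_def[symmetric] by (rule reach_in)
  from reach_below_guards[OF assms finite_guards order_refl this]
  have "reach (formula_vars n) (2 * card (guards n a)) (formula n) (below n a)" by simp
  then show ?thesis by (rule reach_mono) (use card_guards in auto)
qed

text \<open>Elimination of the largest element \<open>k\<close>. In \<open>below (Suc k) k\<close>
  the cycle clauses on \<open>a\<close>, \<open>b\<close>, \<open>k\<close> replace each
  \<open>lt b k\<close> by \<open>lt b a\<close>, at the price of the literal \<open>lt a k\<close>,
  which is finally resolved against \<open>below (Suc k) a\<close>. The clause after
  \<open>b\<close> replacements is \<open>E b\<close>.\<close>

lemma reach_below_pred:
  assumes "a < k" "2 \<le> k" "k < n" "formula n \<subseteq> K" "below (Suc k) a \<in> K" "below
      (Suc k) k \<in> K"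
  shows "reach (formula_vars n) (k + 1) K (below k a)"
proof -
  let ?V = "formula_vars n"
  define E where "E b = Abs_fset ({lt b' a |b'. b' < b \<and> b' \<noteq> a} \<union> {lt b' k |b'.
      b \<le> b' \<and> b' < k} \<union> {lt a k})" for b
  have "finite ({lt b' a |b'. b' < b \<and> b' \<noteq> a} \<union> {lt b' k |b'. b \<le> b' \<and>
      b' < k} \<union> {lt a k})" for b
    by simp
  then have E: "l |\<in>| E b \<longleftrightarrow> (\<exists>b'<b. b' \<noteq> a \<and> l = lt b'
      a) \<or> (\<exists>b'. b \<le> b' \<and> b' < k \<and> l = lt b' k) \<or> l = lt a k"
    for l b unfolding E_def by (subst fset_Abs) auto
  have "reach ?V b K (E b)" if "b \<le> k" for b
    using that
  proof (induction b)
    case 0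
    have "E 0 = below (Suc k) k"
      by (rule fset_eqI) (use assms(1) in \<open>auto simp: E in_below_iff less_Suc_eq\<close>)
    then show ?case using assms(6) by (simp add: reach_in)
  next
    case (Suc b)
    show ?case
    proof (cases "b = a")
      case True
      \<comment> \<open>The literal \<open>lt a k\<close> is kept in all the clauses, so nothing
        happens at \<open>b = a\<close>.\<close>
      have "(\<exists>b'. a \<le> b' \<and> b' < k \<and> l = lt b' k) \<longleftrightarrow> l = lt
          a k \<or> (\<exists>b'. Suc a \<le> b' \<and> b' < k \<and> l = lt b' k)" for l
        using assms(1) by (metis Suc_leD le_antisym not_less_eq_eq order_refl)
      moreover have "(\<exists>b'<Suc a. b' \<noteq> a \<and> l = lt b' a) \<longleftrightarrow>
          (\<exists>b'<a. b' \<noteq> a \<and> l = lt b' a)" for l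
        by (auto simp: less_Suc_eq)
      ultimately have "E (Suc b) = E b"
        unfolding True by (intro fset_eqI) (simp add: E, blast)
      then show ?thesis using Suc by (auto intro: reach_mono)
    next
      case False
      have bk: "b < k" "b \<noteq> k" "a \<noteq> k" using Suc.prems assms(1) by auto
      have "cycle_clause a b k \<in> formula n"
        unfolding formula_def using assms False bk by (intro UnI1) (auto intro!: exI)
      then have c: "reach ?V 0 K (cycle_clause a b k)" using assms(4) by (intro reach_in) auto
      have "reach ?V (Suc (b + 0)) K (E (Suc b))"
      proof (rule reach_resolve[OF Suc.IH c, of "lt b k"])
        show "lt b k |\<in>| E b" using bk by (auto simp: E)
        show "neg (lt b k) |\<in>| cycle_clause a b k" using bk by (simp add: neg_lt cycle_clause_def)
        show "E (Suc b) = (E b |-| {|lt b k|}) |\<union>| (cycle_clause a b k |-| {|neg (lt b k)|})"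
        proof (rule fset_eqI)
          fix l
          have "l |\<in>| (E b |-| {|lt b k|}) |\<union>| (cycle_clause a b k |-| {|neg (lt b k)|})
              \<longleftrightarrow>
              l |\<in>| E b \<and> l \<noteq> lt b k \<or> l = lt b a \<or> l = lt a k"
            using bk False by (auto simp: cycle_clause_def neg_lt lt_eq_iff)
          also have "\<dots> \<longleftrightarrow> l |\<in>| E (Suc b)"
          proof -
            have 1: "(\<exists>b'. Suc b \<le> b' \<and> b' < k \<and> l = lt b' k)
                \<longleftrightarrow> (\<exists>b'. b \<le> b' \<and> b' < k \<and> l = lt b' k)
                \<and> l \<noteq> lt b k"
            proof -
              have inj: "lt b' k = lt b k \<longleftrightarrow> b' = b" if "b' < k" for b'
                using that bk by (simp add: lt_eq_iff)
              show ?thesis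
              proof (intro iffI; (elim exE conjE)?)
                fix b' assume "Suc b \<le> b'" "b' < k" "l = lt b' k"
                then show "(\<exists>b'. b \<le> b' \<and> b' < k \<and> l = lt b' k) \<and> l
                    \<noteq> lt b k"
                  using inj[of b'] by (intro conjI exI[of _ b']) auto
              next
                fix b' assume "l \<noteq> lt b k" "b \<le> b'" "b' < k" "l = lt b' k"
                then show "\<exists>b'. Suc b \<le> b' \<and> b' < k \<and> l = lt b' k"
                  by (intro exI[of _ b']) (auto simp: Suc_le_eq le_less)
              qed
            qed
            have 2: "(\<exists>b'<Suc b. b' \<noteq> a \<and> l = lt b' a) \<longleftrightarrow>
                (\<exists>b'<b. b' \<noteq> a \<and> l = lt b' a) \<or> l = lt b a"
              using False by (auto simp: less_Suc_eq)
            have 3: "lt b' a \<noteq> lt b k" "lt a k \<noteq> lt b k" if "b' \<noteq> a" for b'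
              using that bk False by (auto simp: lt_eq_iff)
            define P where "P \<longleftrightarrow> (\<exists>b'<b. b' \<noteq> a \<and> l = lt b' a)"
            define Q where "Q \<longleftrightarrow> (\<exists>b'. b \<le> b' \<and> b' < k \<and> l
                = lt b' k)"
            have "P \<Longrightarrow> l \<noteq> lt b k" "l = lt a k \<Longrightarrow> l \<noteq> lt b k"
              using 3(1) 3(2)[OF False] by (auto simp: P_def)
            then show ?thesis unfolding E 1 2 P_def[symmetric] Q_def[symmetric] by blast
          qed
          finally show "l |\<in>| E (Suc b) \<longleftrightarrow>
              l |\<in>| (E b |-| {|lt b k|}) |\<union>| (cycle_clause a b k |-| {|neg (lt b k)|})"
                  by simp
        qed
        show "lit_var (lt b k) \<in> ?V" using bk assms by (intro lt_var_in) auto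
        show "lit_var (lt b k) \<notin> clause_vars (E (Suc b))"
          using bk False assms(1) by (auto simp: clause_vars_def E lit_var_lt min_def max_def
              split: if_splits)
        show "clause_vars (E (Suc b)) \<subseteq> ?V"
          using assms bk by (auto simp: clause_vars_def E intro!: lt_var_in)
        show "\<not> tautology (E (Suc b))"
          using bk assms(1) by (auto simp: tautology_def E neg_lt lt_eq_iff)
        show "E (Suc b) \<noteq> {||}" using E[of "lt a k" "Suc b"] by auto
      qed (use bk in auto)
      then show ?thesis by simp
    qed
  qed
  then have k: "reach ?V k K (E k)" by simp
  have "reach ?V (Suc (k + 0)) K (below k a)"
  proof (rule reach_resolve[OF k reach_in[OF assms(5)], of "lt a k"])
    show "lt a k |\<in>| E k" by (simp add: E)
    show "neg (lt a k) |\<in>| below (Suc k) a" using assms(1) by (auto simp: neg_lt in_below_iff)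
    show "below k a = (E k |-| {|lt a k|}) |\<union>| (below (Suc k) a |-| {|neg (lt a k)|})"
      by (rule fset_eqI)
        (use assms(1) in \<open>auto simp: E in_below_iff neg_lt lt_eq_iff less_Suc_eq\<close>)
    show "lit_var (lt a k) \<in> ?V" using assms by (intro lt_var_in) auto
    show "lit_var (lt a k) \<notin> clause_vars (below k a)"
      using assms(1) by (auto simp: clause_vars_below lit_var_lt min_def max_def split: if_splits)
    show "clause_vars (below k a) \<subseteq> ?V"
      using assms by (auto simp: clause_vars_below intro!: lt_var_in)
    show "\<not> tautology (below k a)" by (auto simp: tautology_def dest: neg_notin_below)
    have "\<exists>b<k. b \<noteq> a" using assms(1,2) by (intro exI[of _ "if a = 0 then 1 else 0"]) auto
    then show "below k a \<noteq> {||}" by (metis in_below_iff fempty_iff)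
  qed
  then show ?thesis by simp
qed

text \<open>Level \<open>k\<close> consists of at most n clauses, each learned from level
  \<open>k + 1\<close> in at most n + 1 steps. The cost \<open>d\<close> of what comes after the
  descent is a parameter, which lets the induction move the starting level upwards.\<close>

lemma reach_descend:
  assumes "2 \<le> k" "k \<le> n" "reach (formula_vars n) d (formula n \<union> below k ` {..<k}) E"
  shows "reach (formula_vars n) ((n - k) * ((n + 1) * n) + d) (formula n \<union> below n ` {..<n}) E"
  using assms(2,1,3)
proof (induction k arbitrary: d rule: inc_induct)
  case base
  then show ?case by simp
next
  case (step k)
  let ?K = "formula n \<union> below (Suc k) ` {..<Suc k}"
  have 1: "reach (formula_vars n) (k + 1) ?K B" if B: "B \<in> below k ` {..<k}" for B
  proof -
    obtain a where "B = below k a" "a < k" using B by auto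
    then show ?thesis using step.hyps step.prems by (auto intro!: reach_below_pred[unfolded
        Suc_eq_plus1[symmetric]])
  qed
  have 2: "reach (formula_vars n) d (?K \<union> below k ` {..<k}) E"
    using step.prems(2) by (rule reach_mono) auto
  have "reach (formula_vars n) ((k + 1) * card (below k ` {..<k}) + d) ?K E"
    by (rule reach_cut_set[OF _ 1 2]) auto
  moreover have "card (below k ` {..<k}) \<le> k" using card_image_le[of "{..<k}" "below k"] by simp
  then have "(k + 1) * card (below k ` {..<k}) \<le> (n + 1) * n"
    using step.hyps by (intro mult_le_mono) auto
  ultimately have "reach (formula_vars n) ((n + 1) * n + d) ?K E"
    by (elim reach_mono) auto
  then have "reach (formula_vars n) ((n - Suc k) * ((n + 1) * n) + ((n + 1) * n + d)) (formula n
      \<union> below n ` {..<n}) E"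
    using step.prems by (intro step.IH) auto
  moreover have "n - k = Suc (n - Suc k)" using step.hyps by simp
  ultimately show ?case by (simp add: algebra_simps)
qed

lemma reach_below_2:
  assumes "2 \<le> n" "a < 2"
  shows "reach (formula_vars n) (2 * n ^ 2 * n + n * ((n + 1) * n)) (formula n) (below 2 a)"
proof -
  have "reach (formula_vars n) 0 (formula n \<union> below 2 ` {..<2}) (below 2 a)"
    using assms by (intro reach_in) auto
  from reach_descend[OF _ assms(1) this]
  have "reach (formula_vars n) ((n - 2) * ((n + 1) * n)) (formula n \<union> below n ` {..<n})
      (below 2 a)" by simp
  then have 1: "reach (formula_vars n) (n * ((n + 1) * n)) (formula n \<union> below n ` {..<n})
      (below 2 a)"
    by (rule reach_mono) (auto intro: mult_le_mono1)
  have "reach (formula_vars n) (2 * n ^ 2 * card (below n ` {..<n}) + n * ((n + 1) * n)) (formula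
      n) (below 2 a)"
    by (rule reach_cut_set[OF _ _ 1]) (use assms(1) reach_below in auto)
  then show ?thesis
  proof (rule reach_mono)
    show "2 * n ^ 2 * card (below n ` {..<n}) + n * ((n + 1) * n) \<le> 2 * n ^ 2 * n + n * ((n +
        1) * n)"
      using card_image_le[of "{..<n}" "below n"] by simp
  qed simp
qed

theorem formula_regWRTI:
  assumes "2 \<le> n"
  shows "\<exists>T. regWRTI_refutation (formula n) T \<and> length (post_order T) \<le> 100 * n ^ 6"
proof -
  \<comment> \<open>The descent stops at two elements, where the clauses are the two opposite units
    on one comparison.\<close>
  have b: "below 2 1 = {|Pos (order_var 0 1)|}" "below 2 0 = {|Neg (order_var 0 1)|}"
    by (rule fset_eqI; auto simp: in_below_iff lt_def less_2_cases_iff)+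
  let ?c = "2 * n ^ 2 * n + n * ((n + 1) * n)"
  have "order_var 0 1 \<in> formula_vars n"
    using lt_var_in[of 0 n 1] assms by (simp add: lit_var_lt)
  moreover have "{|Pos 2|} \<in> formula n" by (simp add: formula_def)
  ultimately obtain T where T: "regWRTI_refutation (formula n) T"
      "length (post_order T) \<le> 5 + (?c + ?c) * (2 * card (formula_vars n) + 4)"
    using reach_refutation[OF reach_below_2[OF assms, of 1, unfolded b] reach_below_2[OF assms, of
        0, unfolded b]]
      finite_formula_vars formula_vars_mod by auto
  have le: "n ^ 2 \<le> n ^ 3" "1 \<le> n ^ 3" "1 \<le> n ^ 6" using assms by (auto intro:
      power_increasing)
  have "?c + ?c \<le> 8 * n ^ 3"
    using le by (simp add: power2_eq_square power3_eq_cube algebra_simps)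
  moreover have "2 * card (formula_vars n) + 4 \<le> 8 * n ^ 3"
    using card_formula_vars[of n] le by linarith
  ultimately have "(?c + ?c) * (2 * card (formula_vars n) + 4) \<le> (8 * n ^ 3) * (8 * n ^ 3)"
    by (rule mult_le_mono)
  also have "\<dots> = 64 * n ^ 6" by (simp flip: power_add)
  finally show ?thesis using T le(3) by (intro exI[of _ T]) linarith
qed

section \<open>The lower bound\<close>

text \<open>Rank 0 belongs to the elements not removed yet, all of them equal. The element removed
  last has rank 1: it lies above these and under everything removed before.\<close>

fun rank :: "nat list \<Rightarrow> nat \<Rightarrow> nat" where
  "rank [] a = 0"
| "rank (c # R) a = (if a = c then 1 else if rank R a = 0 then 0 else Suc (rank R a))"

lemma rank_pos_iff: "0 < rank R a \<longleftrightarrow> a \<in> set R"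
  by (induction R) auto

lemma rank_inj: "a \<in> set R \<or> b \<in> set R \<Longrightarrow> a \<noteq> b \<Longrightarrow>
    rank R a \<noteq> rank R b"
  by (induction R) (auto simp: rank_pos_iff split: if_splits)

text \<open>Later removals enter under all of \<open>R\<close>, so a comparison with a member of
  \<open>R\<close> is settled for good.\<close>

lemma rank_append_less_iff:
  "a \<in> set R \<or> b \<in> set R \<Longrightarrow> distinct (xs @ R) \<Longrightarrow> rank (xs
      @ R) a < rank (xs @ R) b \<longleftrightarrow> rank R a < rank R b"
proof (induction xs)
  case (Cons c xs)
  then have "a \<noteq> c \<or> b \<in> set R" "b \<noteq> c \<or> a \<in> set R" "c \<notin> set
      R" "rank R c = 0" "rank (xs @ R) c = 0"
    using rank_pos_iff[of R c] rank_pos_iff[of "xs @ R" c] by auto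
  moreover have "y \<in> set R \<longrightarrow> rank (xs @ R) y \<noteq> 0 \<and> rank R y
      \<noteq> 0" for y
    using rank_pos_iff[of "xs @ R" y] rank_pos_iff[of R y] by auto
  note this[of a] this[of b]
  ultimately show ?case using Cons by (auto split: if_splits)
qed auto

text \<open>The removed elements \<open>R\<close>, the last one first, lie above all others, whose mutual
  order is still open.\<close>

definition val :: "nat list \<Rightarrow> nat set \<Rightarrow> nat \<Rightarrow> bool" where
  "val R \<sigma> y = (if y mod 3 = 0 then let (a, b) = prod_decode (y div 3) in rank R a < rank R b
     else if y mod 3 = 1 then y \<in> \<sigma> else True)"

lemma val_order_var [simp]: "val R \<sigma> (order_var a b) \<longleftrightarrow> rank R a < rank R b"
  by (simp add: val_def order_var_def)

lemma val_guard_var [simp]: "val R \<sigma> (guard_var a y) \<longleftrightarrow> guard_var a y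
    \<in> \<sigma>"
proof -
  have "guard_var a y mod 3 = 1" unfolding guard_var_def by presburger
  then show ?thesis by (simp add: val_def)
qed

lemma val_2 [simp]: "val R \<sigma> 2"
  by (simp add: val_def)

fun lit_true :: "(nat \<Rightarrow> bool) \<Rightarrow> literal \<Rightarrow> bool" where
  "lit_true v (Pos x) \<longleftrightarrow> v x"
| "lit_true v (Neg x) \<longleftrightarrow> \<not> v x"

text \<open>Variables other than comparisons are always determined: the selectors are chosen in
  advance by \<open>\<sigma>\<close>, and variable 2 is true.\<close>

definition determined :: "nat list \<Rightarrow> nat \<Rightarrow> bool" where
  "determined R y \<longleftrightarrow> (\<forall>a b. y = order_var a b \<longrightarrow> a \<in>
      set R \<or> b \<in> set R)"

definition query_vars :: "nat \<Rightarrow> nat set" where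
  "query_vars n = {order_var a b |a b. a < b \<and> b < n} \<union>
     {guard_var a y |a y. a < n \<and> y \<in> guards n a} \<union> {2}"

lemma val_append:
  assumes "determined R y" "y \<in> query_vars n" "distinct (xs @ R)"
  shows "val (xs @ R) \<sigma> y = val R \<sigma> y"
  using assms rank_append_less_iff[OF _ assms(3)] by (auto simp: query_vars_def determined_def)

lemma determined_append: "determined R y \<Longrightarrow> determined (xs @ R) y"
  by (auto simp: determined_def)

lemma lit_true_lt: "rank R a \<noteq> rank R b \<Longrightarrow> lit_true (val R \<sigma>) (lt a b)
    \<longleftrightarrow> rank R a < rank R b"
  by (auto simp: lt_def)

lemma determined_lt: "a \<noteq> b \<Longrightarrow> determined R (lit_var (lt a b))
    \<Longrightarrow> rank R a \<noteq> rank R b"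
  by (intro rank_inj) (auto simp: determined_def lit_var_lt min_def max_def split: if_splits)

lemma formula_cases [consumes 1]:
  assumes "C \<in> formula n"
  obtains (cycle) a b c where "C = cycle_clause a b c" "a < n" "b < n" "c < n" "a \<noteq> b" "b
      \<noteq> c" "a \<noteq> c"
  | (guarded) a y l where "C = guarded n a y l" "a < n" "y \<in> guards n a" "lit_var l = y"
  | (selector) a where "C = selector_clause n a" "a < n"
  | (unit) "C = {|Pos 2|}"
  using assms unfolding formula_def by blast

lemma clause_vars_formula: "C \<in> formula n \<Longrightarrow> clause_vars C \<subseteq> query_vars n"
proof -
  have lt: "lit_var (lt a b) \<in> query_vars n" if "a < n" "b < n" "a \<noteq> b" for a b
    using that by (auto simp: query_vars_def lit_var_lt min_def max_def)
  have b: "clause_vars (below n a) \<subseteq> query_vars n" if "a < n" for a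
    using that lt by (auto simp: clause_vars_below)
  have g: "guard_var a y \<in> query_vars n" "y \<in> query_vars n" if "a < n" "y \<in> guards n a"
      for a y
    using that by (auto simp: query_vars_def guards_def)
  assume "C \<in> formula n"
  then show ?thesis
  proof (cases rule: formula_cases)
    case (cycle a b c)
    then show ?thesis using lt by (simp add: cycle_clause_def clause_vars_def)
  next
    case (guarded a y l)
    then show ?thesis using b g by (simp add: guarded_def clause_vars_finsert)
  next
    case (selector a)
    then have "clause_vars (Abs_fset (Pos ` guard_var a ` guards n a)) \<subseteq> query_vars n"
      using g by (auto simp: clause_vars_def)
    then show ?thesis using selector b by (simp add: selector_clause_def clause_vars_funion)
  next
    case unit
    then show ?thesis by (simp add: clause_vars_def query_vars_def)
  qed
qed

text \<open>Distinct ranks are linearly ordered, so no cycle clause is falsified, and the unit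
  clause is true. A falsified clause thus belongs to an element that precedes all others.\<close>

lemma formula_true:
  assumes "C \<in> formula n" "distinct R"
    and det: "\<And>a b. lt a b |\<in>| C \<Longrightarrow> a \<noteq> b \<Longrightarrow> rank R a
        \<noteq> rank R b"
    and false: "\<And>l. l |\<in>| C \<Longrightarrow> \<not> lit_true (val R \<sigma>) l"
  obtains a where "a < n" "below n a |\<subseteq>| C" "C = selector_clause n a \<or>
      (\<exists>y\<in>guards n a. \<exists>l. lit_var l = y \<and> C = guarded n a y l)"
    "\<forall>b<n. b \<noteq> a \<longrightarrow> rank R a < rank R b"
  using assms(1)
proof (cases rule: formula_cases)
  case (cycle a b c)
  have "rank R y < rank R x" if "lt x y |\<in>| C" "x \<noteq> y" for x y
    using det[OF that] false[OF that(1)] lit_true_lt[of R x y \<sigma>] by auto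
  from this[of b a] this[of c b] this[of a c] cycle show ?thesis by (auto simp: cycle_clause_def)
next
  case unit
  then show ?thesis using false[of "Pos 2"] by simp
next
  case (guarded a y l)
  have sub: "below n a |\<subseteq>| C" using guarded by (auto simp: guarded_def)
  have "rank R a < rank R b" if "b < n" "b \<noteq> a" for b
  proof -
    have "lt b a |\<in>| C" using sub that by (metis in_below_iff fsubsetD)
    then show ?thesis using det[of b a] false[of "lt b a"] lit_true_lt[of R b a \<sigma>] that by auto
  qed
  then show ?thesis using that[of a] sub guarded by blast
next
  case (selector a)
  have sub: "below n a |\<subseteq>| C" using selector by (auto simp: selector_clause_def)
  have "rank R a < rank R b" if "b < n" "b \<noteq> a" for b
  proof -
    have "lt b a |\<in>| C" using sub that by (metis in_below_iff fsubsetD)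
    then show ?thesis using det[of b a] false[of "lt b a"] lit_true_lt[of R b a \<sigma>] that by auto
  qed
  then show ?thesis using that[of a] sub selector by blast
qed

section \<open>The adversary's walk through the dag\<close>

definition wrong :: "nat \<Rightarrow> bool \<Rightarrow> literal" where
  "wrong x \<beta> = (if \<beta> then Neg x else Pos x)"

definition pick :: "dag \<Rightarrow> nat \<Rightarrow> nat \<Rightarrow> nat \<Rightarrow> bool
    \<Rightarrow> nat" where
  "pick D x i j \<beta> = (if wrong x \<beta> |\<in>| node_clause (D ! i) then i else j)"

lemma lit_var_wrong [simp]: "lit_var (wrong x \<beta>) = x"
  by (simp add: wrong_def)

lemma lit_true_cong: "v (lit_var l) = v' (lit_var l) \<Longrightarrow> lit_true v l = lit_true v' l"
  by (cases l) auto

lemma not_lit_true_iff: "\<not> lit_true v l \<longleftrightarrow> l = wrong (lit_var l) (v (lit_var l))"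
  by (cases l) (auto simp: wrong_def)

text \<open>The walk leads from \<open>u\<close> towards the sources and keeps to falsified clauses.
  A forced step requires that a coin is left, so the walk stops right after the last toss. The
  answer true to \<open>a < b\<close> puts \<open>b\<close> on top, the answer false
  \<open>a\<close>; \<open>cs\<close> records what the coins decided.\<close>

inductive run :: "dag \<Rightarrow> nat set \<Rightarrow> nat \<Rightarrow> nat list \<Rightarrow>
    bool list \<Rightarrow> nat \<Rightarrow> nat list \<Rightarrow> (nat \<times> bool) list
    \<Rightarrow> bool"
  for D \<sigma> where
  run_stop: "run D \<sigma> u R [] u R []"
| run_forced: "D ! u = Derived x C i j \<Longrightarrow> determined R x \<Longrightarrow> bs
    \<noteq> [] \<Longrightarrow>
    run D \<sigma> (pick D x i j (val R \<sigma> x)) R bs w R' cs \<Longrightarrow> run D \<sigma>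
        u R bs w R' cs"
| run_coin: "D ! u = Derived (order_var a b) C i j \<Longrightarrow> a \<notin> set R
    \<Longrightarrow> b \<notin> set R \<Longrightarrow>
    run D \<sigma> (pick D (order_var a b) i j \<beta>) ((if \<beta> then b else a) # R) bs w R' cs
        \<Longrightarrow>
    run D \<sigma> u R (\<beta> # bs) w R' ((order_var a b, \<beta>) # cs)"

text \<open>Equal selectors and equal coins keep two walks together. At the first different coin
  both toss for the same comparison, and the clause at the common end would contain it in both
  polarities.\<close>

lemma run_injective:
  "run D \<sigma> u R bs w R' cs \<Longrightarrow> run D \<sigma> u R bs' w R'' cs'
      \<Longrightarrow> length bs = length bs' \<Longrightarrow>
    (\<forall>(y, \<beta>)\<in>set cs \<union> set cs'. wrong y \<beta> |\<in>| node_clause (D !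
        w)) \<Longrightarrow>
    \<not> tautology (node_clause (D ! w)) \<Longrightarrow> bs = bs'"
proof (induction arbitrary: bs' cs' R'' rule: run.induct)
  case (run_stop u R)
  then show ?case by simp
next
  case (run_forced u x C i j R bs w R' cs)
  from run_forced.prems(1) show ?case
  proof (cases rule: run.cases)
    case run_stop
    then show ?thesis using run_forced.prems run_forced.hyps by simp
  next
    case (run_forced x' C' i' j')
    then show ?thesis using run_forced.IH[of bs' R'' cs'] run_forced.prems run_forced.hyps
      by (metis dag_node.inject(2) local.run_forced(1))
  next
    case (run_coin a b C' i' j' \<beta> bs'' cs'')
    then show ?thesis using run_forced.hyps by (auto simp: determined_def)
  qed
next
  case (run_coin u a b C i j R \<beta> bs w R' cs)
  from run_coin.prems(1) show ?case
  proof (cases rule: run.cases)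
    case run_stop
    then show ?thesis using run_coin.prems by simp
  next
    case (run_forced x' C' i' j')
    then show ?thesis using run_coin.hyps by (auto simp: determined_def)
  next
    case (run_coin a' b' C' i' j' \<beta>' bs'' cs'')
    have eq: "a' = a" "b' = b" "i' = i" "j' = j"
      using run_coin(3) run_coin.hyps(1) by auto
    have "wrong (order_var a b) \<beta> |\<in>| node_clause (D ! w)" "wrong (order_var a b)
        \<beta>' |\<in>| node_clause (D ! w)"
      using run_coin.prems(3) run_coin(2) eq by auto
    then have "\<beta> = \<beta>'"
      using run_coin.prems(4) by (cases \<beta>; cases \<beta>'; auto simp: wrong_def tautology_def)
    then show ?thesis
      using run_coin.IH[of bs'' R'' cs''] run_coin eq run_coin.prems by auto
  qed
qed

text \<open>The size leaves an element outside the t removed ones, the two elements of a forgotten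
  comparison and fewer than t elements with a selector in the clause.\<close>

locale formula_dag =
  fixes t n :: nat and D :: dag
  assumes refutation: "regRD_refutation (formula n) D" and n: "n = 2 * t + 3"
begin

lemma acyclic: "acyclic (edges D)"
  and correct: "\<forall>v<length D. correct_node (formula n) D (D ! v)"
  and regular: "regular_dag D"
  using refutation by (auto simp: regRD_refutation_def)

lemma not_queried_again:
  "(w, v) \<in> (edges D)\<^sup>+ \<Longrightarrow> node_var (D ! w) = Some x \<Longrightarrow>
      node_var (D ! v) \<noteq> Some x"
  using regular_dag_trancl[OF regular acyclic correct] by blast

lemma dag_vars: "v < length D \<Longrightarrow> clause_vars (node_clause (D ! v)) \<subseteq>
    query_vars n"
proof (induction v rule: wf_induct_rule[OF wf_edges[OF acyclic correct]])
  case (1 v)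
  show ?case
  proof (cases "D ! v")
    case (Source C)
    then have "C \<in> formula n" using correct 1(2) by (metis correct_node.simps(1))
    then show ?thesis using Source clause_vars_formula by simp
  next
    case (Derived x C i j)
    note c = correct_nodeD[OF correct 1(2) Derived]
    have "clause_vars C \<subseteq> clause_vars (node_clause (D ! i)) \<union> clause_vars
        (node_clause (D ! j))"
      using c(5) by (auto simp: is_resolvent_def resolvent_def clause_vars_def)
    then show ?thesis using 1(1)[OF c(3,1)] 1(1)[OF c(4,2)] Derived by auto
  qed
qed

lemma query_var:
  assumes "u < length D" "D ! u = Derived x C i j"
  shows "x \<in> query_vars n"
proof -
  note c = correct_nodeD[OF correct assms]
  have "x \<in> clause_vars (node_clause (D ! i))"
    using c(5) by (force simp: is_resolvent_def clause_vars_def)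
  then show ?thesis using dag_vars c(1) by auto
qed

lemma pick_premise:
  assumes "u < length D" "D ! u = Derived x C i j" "x \<notin> clause_vars C"
  shows "pick D x i j \<beta> < length D" "(pick D x i j \<beta>, u) \<in> edges D"
    "node_clause (D ! pick D x i j \<beta>) |\<subseteq>| finsert (wrong x \<beta>) C"
proof -
  note c = correct_nodeD[OF correct assms(1,2)]
  show "pick D x i j \<beta> < length D" "(pick D x i j \<beta>, u) \<in> edges D" using c by (auto
      simp: pick_def)
  have x: "Pos x |\<notin>| C" "Neg x |\<notin>| C" using assms(3) by (force simp: clause_vars_def)+
  show "node_clause (D ! pick D x i j \<beta>) |\<subseteq>| finsert (wrong x \<beta>) C"
    using c(5) x unfolding is_resolvent_def resolvent_def pick_def wrong_def
    by (cases \<beta>) auto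
qed

text \<open>The last conjunct says that every variable of the current clause is resolved on between
  the current node and the sink. By regularity such a variable is not queried at the current node or
  further towards the sources.\<close>

definition inv :: "nat set \<Rightarrow> nat \<Rightarrow> nat list \<Rightarrow> bool" where
  "inv \<sigma> u R \<longleftrightarrow> u < length D \<and> distinct R \<and> set R \<subseteq>
      {..<n} \<and>
     (\<forall>l. l |\<in>| node_clause (D ! u) \<longrightarrow> determined R (lit_var l) \<and>
         \<not> lit_true (val R \<sigma>) l \<and>
        (\<exists>z. (u, z) \<in> (edges D)\<^sup>+ \<and> node_var (D ! z) = Some (lit_var l)))"

lemma inv_not_tautology: "inv \<sigma> u R \<Longrightarrow> \<not> tautology (node_clause (D ! u))"
  unfolding inv_def tautology_def not_lit_true_iff by (metis lit_var_neg neg_neq(1))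

lemma inv_fresh_query:
  assumes "inv \<sigma> u R" "D ! u = Derived x C i j"
  shows "x \<notin> clause_vars C"
proof
  assume "x \<in> clause_vars C"
  then obtain l where l: "l |\<in>| C" "lit_var l = x" by (auto simp: clause_vars_def)
  then obtain z where "(u, z) \<in> (edges D)\<^sup>+" "node_var (D ! z) = Some x"
    using assms by (auto simp: inv_def)
  then show False using not_queried_again[of u z x] assms(2) by simp
qed

text \<open>\<open>xs\<close> is empty for a forced answer and holds the loser after a coin, so both
  kinds of steps are covered.\<close>

lemma inv_pick:
  assumes "inv \<sigma> u R" "D ! u = Derived x C i j" "distinct (xs @ R)" "set xs \<subseteq> {..<n}"
    and "determined (xs @ R) x" "val (xs @ R) \<sigma> x = \<beta>"
  shows "inv \<sigma> (pick D x i j \<beta>) (xs @ R)"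
proof -
  have u: "u < length D" using assms(1) by (simp add: inv_def)
  note p = pick_premise[OF u assms(2) inv_fresh_query[OF assms(1,2)], of \<beta>]
  let ?k = "pick D x i j \<beta>"
  have "determined (xs @ R) (lit_var l) \<and> \<not> lit_true (val (xs @ R) \<sigma>) l \<and>
      (\<exists>z. (?k, z) \<in> (edges D)\<^sup>+ \<and> node_var (D ! z) = Some (lit_var l))"
    if "l |\<in>| node_clause (D ! ?k)" for l
  proof (cases "l = wrong x \<beta>")
    case True
    have "\<not> lit_true (val (xs @ R) \<sigma>) l" unfolding not_lit_true_iff using True assms(6)
        by simp
    moreover have "(?k, u) \<in> (edges D)\<^sup>+" using p(2) by (rule r_into_trancl)
    ultimately show ?thesis using True assms(2,5) by (intro conjI exI[of _ u]) simp_all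
  next
    case False
    then have l: "l |\<in>| C" using that p(3) by auto
    then have d: "determined R (lit_var l)" "\<not> lit_true (val R \<sigma>) l"
      and z: "\<exists>z. (u, z) \<in> (edges D)\<^sup>+ \<and> node_var (D ! z) = Some (lit_var l)"
      using assms(1,2) by (simp_all add: inv_def)
    have "lit_var l \<in> query_vars n"
      using dag_vars[OF u] l assms(2) by (auto simp: clause_vars_def)
    then have "val (xs @ R) \<sigma> (lit_var l) = val R \<sigma> (lit_var l)"
      by (rule val_append[OF d(1) _ assms(3)])
    then have "\<not> lit_true (val (xs @ R) \<sigma>) l" using d(2) lit_true_cong by blast
    moreover obtain z where "(u, z) \<in> (edges D)\<^sup>+" "node_var (D ! z) = Some (lit_var l)"
      using z by blast
    then have "\<exists>z. (?k, z) \<in> (edges D)\<^sup>+ \<and> node_var (D ! z) = Some (lit_var l)"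
      using trancl_into_trancl2[OF p(2)] by blast
    ultimately show ?thesis using determined_append[OF d(1)] by blast
  qed
  moreover have "set R \<subseteq> {..<n}" using assms(1) by (simp add: inv_def)
  ultimately show ?thesis using p(1) assms(3,4) unfolding inv_def by simp
qed

lemma coin_pair:
  assumes "u < length D" "D ! u = Derived (order_var a b) C i j"
  shows "a < b" "b < n"
  using query_var[OF assms] by (auto simp: query_vars_def)

lemma run_inv:
  "run D \<sigma> u R bs w R' cs \<Longrightarrow> inv \<sigma> u R \<Longrightarrow>
     inv \<sigma> w R' \<and> length R' = length R + length bs \<and> (w, u) \<in> (edges
         D)\<^sup>* \<and> (\<exists>xs. R' = xs @ R) \<and>
     (\<forall>(y, \<beta>)\<in>set cs. (\<exists>z. (w, z) \<in> (edges D)\<^sup>+ \<and> node_var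
         (D ! z) = Some y) \<and>
        val R' \<sigma> y = \<beta> \<and> (\<exists>a b. y = order_var a b \<and> a < b \<and> b < n))"
proof (induction rule: run.induct)
  case (run_stop u R)
  then show ?case by auto
next
  case (run_forced u x C i j R bs w R' cs)
  have "inv \<sigma> (pick D x i j (val R \<sigma> x)) R"
    using inv_pick[OF run_forced.prems run_forced.hyps(1), of "[]"] run_forced by (auto simp: inv_def)
  moreover have "(pick D x i j (val R \<sigma> x), u) \<in> edges D"
    using pick_premise(2) run_forced.prems run_forced.hyps(1) inv_fresh_query by (auto simp: inv_def)
  ultimately show ?case using run_forced.IH by (auto intro: rtrancl_into_rtrancl)
next
  case (run_coin u a b C i j R \<beta> bs w R' cs)
  have u: "u < length D" using run_coin.prems by (simp add: inv_def)
  note ab = coin_pair[OF u run_coin.hyps(1)]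
  let ?c = "if \<beta> then b else a"
  let ?k = "pick D (order_var a b) i j \<beta>"
  have rank0: "rank R a = 0" "rank R b = 0"
    using run_coin.hyps(2,3) rank_pos_iff[of R a] rank_pos_iff[of R b] by auto
  have v: "val ([?c] @ R) \<sigma> (order_var a b) = \<beta>" using ab(1) rank0 by auto
  have d: "determined ([?c] @ R) (order_var a b)" by (auto simp: determined_def)
  have dist: "distinct ([?c] @ R)" "set [?c] \<subseteq> {..<n}"
    using run_coin.hyps(2,3) run_coin.prems ab by (auto simp: inv_def)
  have k: "inv \<sigma> ?k (?c # R)"
    using inv_pick[OF run_coin.prems run_coin.hyps(1) dist d v] by simp
  note IH = run_coin.IH[OF k]
  have e: "(?k, u) \<in> edges D"
    using pick_premise(2) run_coin.prems run_coin.hyps(1) inv_fresh_query u by blast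
  obtain xs where xs: "R' = xs @ ?c # R" using IH by auto
  have "(w, ?k) \<in> (edges D)\<^sup>*" using IH by simp
  then have "(w, u) \<in> (edges D)\<^sup>+" using e by auto
  moreover have "val (xs @ ([?c] @ R)) \<sigma> (order_var a b) = \<beta>"
    using val_append[OF d query_var[OF u run_coin.hyps(1)], of xs \<sigma>] IH v xs by (simp add:
        inv_def)
  ultimately show ?case
    using IH xs ab run_coin.hyps(1)
    by (auto intro: trancl_into_rtrancl)
qed

text \<open>A walk cannot get stuck at a source: a falsified clause of the formula needs an element
  with strictly smaller rank than all others, which puts n - 1 elements into \<open>R\<close>, while
  \<open>R\<close> has at most t.\<close>

lemma run_exists:
  "inv \<sigma> u R \<Longrightarrow> length R + length bs \<le> t \<Longrightarrow> \<exists>w R'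
      cs. run D \<sigma> u R bs w R' cs"
proof (induction u arbitrary: R bs rule: wf_induct_rule[OF wf_edges[OF acyclic correct]])
  case (1 u)
  have u: "u < length D" using 1(2) by (simp add: inv_def)
  show ?case
  proof (cases "bs = []")
    case True
    then show ?thesis using run_stop by blast
  next
    case False
    show ?thesis
    proof (cases "D ! u")
      case (Source C)
      then have C: "C \<in> formula n" using correct u by (metis correct_node.simps(1))
      have R: "distinct R" using 1(2) by (simp add: inv_def)
      obtain a where a: "a < n" "\<forall>b<n. b \<noteq> a \<longrightarrow> rank R a < rank R b"
      proof (rule formula_true[OF C R])
        show "rank R a \<noteq> rank R b" if "lt a b |\<in>| C" "a \<noteq> b" for a b
          using that 1(2) Source by (intro determined_lt) (auto simp: inv_def)
        show "\<not> lit_true (val R \<sigma>) l" if "l |\<in>| C" for l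
          using that 1(2) Source by (auto simp: inv_def)
      qed auto
      have "{..<n} - {a} \<subseteq> set R"
      proof
        fix b assume "b \<in> {..<n} - {a}"
        then have "rank R a < rank R b" using a by auto
        then show "b \<in> set R" using rank_pos_iff[of R b] by simp
      qed
      then have "card ({..<n} - {a}) \<le> card (set R)" by (intro card_mono) auto
      also have "\<dots> \<le> length R" by (rule card_length)
      finally have False using a(1) 1(3) n by simp
      then show ?thesis ..
    next
      case (Derived x C i j)
      note p = pick_premise[OF u Derived inv_fresh_query[OF 1(2) Derived]]
      show ?thesis
      proof (cases "determined R x")
        case True
        have "inv \<sigma> (pick D x i j (val R \<sigma> x)) R"
          using inv_pick[OF 1(2) Derived, of "[]"] True 1(2) by (auto simp: inv_def)
        then show ?thesis
          using 1(1)[OF p(2)] 1(3) run_forced[OF Derived True False] by blast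
      next
        case nd: False
        then obtain a b where x: "x = order_var a b" "a \<notin> set R" "b \<notin> set R"
          by (auto simp: determined_def)
        obtain \<beta> bs' where bs: "bs = \<beta> # bs'" using False by (cases bs) auto
        note ab = coin_pair[OF u Derived[unfolded x(1)]]
        let ?c = "if \<beta> then b else a"
        have rank0: "rank R a = 0" "rank R b = 0"
          using x rank_pos_iff[of R a] rank_pos_iff[of R b] by auto
        have "inv \<sigma> (pick D x i j \<beta>) ([?c] @ R)"
        proof (rule inv_pick[OF 1(2) Derived])
          show "distinct ([?c] @ R)" "set [?c] \<subseteq> {..<n}" using x ab 1(2) by (auto simp:
              inv_def)
          show "determined ([?c] @ R) x" using x by (auto simp: determined_def)
          show "val ([?c] @ R) \<sigma> x = \<beta>" using x ab rank0 by auto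
        qed
        then have "\<exists>w R' cs. run D \<sigma> (pick D x i j \<beta>) (?c # R) bs' w R' cs"
          using 1(1)[OF p(2)] 1(3) bs by simp
        then show ?thesis using run_coin[OF Derived[unfolded x(1)] x(2,3)] x(1) bs by blast
      qed
    qed
  qed
qed

end

section \<open>Counting the outcomes that reach a node\<close>

context formula_dag
begin

text \<open>A total assignment falsifies a premise of every inference whose conclusion it falsifies,
  which leads to a source. A variable of that source either persists down to \<open>w\<close> or is
  resolved on along the way.\<close>

lemma falsified_source:
  "w < length D \<Longrightarrow> (\<And>l. l |\<in>| node_clause (D ! w) \<Longrightarrow> \<not>
      lit_true v l) \<Longrightarrow>
     \<exists>C\<in>formula n. (\<forall>l. l |\<in>| C \<longrightarrow> \<not> lit_true v l) \<and>
       (\<forall>y\<in>clause_vars C. y \<in> clause_vars (node_clause (D ! w)) \<or>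
          (\<exists>z. (z, w) \<in> (edges D)\<^sup>* \<and> node_var (D ! z) = Some y))"
proof (induction w rule: wf_induct_rule[OF wf_edges[OF acyclic correct]])
  case (1 w)
  show ?case
  proof (cases "D ! w")
    case (Source C)
    then show ?thesis using 1 correct by (metis correct_node.simps(1) node_clause.simps(1))
  next
    case (Derived x C i j)
    note c = correct_nodeD[OF correct 1(2) Derived]
    have false: "\<not> lit_true v l" if "l |\<in>| C" for l using 1(3) Derived that by simp
    obtain k where k: "k < length D" "(k, w) \<in> edges D"
      "\<And>l. l |\<in>| node_clause (D ! k) \<Longrightarrow> \<not> lit_true v l"
      "\<And>l. l |\<in>| node_clause (D ! k) \<Longrightarrow> l |\<in>| C \<or> lit_var l = x"
    proof -
      have "\<exists>k\<in>{i, j}. \<forall>l. l |\<in>| node_clause (D ! k) \<longrightarrow> l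
          |\<in>| C \<or> l = wrong x (v x)"
        using c(5) unfolding is_resolvent_def resolvent_def wrong_def by (cases "v x") auto
      then obtain k where "k = i \<or> k = j" and *: "\<And>l. l |\<in>| node_clause (D ! k)
          \<Longrightarrow> l |\<in>| C \<or> l = wrong x (v x)"
        by blast
      then have "k < length D" "(k, w) \<in> edges D" using c by auto
      moreover have "\<not> lit_true v l" if "l |\<in>| node_clause (D ! k)" for l
        using *[OF that] false by (cases "v x") (auto simp: wrong_def)
      moreover have "l |\<in>| C \<or> lit_var l = x" if "l |\<in>| node_clause (D ! k)" for l
        using *[OF that] by auto
      ultimately show thesis by (rule that)
    qed
    obtain E where E: "E \<in> formula n" "\<forall>l. l |\<in>| E \<longrightarrow> \<not> lit_true v l"
       "\<forall>y\<in>clause_vars E. y \<in> clause_vars (node_clause (D ! k)) \<or>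
          (\<exists>z. (z, k) \<in> (edges D)\<^sup>* \<and> node_var (D ! z) = Some y)"
      using 1(1)[OF k(2,1,3)] by blast
    have "y \<in> clause_vars C \<or> (\<exists>z. (z, w) \<in> (edges D)\<^sup>* \<and> node_var
        (D ! z) = Some y)"
      if "y \<in> clause_vars E" for y
    proof -
      consider "y \<in> clause_vars (node_clause (D ! k))"
        | z where "(z, k) \<in> (edges D)\<^sup>*" "node_var (D ! z) = Some y"
        using E(3) \<open>y \<in> clause_vars E\<close> by blast
      then show ?thesis
      proof cases
        case 1
        then have "y \<in> clause_vars C \<or> y = x" using k(4) by (auto simp: clause_vars_def)
        then show ?thesis using Derived by auto
      next
        case 2
        then show ?thesis using k(2) by (meson rtrancl_into_rtrancl)
      qed
    qed
    then show ?thesis using E(1,2) Derived by auto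
  qed
qed

definition touched :: "nat \<Rightarrow> nat set" where
  "touched w = {a. \<exists>y. guard_var a y \<in> clause_vars (node_clause (D ! w))}"

lemma finite_touched: "finite (touched w)"
proof -
  have "touched w \<subseteq> (\<lambda>x. fst (prod_decode (x div 3))) ` clause_vars (node_clause
      (D ! w))"
  proof
    fix a assume "a \<in> touched w"
    then obtain y where "guard_var a y \<in> clause_vars (node_clause (D ! w))" by (auto simp:
        touched_def)
    moreover have "guard_var a y div 3 = prod_encode (a, y)" unfolding guard_var_def by presburger
    then have "a = fst (prod_decode (guard_var a y div 3))" by simp
    ultimately show "a \<in> (\<lambda>x. fst (prod_decode (x div 3))) ` clause_vars (node_clause
        (D ! w))" by blast
  qed
  then show ?thesis by (rule finite_subset) (simp add: clause_vars_def)
qed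

text \<open>If a comparison \<open>y\<close> has been forgotten at \<open>w\<close>, an untouched element \<open>a\<close> can
  be made minimal and its selector pointed at \<open>y\<close>; the only clauses left to falsify then
  require querying \<open>y\<close> again.\<close>

lemma forgotten_comparison:
  assumes "inv \<sigma> w R" "length R = t" "(w, z) \<in> (edges D)\<^sup>+" "node_var (D ! z) = Some y"
    and y: "y = order_var c d" "c < d" "d < n" "y \<notin> clause_vars (node_clause (D ! w))"
  shows "t \<le> card (touched w)"
proof (rule ccontr)
  assume "\<not> t \<le> card (touched w)"
  have w: "w < length D" and R: "distinct R" "set R \<subseteq> {..<n}" using assms(1) by (auto
      simp: inv_def)
  have "card (set R \<union> {c, d} \<union> touched w) \<le> card (set R \<union> {c, d}) + card
      (touched w)"
    by (rule card_Un_le)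
  also have "\<dots> \<le> card (set R) + card {c, d} + card (touched w)"
    using card_Un_le[of "set R" "{c, d}"] by simp
  also have "\<dots> \<le> t + 2 + card (touched w)"
    using assms(2) card_length[of R] y(2) by simp
  \<comment> \<open>Here t + 2 + (t - 1) < 2t + 3 enters.\<close>
  also have "\<dots> < card {..<n}" using \<open>\<not> t \<le> card (touched w)\<close> n by simp
  finally have "\<not> {..<n} \<subseteq> set R \<union> {c, d} \<union> touched w"
    using finite_touched by (meson card_mono finite.emptyI finite_insert finite_UnI finite_set not_less)
  then obtain a where a: "a < n" "a \<notin> set R" "a \<noteq> c" "a \<noteq> d" "a \<notin>
      touched w" by auto
  obtain xs where xs: "set xs = {..<n} - insert a (set R)" "distinct xs"
    using finite_distinct_list[of "{..<n} - insert a (set R)"] by auto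
  \<comment> \<open>All elements are ranked now. \<open>a\<close> stands first and is therefore
    least, and \<open>R\<close> stays at the end, so that determined comparisons keep their
    values.\<close>
  define L where "L = (a # xs) @ R"
  have L: "distinct L" "set L = {..<n}" using xs R a by (auto simp: L_def)
  \<comment> \<open>Only selectors of \<open>a\<close> change, and none of them occurs in the clause
    at \<open>w\<close>, which thus remains falsified.\<close>
  define \<tau> where "\<tau> = {g \<in> \<sigma>. \<forall>x. g \<noteq> guard_var a x} \<union>
      {guard_var a y}"
  have "\<not> lit_true (val L \<tau>) l" if l: "l |\<in>| node_clause (D ! w)" for l
  proof -
    have d: "determined R (lit_var l)" "\<not> lit_true (val R \<sigma>) l" using assms(1) l by
        (auto simp: inv_def)
    have q: "lit_var l \<in> query_vars n" "lit_var l \<in> clause_vars (node_clause (D ! w))"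
      using dag_vars[OF w] l by (auto simp: clause_vars_def)
    have "val L \<tau> (lit_var l) = val R \<tau> (lit_var l)"
      unfolding L_def by (rule val_append[OF d(1) q(1)]) (use L in \<open>simp add: L_def\<close>)
    also have "\<dots> = val R \<sigma> (lit_var l)"
    proof -
      consider b e where "lit_var l = order_var b e" | b x where "lit_var l = guard_var b x" "b
          \<noteq> a"
        | "lit_var l = 2"
        using q a(5) unfolding query_vars_def touched_def by fastforce
      then show ?thesis by cases (auto simp: \<tau>_def)
    qed
    finally show ?thesis using d(2) lit_true_cong by blast
  qed
  from falsified_source[OF w this] obtain C where C: "C \<in> formula n"
    "\<And>l. l |\<in>| C \<Longrightarrow> \<not> lit_true (val L \<tau>) l"
    "\<forall>y\<in>clause_vars C. y \<in> clause_vars (node_clause (D ! w)) \<or>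
          (\<exists>z. (z, w) \<in> (edges D)\<^sup>* \<and> node_var (D ! z) = Some y)"
    by blast
  have "y \<in> clause_vars C"
  proof (rule formula_true[OF C(1) L(1) _ C(2)])
    have "clause_vars C \<subseteq> query_vars n" by (rule clause_vars_formula[OF C(1)])
    then show "rank L b \<noteq> rank L e" if "lt b e |\<in>| C" "b \<noteq> e" for b e
    proof -
      have "lit_var (lt b e) \<in> query_vars n"
        using that \<open>clause_vars C \<subseteq> query_vars n\<close> by (auto simp: clause_vars_def)
      then have "b \<in> set L \<or> e \<in> set L"
        using L(2) by (auto simp: query_vars_def lit_var_lt min_def max_def split: if_splits)
      then show ?thesis using rank_inj that by blast
    qed
    fix b assume b: "b < n" "C = selector_clause n b \<or> (\<exists>y\<in>guards n b. \<exists>l.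
        lit_var l = y \<and> C = guarded n b y l)"
      and min: "\<forall>e<n. e \<noteq> b \<longrightarrow> rank L b < rank L e"
    have "rank L a = 1" by (simp add: L_def)
    moreover have "0 < rank L b" using rank_pos_iff[of L b] L b by auto
    ultimately have [simp]: "b = a" using min a(1) by (metis less_one less_nat_zero_code less_trans)
    have g: "guard_var a y \<in> \<tau>" by (simp add: \<tau>_def)
    show ?thesis using b(2)
    proof
      assume "C = selector_clause n b"
      moreover have "y \<in> guards n a" using y a by (auto simp: guards_def)
      ultimately have "Pos (guard_var a y) |\<in>| C" by (auto simp: fset_selector_clause)
      then show ?thesis using C(2)[of "Pos (guard_var a y)"] g by simp
    next
      assume "\<exists>y\<in>guards n b. \<exists>l. lit_var l = y \<and> C = guarded n b y l"
      then obtain l where l: "C = guarded n a (lit_var l) l" by auto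
      then have "Neg (guard_var a (lit_var l)) |\<in>| C" by (simp add: guarded_def)
      from C(2)[OF this] have "guard_var a (lit_var l) \<in> \<tau>" by simp
      then have "lit_var l = y" by (simp add: \<tau>_def)
      then show ?thesis using l by (auto simp: guarded_def clause_vars_finsert)
    qed
  qed
  \<comment> \<open>Now \<open>y\<close> is resolved on at \<open>z'\<close>, at \<open>w\<close> or
    on its source side, and again at \<open>z\<close> on its sink side, against regularity.\<close>
  then obtain z' where "(z', w) \<in> (edges D)\<^sup>*" "node_var (D ! z') = Some y"
    using C(3) y(4) by blast
  then show False using assms(3,4) not_queried_again[of z' z y] by (meson rtrancl_trancl_trancl)
qed

definition selectors :: "nat set" where
  "selectors = {guard_var a y |a y. a < n \<and> y \<in> guards n a}"

lemma finite_selectors: "finite selectors"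
proof -
  have "selectors \<subseteq> formula_vars n" using guard_var_in by (auto simp: selectors_def)
  then show ?thesis using finite_formula_vars finite_subset by blast
qed

definition outcomes :: "nat \<Rightarrow> nat \<Rightarrow> (bool list \<times> nat set) set" where
  "outcomes s w = {(bs, \<sigma>). length bs = t \<and> \<sigma> \<subseteq> selectors \<and>
      (\<exists>R cs. run D \<sigma> s [] bs w R cs)}"

text \<open>If t elements are touched, choose one selector for each: the clause is falsified, so it
  dictates their values, and the t lost bits of \<open>\<sigma>\<close> outweigh the t free coins.
  Otherwise no comparison decided by a coin has been forgotten, and \<open>\<sigma>\<close> alone
  determines the coins.\<close>

lemma card_outcomes_le:
  assumes s: "s < length D" "node_clause (D ! s) = {||}"
  shows "finite (outcomes s w) \<and> card (outcomes s w) \<le> 2 ^ card selectors"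
proof (cases "t \<le> card (touched w)")
  case True
  have inv_s: "inv \<sigma> s []" for \<sigma> using s by (simp add: inv_def)
  obtain A where A: "A \<subseteq> touched w" "card A = t" "finite A"
    by (rule obtain_subset_with_card_n[OF True])
  then have "\<forall>a\<in>A. \<exists>y. guard_var a y \<in> clause_vars (node_clause (D ! w))"
    by (auto simp: touched_def)
  from bchoice[OF this] obtain g
    where "\<forall>a\<in>A. guard_var a (g a) \<in> clause_vars (node_clause (D ! w))" ..
  then have g: "\<And>a. a \<in> A \<Longrightarrow> guard_var a (g a) \<in> clause_vars
      (node_clause (D ! w))" by blast
  define T where "T = (\<lambda>a. guard_var a (g a)) ` A"
  have T: "card T = t" unfolding T_def using A by (subst card_image) (auto simp: inj_on_def)
  show ?thesis
  proof (cases "outcomes s w = {}")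
    case False
    then obtain bs \<sigma> R cs where "run D \<sigma> s [] bs w R cs" unfolding outcomes_def by blast
    from run_inv[OF this inv_s] have w: "w < length D" by (simp add: inv_def)
    have TS: "T \<subseteq> selectors"
    proof
      fix x assume "x \<in> T"
      then obtain a where a: "x = guard_var a (g a)" "a \<in> A" by (auto simp: T_def)
      then have "guard_var a (g a) \<in> query_vars n" using g dag_vars[OF w] by blast
      then have "a < n" "g a \<in> guards n a" by (auto simp: query_vars_def)
      then show "x \<in> selectors" unfolding a(1) selectors_def by blast
    qed
    define T0 where "T0 = {y \<in> T. Neg y |\<in>| node_clause (D ! w)}"
    \<comment> \<open>The right-hand side depends on the clause only: a selector in a falsified
      clause is true exactly when it occurs negated.\<close>
    have fixed: "\<sigma> \<inter> T = T0" if o: "(bs, \<sigma>) \<in> outcomes s w" for bs \<sigma>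
    proof -
      obtain R cs where "run D \<sigma> s [] bs w R cs" using o unfolding outcomes_def by blast
      then have i: "inv \<sigma> w R" using run_inv inv_s by blast
      have "y \<in> \<sigma> \<longleftrightarrow> Neg y |\<in>| node_clause (D ! w)" if y: "y
          \<in> T" for y
      proof -
        obtain a where a: "y = guard_var a (g a)" "a \<in> A" using y by (auto simp: T_def)
        obtain l where l: "l |\<in>| node_clause (D ! w)" "lit_var l = y"
          using g[OF a(2)] a(1) by (auto simp: clause_vars_def)
        have f: "\<not> lit_true (val R \<sigma>) m" if "m |\<in>| node_clause (D ! w)" for m
          using i that by (simp add: inv_def)
        have v: "val R \<sigma> y \<longleftrightarrow> y \<in> \<sigma>" using a(1) by simp
        show ?thesis
        proof
          assume "y \<in> \<sigma>"
          then have "l \<noteq> Pos y" using f[OF l(1)] v by auto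
          then show "Neg y |\<in>| node_clause (D ! w)" using l by (cases l) auto
        next
          assume "Neg y |\<in>| node_clause (D ! w)"
          then show "y \<in> \<sigma>" using f[of "Neg y"] v by auto
        qed
      qed
      then show ?thesis unfolding T0_def by blast
    qed
    let ?B = "{bs :: bool list. length bs = t}"
    have B: "finite ?B" "card ?B = 2 ^ t"
      using finite_lists_length_eq[of "UNIV :: bool set" t] card_lists_length_eq[of "UNIV :: bool set" t]
      by simp_all
    have inj: "inj_on (\<lambda>(bs, \<sigma>). (bs, \<sigma> - T)) (outcomes s w)"
    proof (rule inj_onI)
      fix p q assume p: "p \<in> outcomes s w" and q: "q \<in> outcomes s w"
        and eq: "(case p of (bs, \<sigma>) \<Rightarrow> (bs, \<sigma> - T)) = (case q of (bs,
            \<sigma>) \<Rightarrow> (bs, \<sigma> - T))"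
      obtain bs \<sigma> bs' \<sigma>' where pq: "p = (bs, \<sigma>)" "q = (bs', \<sigma>')" by
          (cases p; cases q)
      have "\<sigma> \<inter> T = \<sigma>' \<inter> T" using fixed[of bs \<sigma>] fixed[of bs'
          \<sigma>'] p q pq by simp
      moreover have "\<sigma> - T = \<sigma>' - T" "bs = bs'" using eq pq by auto
      ultimately show "p = q" using pq by blast
    qed
    have im: "(\<lambda>(bs, \<sigma>). (bs, \<sigma> - T)) ` outcomes s w \<subseteq> ?B \<times>
        Pow (selectors - T)"
      by (auto simp: outcomes_def)
    have fin: "finite (?B \<times> Pow (selectors - T))" using B(1) finite_selectors by simp
    have "card (outcomes s w) \<le> card (?B \<times> Pow (selectors - T))"
      by (rule card_inj_on_le[OF inj im fin])
    also have "\<dots> = 2 ^ t * 2 ^ card (selectors - T)"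
      using B finite_selectors by (simp add: card_cartesian_product card_Pow)
    also have "card (selectors - T) = card selectors - t"
      using card_Diff_subset[OF finite_subset[OF TS finite_selectors] TS] T by simp
    also have "2 ^ t * 2 ^ (card selectors - t) = (2::nat) ^ card selectors"
    proof -
      have "t \<le> card selectors" using card_mono[OF finite_selectors TS] T by simp
      then show ?thesis by (simp flip: power_add)
    qed
    finally have "card (outcomes s w) \<le> 2 ^ card selectors" .
    moreover have "finite (outcomes s w)" using inj_on_finite[OF inj im fin] .
    ultimately show ?thesis by simp
  qed simp
next
  case False
  have *: "(\<forall>(y, \<beta>)\<in>set cs. wrong y \<beta> |\<in>| node_clause (D ! w)) \<and>
      \<not> tautology (node_clause (D ! w))"
    if r: "run D \<sigma> s [] bs w R cs" "length bs = t" for \<sigma> bs R cs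
  proof -
    have "inv \<sigma> s []" using s by (simp add: inv_def)
    note ri = run_inv[OF r(1) this]
    have i: "inv \<sigma> w R" "length R = t" using ri r(2) by simp_all
    from ri have all: "\<forall>(y, \<beta>)\<in>set cs. (\<exists>z. (w, z) \<in> (edges
        D)\<^sup>+ \<and> node_var (D ! z) = Some y) \<and>
        val R \<sigma> y = \<beta> \<and> (\<exists>a b. y = order_var a b \<and> a < b \<and> b <
            n)" by blast
    have "wrong y \<beta> |\<in>| node_clause (D ! w)" if cs: "(y, \<beta>) \<in> set cs" for y \<beta>
    proof -
      have yb: "(\<exists>z. (w, z) \<in> (edges D)\<^sup>+ \<and> node_var (D ! z) = Some y) \<and>
        val R \<sigma> y = \<beta> \<and> (\<exists>a b. y = order_var a b \<and> a < b \<and> b < n)"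
        using bspec[OF all cs] by simp
      then obtain z where z: "(w, z) \<in> (edges D)\<^sup>+" "node_var (D ! z) = Some y" by blast
      from yb obtain c d where cd: "y = order_var c d" "c < d" "d < n" by blast
      then have "y \<in> clause_vars (node_clause (D ! w))"
        using forgotten_comparison[OF i z cd] False by blast
      then obtain l where l: "l |\<in>| node_clause (D ! w)" "lit_var l = y" by (auto simp:
          clause_vars_def)
      then have "\<not> lit_true (val R \<sigma>) l" using i(1) by (simp add: inv_def)
      then have "l = wrong y \<beta>" using l(2) yb by (simp add: not_lit_true_iff)
      then show ?thesis using l by simp
    qed
    then show ?thesis using inv_not_tautology[OF i(1)] by blast
  qed
  have inj: "inj_on snd (outcomes s w)"
  proof (rule inj_onI)
    fix p q assume p: "p \<in> outcomes s w" and q: "q \<in> outcomes s w" and eq: "snd p = snd q"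
    obtain bs \<sigma> bs' where pq: "p = (bs, \<sigma>)" "q = (bs', \<sigma>)" using eq by (cases
        p; cases q) auto
    obtain R cs R' cs' where r: "run D \<sigma> s [] bs w R cs" "run D \<sigma> s [] bs' w R' cs'"
      "length bs = t" "length bs' = t"
      using p q pq by (auto simp: outcomes_def)
    have "bs = bs'"
    proof (rule run_injective[OF r(1,2)])
      show "\<forall>(y, \<beta>)\<in>set cs \<union> set cs'. wrong y \<beta> |\<in>| node_clause
          (D ! w)"
        using *[OF r(1,3)] *[OF r(2,4)] by blast
    qed (use *[OF r(1,3)] r(3,4) in simp_all)
    then show "p = q" using pq by simp
  qed
  have im: "snd ` outcomes s w \<subseteq> Pow selectors" by (auto simp: outcomes_def)
  have fin: "finite (Pow selectors)" using finite_selectors by simp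
  have "card (outcomes s w) \<le> card (Pow selectors)" by (rule card_inj_on_le[OF inj im fin])
  then show ?thesis using inj_on_finite[OF inj im fin] finite_selectors by (simp add: card_Pow)
qed

text \<open>Every pair of t coins and a set of selectors reaches some node, so the outcome sets
  cover all 2^t * 2^s pairs, while each has at most 2^s elements.\<close>

lemma size_lower_bound: "2 ^ t \<le> length D"
proof -
  obtain s where s: "s < length D" "node_clause (D ! s) = {||}"
    using refutation by (auto simp: regRD_refutation_def)
  let ?B = "{bs :: bool list. length bs = t}"
  have B: "finite ?B" "card ?B = 2 ^ t"
    using finite_lists_length_eq[of "UNIV :: bool set" t] card_lists_length_eq[of "UNIV :: bool set" t]
    by simp_all
  have "?B \<times> Pow selectors \<subseteq> (\<Union>w<length D. outcomes s w)"
  proof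
    fix p assume "p \<in> ?B \<times> Pow selectors"
    then obtain bs \<sigma> where p: "p = (bs, \<sigma>)" "length bs = t" "\<sigma> \<subseteq>
        selectors" by auto
    have i: "inv \<sigma> s []" using s by (simp add: inv_def)
    have "\<exists>w R cs. run D \<sigma> s [] bs w R cs" using run_exists[OF i, of bs] p(2) by simp
    then obtain w R cs where r: "run D \<sigma> s [] bs w R cs" by blast
    then have "w < length D" using run_inv[OF r i] by (simp add: inv_def)
    then show "p \<in> (\<Union>w<length D. outcomes s w)" using p r by (auto simp: outcomes_def)
  qed
  moreover have fin: "finite (\<Union>w<length D. outcomes s w)" using card_outcomes_le[OF s] by blast
  ultimately have "card (?B \<times> Pow selectors) \<le> card (\<Union>w<length D. outcomes s w)"
    by (intro card_mono)
  also have "\<dots> \<le> (\<Sum>w<length D. card (outcomes s w))" by (rule card_UN_le) simp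
  also have "\<dots> \<le> (\<Sum>w<length D. 2 ^ card selectors)" using card_outcomes_le[OF s] by
      (intro sum_mono) auto
  finally have "2 ^ t * 2 ^ card selectors \<le> length D * (2::nat) ^ card selectors"
    using B finite_selectors by (simp add: card_cartesian_product card_Pow)
  then show ?thesis by simp
qed

end

section \<open>Exponential against polynomial growth, and the separation\<close>

lemma power_over_exp: "(\<lambda>t. real t ^ i / 2 ^ t) \<longlonglongrightarrow> 0"
proof -
  have "filterlim (\<lambda>t. real t * ln 2) at_top sequentially"
    using filterlim_tendsto_pos_mult_at_top[OF tendsto_const[of "ln (2::real)"] _
        filterlim_real_sequentially]
    by (simp add: mult.commute)
  then have "(\<lambda>t. (real t * ln 2) ^ i / exp (real t * ln 2)) \<longlonglongrightarrow> 0"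
    by (rule filterlim_compose[OF tendsto_power_div_exp_0])
  then have "(\<lambda>t. inverse (ln 2 ^ i) * ((real t * ln 2) ^ i / exp (real t * ln 2)))
      \<longlonglongrightarrow> inverse (ln 2 ^ i) * 0"
    by (intro tendsto_mult tendsto_const)
  moreover have "inverse (ln 2 ^ i) * ((real t * ln 2) ^ i / exp (real t * ln 2)) = real t ^ i / 2
      ^ t" for t
    by (simp add: exp_of_nat_mult power_mult_distrib field_simps)
  ultimately show ?thesis by simp
qed

lemma not_poly_bounded:
  fixes p :: "nat poly"
  shows "\<exists>t. \<forall>m\<le>100 * (2 * t + 3) ^ 6. poly p m < 2 ^ t"
proof -
  have mono: "poly p m \<le> poly p m'" if "m \<le> m'" for m m'
    using that unfolding poly_altdef by (intro sum_mono mult_le_mono power_mono) auto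
  define q where "q = pcompose p (smult 100 ([:3, 2:] ^ 6))"
  have q: "poly q t = poly p (100 * (2 * t + 3) ^ 6)" for t
    by (simp add: q_def poly_pcompose poly_power add.commute mult.commute)
  have tends: "(\<lambda>t. real (poly q t) / 2 ^ t) \<longlonglongrightarrow> 0"
  proof -
    have "(\<lambda>t. real (coeff q i) * (real t ^ i / 2 ^ t)) \<longlonglongrightarrow> real
        (coeff q i) * 0" for i
      by (intro tendsto_mult tendsto_const power_over_exp)
    then have "(\<lambda>t. \<Sum>i\<le>degree q. real (coeff q i) * (real t ^ i / 2 ^ t))
        \<longlonglongrightarrow> (\<Sum>i\<le>degree q. real (coeff q i) * 0)"
      by (intro tendsto_sum)
    then show ?thesis by (simp add: poly_altdef sum_divide_distrib)
  qed
  then obtain t where "real (poly q t) / 2 ^ t < 1"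
    using order_tendstoD(2)[OF tends, of 1] eventually_happens[of _ sequentially] by auto
  then have "poly q t < 2 ^ t"
    by (simp add: divide_less_eq)
  then show ?thesis using mono q by (metis order_le_less_trans)
qed

theorem theorem5p4: "strictly_weaker regRD regWRTI"
  unfolding strictly_weaker_def
proof
  show "p_simulates regWRTI regRD" by (rule regWRTI_p_simulates_regRD)
  show "\<not> simulates regRD regWRTI"
  proof
    assume "simulates regRD regWRTI"
    then obtain p :: "nat poly" where p: "\<forall>F n. (\<exists>T. regWRTI_refutation F T \<and>
        length (post_order T) = n) \<longrightarrow>
        (\<exists>D. regRD_refutation F D \<and> length D \<le> poly p n)"
      by (auto simp: simulates_def regRD_def regWRTI_def)
    obtain t where t: "\<forall>m\<le>100 * (2 * t + 3) ^ 6. poly p m < 2 ^ t"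
      using not_poly_bounded by blast
    obtain T where T: "regWRTI_refutation (formula (2 * t + 3)) T"
      "length (post_order T) \<le> 100 * (2 * t + 3) ^ 6"
      using formula_regWRTI[of "2 * t + 3"] by auto
    obtain D where D: "regRD_refutation (formula (2 * t + 3)) D" "length D \<le> poly p (length
        (post_order T))"
      using p T(1) by blast
    interpret formula_dag t "2 * t + 3" D by unfold_locales (use D(1) in auto)
    show False using size_lower_bound D(2) t T(2) by (meson leD le_less_trans)
  qed
qed

end
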